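(* Let $(S,\omega)$ be a symplectic manifold with commuting symplectic actions of two Lie groups $G$ (acting on the right) and $H$ (acting on the left) that are mutually completely orthogonal, i.e. $\mathfrak g_S=\mathfrak h_S^{\omega}$ and $\mathfrak h_S=\mathfrak g_S^{\omega}$, and that admit equivariant momentum maps $\mathbf J_R:S\to\mathfrak g^*$ (for $G$) and $\mathbf J_L:S\to\mathfrak h^*$ (for $H$). Assume that $G$ acts transitively on the level sets of $\mathbf J_L$, while $H$ is connected and acts transitively on the connected components of the level sets of $\mathbf J_R$. Let $\sigma\in\mathfrak g^*$ with stabilizer $G_\sigma$, and assume that $\mathbf J_R^{-1}(\sigma)$ is a submanifold of $S$ and that $S_\sigma=\mathbf J_R^{-1}(\sigma)/G_\sigma$ carries the quotient manifold structure. Then each connected component of the reduced symplectic manifold $S_\sigma=\mathbf J_R^{-1}(\sigma)/G_\sigma$ is symplectically diffeomorphic to a coadjoint orbit of $H$.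
   Context: Manifolds and Lie groups may be infinite dimensional (e.g. Fréchet), and symplectic forms may be weak. $\mathfrak g,\mathfrak h$ are the Lie algebras of $G,H$. For $\xi\in\mathfrak g$, $\xi_S$ denotes the infinitesimal generator vector field on $S$, and $\mathfrak g_S(s)=\{\xi_S(s):\xi\in\mathfrak g\}\subset T_sS$; similarly $\mathfrak h_S(s)$. For a subspace $V\subset T_sS$, $V^{\omega}=\{w\in T_sS:\omega(w,v)=0\ \forall v\in V\}$; the identities $\mathfrak g_S=\mathfrak h_S^\omega$, $\mathfrak h_S=\mathfrak g_S^\omega$ are required at every point. $G_\sigma$ is the isotropy group of $\sigma$ for the coadjoint action. The reduced symplectic form $\omega_\sigma$ on $S_\sigma$ is the one whose pullback to $\mathbf J_R^{-1}(\sigma)$ is the restriction of $\omega$; on generators of $H$ it reads $(\omega_\sigma)_{[x]}([\xi_S(x)],[\eta_S(x)])=\omega_x(\xi_S(x),\eta_S(x))=\langle\mathbf J_L(x),[\xi,\eta]\rangle$ for $\xi,\eta\in\mathfrak h$. Coadjoint orbits carry their orbit (Kirillov–Kostant–Souriau) symplectic form. *)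

theory Defs
  imports "HOL-Analysis.Analysis" "HOL-Algebra.Group"
begin

section \<open>Locally convex spaces and smooth maps between them\<close>

text \<open>Hausdorff locally convex real topological vector spaces; no completeness is required, so
  Euclidean, Banach and Frechet spaces are all included.\<close>

class lctvs = real_vector + topological_ab_group_add + t2_space +
  assumes tendsto_scaleR_Pair_lctvs:
      "((\<lambda>p. fst p *\<^sub>R snd p) \<longlongrightarrow> a *\<^sub>R x) (nhds a \<times>\<^sub>F nhds x)"
    and locally_convex:
      "open U \<Longrightarrow> x \<in> U \<Longrightarrow>
        \<exists>C. (\<forall>y\<in>C. \<forall>z\<in>C. \<forall>u\<ge>0. \<forall>v\<ge>0. u + v = 1 \<longrightarrow> u *\<^sub>R y + v *\<^sub>R z \<in> C) \<and>
          open C \<and> x \<in> C \<and> C \<subseteq> U"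

instance real_normed_vector \<subseteq> lctvs
proof
  fix a :: real and x :: 'a
  show "((\<lambda>p. fst p *\<^sub>R snd p) \<longlongrightarrow> a *\<^sub>R x) (nhds a \<times>\<^sub>F nhds x)"
    by (intro tendsto_scaleR filterlim_fst filterlim_snd)
next
  fix U :: "'a set" and x assume "open U" "x \<in> U"
  then obtain e where "e > 0" "ball x e \<subseteq> U"
    by (auto simp: open_contains_ball)
  then show "\<exists>C. (\<forall>y\<in>C. \<forall>z\<in>C. \<forall>u\<ge>0. \<forall>v\<ge>0. u + v = 1 \<longrightarrow> u *\<^sub>R y + v *\<^sub>R z \<in> C) \<and>
      open C \<and> x \<in> C \<and> C \<subseteq> U"
    unfolding convex_def[symmetric] by (intro exI[of _ "ball x e"]) auto
qed

instance prod :: (topological_monoid_add, topological_monoid_add) topological_monoid_add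
proof
  fix a b :: "'a \<times> 'b"
  show "((\<lambda>p. fst p + snd p) \<longlongrightarrow> a + b) (nhds a \<times>\<^sub>F nhds b)"
    unfolding plus_prod_def
    by (intro tendsto_Pair tendsto_add tendsto_fst tendsto_snd filterlim_fst filterlim_snd)
qed

instance prod :: (topological_comm_monoid_add, topological_comm_monoid_add) topological_comm_monoid_add ..

instance prod :: (topological_group_add, topological_group_add) topological_group_add
proof
  fix a :: "'a \<times> 'b"
  have "((\<lambda>p. (- fst p, - snd p)) \<longlongrightarrow> (- fst a, - snd a)) (nhds a)"
    by (intro tendsto_Pair tendsto_minus tendsto_fst tendsto_snd filterlim_ident)
  then show "(uminus \<longlongrightarrow> - a) (nhds a)"
    by (simp add: uminus_prod_def[abs_def])
qed

instance prod :: (topological_ab_group_add, topological_ab_group_add) topological_ab_group_add ..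

instance prod :: (lctvs, lctvs) lctvs
proof
  fix a :: real and x :: "'a \<times> 'b"
  have 1: "((\<lambda>p. fst p *\<^sub>R fst (snd p)) \<longlongrightarrow> a *\<^sub>R fst x) (nhds a \<times>\<^sub>F nhds x)"
    using filterlim_compose[OF tendsto_scaleR_Pair_lctvs[of a "fst x"]
        filterlim_Pair[OF filterlim_fst tendsto_fst[OF filterlim_snd]]]
    by simp
  have 2: "((\<lambda>p. fst p *\<^sub>R snd (snd p)) \<longlongrightarrow> a *\<^sub>R snd x) (nhds a \<times>\<^sub>F nhds x)"
    using filterlim_compose[OF tendsto_scaleR_Pair_lctvs[of a "snd x"]
        filterlim_Pair[OF filterlim_fst tendsto_snd[OF filterlim_snd]]]
    by simp
  show "((\<lambda>p. fst p *\<^sub>R snd p) \<longlongrightarrow> a *\<^sub>R x) (nhds a \<times>\<^sub>F nhds x)"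
    using tendsto_Pair[OF 1 2] by (simp add: scaleR_prod_def)
next
  fix U :: "('a \<times> 'b) set" and x assume "open U" "x \<in> U"
  then obtain A B where AB: "open A" "open B" "x \<in> A \<times> B" "A \<times> B \<subseteq> U"
    by (rule open_prod_elim)
  obtain C where C: "convex C" "open C" "fst x \<in> C" "C \<subseteq> A"
    using locally_convex[folded convex_def, OF AB(1), of "fst x"] AB(3) by auto
  obtain D where D: "convex D" "open D" "snd x \<in> D" "D \<subseteq> B"
    using locally_convex[folded convex_def, OF AB(2), of "snd x"] AB(3) by auto
  show "\<exists>C. (\<forall>y\<in>C. \<forall>z\<in>C. \<forall>u\<ge>0. \<forall>v\<ge>0. u + v = 1 \<longrightarrow> u *\<^sub>R y + v *\<^sub>R z \<in> C) \<and>
      open C \<and> x \<in> C \<and> C \<subseteq> U"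
    unfolding convex_def[symmetric] using C D AB by (intro exI[of _ "C \<times> D"]) (auto intro: convex_Times open_Times simp: mem_Times_iff)
qed

definition has_dir_deriv :: "('e::lctvs \<Rightarrow> 'f::lctvs) \<Rightarrow> 'e \<Rightarrow> 'e \<Rightarrow> 'f \<Rightarrow> bool" where
  "has_dir_deriv f x v l \<longleftrightarrow> ((\<lambda>t::real. (1 / t) *\<^sub>R (f (x + t *\<^sub>R v) - f x)) \<longlongrightarrow> l) (at 0)"

definition dir_deriv :: "('e::lctvs \<Rightarrow> 'f::lctvs) \<Rightarrow> 'e \<Rightarrow> 'e \<Rightarrow> 'f" where
  "dir_deriv f x v = Lim (at 0) (\<lambda>t::real. (1 / t) *\<^sub>R (f (x + t *\<^sub>R v) - f x))"

text \<open>\<open>iter_deriv n f x v\<close> is the iterated directional derivative of order \<open>n\<close> at \<open>x\<close> in the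
  directions \<open>v 0, \<dots>, v (n - 1)\<close>; the remaining entries of \<open>v\<close> are irrelevant.\<close>

primrec iter_deriv :: "nat \<Rightarrow> ('e::lctvs \<Rightarrow> 'f::lctvs) \<Rightarrow> 'e \<Rightarrow> (nat \<Rightarrow> 'e) \<Rightarrow> 'f" where
  "iter_deriv 0 f x v = f x"
| "iter_deriv (Suc n) f x v = dir_deriv (\<lambda>y. iter_deriv n f y v) x (v n)"

text \<open>Smoothness in the sense of Michal--Bastiani (Hamilton's notion on Frechet spaces): all
  iterated directional derivatives exist and are jointly continuous in the base point and the
  directions. \<open>U\<close> is meant to be a relatively open subset of the closed linear subspace \<open>F\<close>, and
  only directions in \<open>F\<close> are used, so this is smoothness on the locally convex space \<open>F\<close>. Since
  the \<open>n\<close>-th derivative involves finitely many entries of \<open>v\<close>, continuity for the product topology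
  on sequences is continuity on \<open>U \<times> F\<^sup>n\<close>.\<close>

definition smooth_on :: "'e::lctvs set \<Rightarrow> 'e set \<Rightarrow> ('e \<Rightarrow> 'f::lctvs) \<Rightarrow> bool" where
  "smooth_on F U f \<longleftrightarrow>
     (\<forall>n. (\<forall>x\<in>U. \<forall>v. range v \<subseteq> F \<longrightarrow>
              (\<exists>l. has_dir_deriv (\<lambda>y. iter_deriv n f y v) x (v n) l)) \<and>
          continuous_on (U \<times> {v. range v \<subseteq> F}) (\<lambda>(x, v). iter_deriv n f x v))"

definition continuous_linear_on :: "'e::lctvs set \<Rightarrow> ('e \<Rightarrow> 'f::lctvs) \<Rightarrow> bool" where
  "continuous_linear_on F P \<longleftrightarrow>
     (\<forall>u\<in>F. \<forall>v\<in>F. P (u + v) = P u + P v) \<and> (\<forall>a. \<forall>v\<in>F. P (a *\<^sub>R v) = a *\<^sub>R P v) \<and>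
     continuous_on F P"


section \<open>Manifolds\<close>

text \<open>A chart takes its values in a closed linear subspace (the model space) of a locally convex
  type. Allowing subspaces lets submanifolds be manifolds over the same type, and lets different
  components have different model spaces.\<close>

datatype ('a, 'e) chart = Chart (cdom: "'a set") (cmap: "'a \<Rightarrow> 'e") (cmodel: "'e set")

datatype ('a, 'e) manifold = Manifold (points: "'a set") (atlas: "('a, 'e) chart set")

definition cinv :: "('a, 'e) chart \<Rightarrow> 'e \<Rightarrow> 'a" where
  "cinv c = inv_into (cdom c) (cmap c)"

definition is_chart :: "'a set \<Rightarrow> ('a, 'e::lctvs) chart \<Rightarrow> bool" where
  "is_chart X c \<longleftrightarrow> cdom c \<subseteq> X \<and> inj_on (cmap c) (cdom c) \<and>
     subspace (cmodel c) \<and> closed (cmodel c) \<and>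
     openin (top_of_set (cmodel c)) (cmap c ` cdom c)"

definition smooth_transition :: "('a, 'e::lctvs) chart \<Rightarrow> ('a, 'e) chart \<Rightarrow> bool" where
  "smooth_transition c d \<longleftrightarrow>
     openin (top_of_set (cmodel c)) (cmap c ` (cdom c \<inter> cdom d)) \<and>
     smooth_on (cmodel c) (cmap c ` (cdom c \<inter> cdom d)) (cmap d \<circ> cinv c)"

definition mtop :: "('a, 'e::lctvs) manifold \<Rightarrow> 'a topology" where
  "mtop M = topology (\<lambda>W. W \<subseteq> points M \<and>
     (\<forall>c\<in>atlas M. openin (top_of_set (cmodel c)) (cmap c ` (W \<inter> cdom c))))"

definition is_manifold :: "('a, 'e::lctvs) manifold \<Rightarrow> bool" where
  "is_manifold M \<longleftrightarrow>
     (\<forall>c\<in>atlas M. is_chart (points M) c) \<and>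
     (\<Union>c\<in>atlas M. cdom c) = points M \<and>
     (\<forall>c\<in>atlas M. \<forall>d\<in>atlas M. smooth_transition c d) \<and>
     Hausdorff_space (mtop M)"

text \<open>Membership in the maximal atlas.\<close>

definition compatible_chart :: "('a, 'e::lctvs) manifold \<Rightarrow> ('a, 'e) chart \<Rightarrow> bool" where
  "compatible_chart M c \<longleftrightarrow> is_chart (points M) c \<and>
     (\<forall>d\<in>atlas M. smooth_transition c d \<and> smooth_transition d c)"

definition charts_at :: "('a, 'e) manifold \<Rightarrow> 'a \<Rightarrow> ('a, 'e) chart set" where
  "charts_at M x = {c \<in> atlas M. x \<in> cdom c}"

definition prod_manifold ::
    "('a, 'e) manifold \<Rightarrow> ('b, 'f) manifold \<Rightarrow> ('a \<times> 'b, 'e \<times> 'f) manifold" where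
  "prod_manifold M N = Manifold (points M \<times> points N)
     {Chart (cdom c \<times> cdom d) (map_prod (cmap c) (cmap d)) (cmodel c \<times> cmodel d) | c d.
        c \<in> atlas M \<and> d \<in> atlas N}"

definition smooth_map ::
    "('a, 'e::lctvs) manifold \<Rightarrow> ('b, 'f::lctvs) manifold \<Rightarrow> ('a \<Rightarrow> 'b) \<Rightarrow> bool" where
  "smooth_map M N f \<longleftrightarrow> continuous_map (mtop M) (mtop N) f \<and>
     (\<forall>c\<in>atlas M. \<forall>d\<in>atlas N.
        smooth_on (cmodel c) (cmap c ` {x \<in> cdom c. f x \<in> cdom d}) (cmap d \<circ> f \<circ> cinv c))"

definition smooth_fun :: "('a, 'e::lctvs) manifold \<Rightarrow> ('a \<Rightarrow> real) \<Rightarrow> bool" where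
  "smooth_fun M f \<longleftrightarrow> (\<forall>c\<in>atlas M. smooth_on (cmodel c) (cmap c ` cdom c) (f \<circ> cinv c))"

definition diffeomorphism ::
    "('a, 'e::lctvs) manifold \<Rightarrow> ('b, 'f::lctvs) manifold \<Rightarrow> ('a \<Rightarrow> 'b) \<Rightarrow> bool" where
  "diffeomorphism M N f \<longleftrightarrow> bij_betw f (points M) (points N) \<and> smooth_map M N f \<and>
     smooth_map N M (inv_into (points M) f)"

text \<open>Charts of the ambient manifold that flatten \<open>A\<close> onto a closed linear subspace \<open>F\<close> of the
  model space (no complement of \<open>F\<close> is required).\<close>

definition slice_chart ::
    "('a, 'e::lctvs) manifold \<Rightarrow> 'a set \<Rightarrow> ('a, 'e) chart \<Rightarrow> 'e set \<Rightarrow> bool" where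
  "slice_chart M A c F \<longleftrightarrow> compatible_chart M c \<and> subspace F \<and> closed F \<and> F \<subseteq> cmodel c \<and>
     cmap c ` (cdom c \<inter> A) = cmap c ` cdom c \<inter> F"

definition is_submanifold :: "('a, 'e::lctvs) manifold \<Rightarrow> 'a set \<Rightarrow> bool" where
  "is_submanifold M A \<longleftrightarrow> A \<subseteq> points M \<and> (\<forall>x\<in>A. \<exists>c F. slice_chart M A c F \<and> x \<in> cdom c)"

text \<open>The manifold structure induced on a submanifold; it is also used for open subsets.\<close>

definition submanifold :: "('a, 'e::lctvs) manifold \<Rightarrow> 'a set \<Rightarrow> ('a, 'e) manifold" where
  "submanifold M A = Manifold A {Chart (cdom c \<inter> A) (cmap c) F | c F. slice_chart M A c F}"

text \<open>Submersions: in suitable charts the map is a continuous linear projection with a continuous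
  linear right inverse. A quotient manifold structure on a quotient set is a manifold structure for
  which the projection is a submersion.\<close>

definition submersion ::
    "('a, 'e::lctvs) manifold \<Rightarrow> ('b, 'f::lctvs) manifold \<Rightarrow> ('a \<Rightarrow> 'b) \<Rightarrow> bool" where
  "submersion M N f \<longleftrightarrow> smooth_map M N f \<and>
     (\<forall>x\<in>points M. \<exists>c d P R. compatible_chart M c \<and> compatible_chart N d \<and>
        x \<in> cdom c \<and> f ` cdom c \<subseteq> cdom d \<and>
        continuous_linear_on (cmodel c) P \<and> P ` cmodel c \<subseteq> cmodel d \<and>
        continuous_linear_on (cmodel d) R \<and> R ` cmodel d \<subseteq> cmodel c \<and>
        (\<forall>w\<in>cmodel d. P (R w) = w) \<and>
        (\<forall>y\<in>cdom c. cmap d (f y) = P (cmap c y)))"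


section \<open>Tangent vectors\<close>

text \<open>A tangent vector at \<open>x\<close> is the family of its coordinate representatives in all atlas charts
  around \<open>x\<close>, related by the derivatives of the transition maps, and \<open>0\<close> outside of these charts.
  The linear structure is therefore pointwise.\<close>

type_synonym ('a, 'e) tvec = "('a, 'e) chart \<Rightarrow> 'e"

definition tangent :: "('a, 'e::lctvs) manifold \<Rightarrow> 'a \<Rightarrow> ('a, 'e) tvec set" where
  "tangent M x = {v. (\<forall>c. c \<notin> charts_at M x \<longrightarrow> v c = 0) \<and>
     (\<forall>c\<in>charts_at M x. v c \<in> cmodel c \<and>
        (\<forall>d\<in>charts_at M x. v d = dir_deriv (cmap d \<circ> cinv c) (cmap c x) (v c)))}"

definition tadd :: "('a, 'e::lctvs) tvec \<Rightarrow> ('a, 'e) tvec \<Rightarrow> ('a, 'e) tvec" where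
  "tadd u v = (\<lambda>c. u c + v c)"

definition tscale :: "real \<Rightarrow> ('a, 'e::lctvs) tvec \<Rightarrow> ('a, 'e) tvec" where
  "tscale a v = (\<lambda>c. a *\<^sub>R v c)"

text \<open>The tangent vector at \<open>x\<close> whose representative in the chart \<open>c\<close> is \<open>w\<close>.\<close>

definition coord_tvec ::
    "('a, 'e::lctvs) manifold \<Rightarrow> 'a \<Rightarrow> ('a, 'e) chart \<Rightarrow> 'e \<Rightarrow> ('a, 'e) tvec" where
  "coord_tvec M x c w =
     (\<lambda>d. if d \<in> charts_at M x then dir_deriv (cmap d \<circ> cinv c) (cmap c x) w else 0)"

text \<open>Derivative of a vector-valued function along a tangent vector at \<open>x\<close>; by the chain rule the
  chosen chart does not matter.\<close>

definition tderiv ::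
    "('a, 'e::lctvs) manifold \<Rightarrow> 'a \<Rightarrow> ('a \<Rightarrow> 'f::lctvs) \<Rightarrow> ('a, 'e) tvec \<Rightarrow> 'f" where
  "tderiv M x f v =
     (let c = (SOME c. c \<in> charts_at M x) in dir_deriv (f \<circ> cinv c) (cmap c x) (v c))"

definition tmap ::
    "('a, 'e::lctvs) manifold \<Rightarrow> ('b, 'f::lctvs) manifold \<Rightarrow> ('a \<Rightarrow> 'b) \<Rightarrow> 'a \<Rightarrow>
       ('a, 'e) tvec \<Rightarrow> ('b, 'f) tvec" where
  "tmap M N f x v = (\<lambda>d. if d \<in> charts_at N (f x) then tderiv M x (cmap d \<circ> f) v else 0)"


section \<open>Symplectic forms\<close>

type_synonym ('a, 'e) two_form = "'a \<Rightarrow> ('a, 'e) tvec \<Rightarrow> ('a, 'e) tvec \<Rightarrow> real"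

definition local_form ::
    "('a, 'e::lctvs) manifold \<Rightarrow> ('a, 'e) two_form \<Rightarrow> ('a, 'e) chart \<Rightarrow> 'e \<Rightarrow> 'e \<Rightarrow> 'e \<Rightarrow> real" where
  "local_form M w c y a b =
     w (cinv c y) (coord_tvec M (cinv c y) c a) (coord_tvec M (cinv c y) c b)"

definition is_two_form :: "('a, 'e::lctvs) manifold \<Rightarrow> ('a, 'e) two_form \<Rightarrow> bool" where
  "is_two_form M w \<longleftrightarrow>
     (\<forall>x\<in>points M. \<forall>u\<in>tangent M x. \<forall>v\<in>tangent M x.
        w x u v = - w x v u \<and>
        (\<forall>a. w x (tscale a u) v = a * w x u v) \<and>
        (\<forall>u'\<in>tangent M x. w x (tadd u u') v = w x u v + w x u' v)) \<and>
     (\<forall>c\<in>atlas M. smooth_on (cmodel c \<times> cmodel c \<times> cmodel c)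
        ((cmap c ` cdom c) \<times> cmodel c \<times> cmodel c) (\<lambda>(y, a, b). local_form M w c y a b))"

text \<open>The exterior derivative, evaluated on constant (hence commuting) vector fields of a chart.\<close>

definition closed_form :: "('a, 'e::lctvs) manifold \<Rightarrow> ('a, 'e) two_form \<Rightarrow> bool" where
  "closed_form M w \<longleftrightarrow>
     (\<forall>c\<in>atlas M. \<forall>y\<in>cmap c ` cdom c. \<forall>a\<in>cmodel c. \<forall>b\<in>cmodel c. \<forall>d\<in>cmodel c.
        dir_deriv (\<lambda>z. local_form M w c z b d) y a +
        dir_deriv (\<lambda>z. local_form M w c z d a) y b +
        dir_deriv (\<lambda>z. local_form M w c z a b) y d = 0)"

text \<open>Symplectic forms are weak: \<open>v \<mapsto> \<omega>(v, \<cdot>)\<close> is injective, not necessarily onto the dual.\<close>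

definition symplectic_form :: "('a, 'e::lctvs) manifold \<Rightarrow> ('a, 'e) two_form \<Rightarrow> bool" where
  "symplectic_form M w \<longleftrightarrow> is_two_form M w \<and> closed_form M w \<and>
     (\<forall>x\<in>points M. \<forall>u\<in>tangent M x.
        (\<forall>v\<in>tangent M x. w x u v = 0) \<longrightarrow> u = (\<lambda>_. 0))"

definition pullback_eq ::
    "('a, 'e::lctvs) manifold \<Rightarrow> ('a, 'e) two_form \<Rightarrow> ('b, 'f::lctvs) manifold \<Rightarrow>
       ('b, 'f) two_form \<Rightarrow> ('a \<Rightarrow> 'b) \<Rightarrow> bool" where
  "pullback_eq M w N w' f \<longleftrightarrow>
     (\<forall>x\<in>points M. \<forall>u\<in>tangent M x. \<forall>v\<in>tangent M x.
        w' (f x) (tmap M N f x u) (tmap M N f x v) = w x u v)"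

definition pullback_form ::
    "('a, 'e::lctvs) manifold \<Rightarrow> ('b, 'f::lctvs) manifold \<Rightarrow> ('b, 'f) two_form \<Rightarrow>
       ('a \<Rightarrow> 'b) \<Rightarrow> ('a, 'e) two_form" where
  "pullback_form M N w f = (\<lambda>x u v. w (f x) (tmap M N f x u) (tmap M N f x v))"

definition restrict_form ::
    "('a, 'e::lctvs) manifold \<Rightarrow> ('a, 'e) two_form \<Rightarrow> 'a set \<Rightarrow> ('a, 'e) two_form" where
  "restrict_form M w A = pullback_form (submanifold M A) M w (\<lambda>x. x)"

definition symplectic_orthogonal ::
    "('a, 'e::lctvs) manifold \<Rightarrow> ('a, 'e) two_form \<Rightarrow> 'a \<Rightarrow> ('a, 'e) tvec set \<Rightarrow> ('a, 'e) tvec set" where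
  "symplectic_orthogonal M w x V = {u \<in> tangent M x. \<forall>v\<in>V. w x u v = 0}"

definition symplectomorphism ::
    "('a, 'e::lctvs) manifold \<Rightarrow> ('a, 'e) two_form \<Rightarrow> ('b, 'f::lctvs) manifold \<Rightarrow>
       ('b, 'f) two_form \<Rightarrow> ('a \<Rightarrow> 'b) \<Rightarrow> bool" where
  "symplectomorphism M w N w' f \<longleftrightarrow> diffeomorphism M N f \<and> pullback_eq M w N w' f"


section \<open>Lie groups and the coadjoint action\<close>

definition lie_group :: "'g monoid \<Rightarrow> ('g, 'e::lctvs) manifold \<Rightarrow> bool" where
  "lie_group G MG \<longleftrightarrow> group G \<and> is_manifold MG \<and> points MG = carrier G \<and>
     smooth_map (prod_manifold MG MG) MG (\<lambda>(a, b). a \<otimes>\<^bsub>G\<^esub> b) \<and>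
     smooth_map MG MG (\<lambda>a. inv\<^bsub>G\<^esub> a)"

definition lie_algebra :: "'g monoid \<Rightarrow> ('g, 'e::lctvs) manifold \<Rightarrow> ('g, 'e) tvec set" where
  "lie_algebra G MG = tangent MG \<one>\<^bsub>G\<^esub>"

definition Ad :: "'g monoid \<Rightarrow> ('g, 'e::lctvs) manifold \<Rightarrow> 'g \<Rightarrow> ('g, 'e) tvec \<Rightarrow> ('g, 'e) tvec" where
  "Ad G MG g = tmap MG MG (\<lambda>a. g \<otimes>\<^bsub>G\<^esub> a \<otimes>\<^bsub>G\<^esub> inv\<^bsub>G\<^esub> g) \<one>\<^bsub>G\<^esub>"

text \<open>The bracket of the left-invariant Lie algebra, as the derivative of \<open>g \<mapsto> Ad g \<eta>\<close> at the unit
  in the direction \<open>\<xi>\<close>.\<close>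

definition lie_bracket ::
    "'g monoid \<Rightarrow> ('g, 'e::lctvs) manifold \<Rightarrow> ('g, 'e) tvec \<Rightarrow> ('g, 'e) tvec \<Rightarrow> ('g, 'e) tvec" where
  "lie_bracket G MG \<xi> \<eta> = (\<lambda>c. tderiv MG \<one>\<^bsub>G\<^esub> (\<lambda>g. Ad G MG g \<eta> c) \<xi>)"

text \<open>The topological dual of the Lie algebra. Functionals are extended by \<open>0\<close> outside of the Lie
  algebra, so that equality of functionals is equality of functions.\<close>

definition lie_dual :: "'g monoid \<Rightarrow> ('g, 'e::lctvs) manifold \<Rightarrow> (('g, 'e) tvec \<Rightarrow> real) set" where
  "lie_dual G MG = {\<mu>. (\<forall>\<xi>. \<xi> \<notin> lie_algebra G MG \<longrightarrow> \<mu> \<xi> = 0) \<and>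
     (\<forall>c\<in>charts_at MG \<one>\<^bsub>G\<^esub>.
        continuous_linear_on (cmodel c) (\<lambda>w. \<mu> (coord_tvec MG \<one>\<^bsub>G\<^esub> c w)))}"

text \<open>The transpose of \<open>Ad g\<close>; this is a right action of the group.\<close>

definition Ad_dual ::
    "'g monoid \<Rightarrow> ('g, 'e::lctvs) manifold \<Rightarrow> 'g \<Rightarrow> (('g, 'e) tvec \<Rightarrow> real) \<Rightarrow> ('g, 'e) tvec \<Rightarrow> real" where
  "Ad_dual G MG g \<mu> = (\<lambda>\<xi>. if \<xi> \<in> lie_algebra G MG then \<mu> (Ad G MG g \<xi>) else 0)"

definition coadjoint_isotropy ::
    "'g monoid \<Rightarrow> ('g, 'e::lctvs) manifold \<Rightarrow> (('g, 'e) tvec \<Rightarrow> real) \<Rightarrow> 'g set" where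
  "coadjoint_isotropy G MG \<sigma> = {g \<in> carrier G. Ad_dual G MG g \<sigma> = \<sigma>}"

definition coadjoint_action ::
    "'h monoid \<Rightarrow> ('h, 'e::lctvs) manifold \<Rightarrow> 'h \<Rightarrow> (('h, 'e) tvec \<Rightarrow> real) \<Rightarrow> ('h, 'e) tvec \<Rightarrow> real" where
  "coadjoint_action H MH h \<mu> = Ad_dual H MH (inv\<^bsub>H\<^esub> h) \<mu>"

definition coadjoint_orbit ::
    "'h monoid \<Rightarrow> ('h, 'e::lctvs) manifold \<Rightarrow> (('h, 'e) tvec \<Rightarrow> real) \<Rightarrow> (('h, 'e) tvec \<Rightarrow> real) set" where
  "coadjoint_orbit H MH \<mu> = (\<lambda>h. coadjoint_action H MH h \<mu>) ` carrier H"


section \<open>Actions and momentum maps\<close>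

definition smooth_left_action ::
    "'h monoid \<Rightarrow> ('h, 'f::lctvs) manifold \<Rightarrow> ('s, 'e::lctvs) manifold \<Rightarrow> ('h \<Rightarrow> 's \<Rightarrow> 's) \<Rightarrow> bool" where
  "smooth_left_action H MH S L \<longleftrightarrow>
     smooth_map (prod_manifold MH S) S (\<lambda>(h, x). L h x) \<and>
     (\<forall>x\<in>points S. L \<one>\<^bsub>H\<^esub> x = x \<and>
        (\<forall>h\<in>carrier H. \<forall>k\<in>carrier H. L (h \<otimes>\<^bsub>H\<^esub> k) x = L h (L k x)))"

definition smooth_right_action ::
    "'g monoid \<Rightarrow> ('g, 'f::lctvs) manifold \<Rightarrow> ('s, 'e::lctvs) manifold \<Rightarrow> ('s \<Rightarrow> 'g \<Rightarrow> 's) \<Rightarrow> bool" where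
  "smooth_right_action G MG S R \<longleftrightarrow>
     smooth_map (prod_manifold S MG) S (\<lambda>(x, g). R x g) \<and>
     (\<forall>x\<in>points S. R x \<one>\<^bsub>G\<^esub> = x \<and>
        (\<forall>g\<in>carrier G. \<forall>k\<in>carrier G. R x (g \<otimes>\<^bsub>G\<^esub> k) = R (R x g) k))"

text \<open>The infinitesimal generator of \<open>\<xi>\<close> at \<open>x\<close> is the derivative at the unit of the orbit map
  through \<open>x\<close>; no exponential map is needed.\<close>

definition left_generator ::
    "'h monoid \<Rightarrow> ('h, 'f::lctvs) manifold \<Rightarrow> ('s, 'e::lctvs) manifold \<Rightarrow> ('h \<Rightarrow> 's \<Rightarrow> 's) \<Rightarrow>
       ('h, 'f) tvec \<Rightarrow> 's \<Rightarrow> ('s, 'e) tvec" where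
  "left_generator H MH S L \<xi> x = tmap MH S (\<lambda>h. L h x) \<one>\<^bsub>H\<^esub> \<xi>"

definition right_generator ::
    "'g monoid \<Rightarrow> ('g, 'f::lctvs) manifold \<Rightarrow> ('s, 'e::lctvs) manifold \<Rightarrow> ('s \<Rightarrow> 'g \<Rightarrow> 's) \<Rightarrow>
       ('g, 'f) tvec \<Rightarrow> 's \<Rightarrow> ('s, 'e) tvec" where
  "right_generator G MG S R \<xi> x = tmap MG S (\<lambda>g. R x g) \<one>\<^bsub>G\<^esub> \<xi>"

text \<open>\<open>gen \<xi>\<close> is the generator vector field of \<open>\<xi>\<close>. The convention is
  \<open>d\<langle>J, \<xi>\<rangle> = \<omega>(\<xi>\<^sub>S, \<cdot>)\<close>, which for left actions gives \<open>\<omega>(\<xi>\<^sub>S, \<eta>\<^sub>S) = \<langle>J, [\<xi>, \<eta>]\<rangle>\<close>.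
  Smoothness of \<open>J\<close> is only required after pairing with elements of the Lie algebra.\<close>

definition momentum_map ::
    "'g monoid \<Rightarrow> ('g, 'f::lctvs) manifold \<Rightarrow> ('s, 'e::lctvs) manifold \<Rightarrow> ('s, 'e) two_form \<Rightarrow>
       (('g, 'f) tvec \<Rightarrow> 's \<Rightarrow> ('s, 'e) tvec) \<Rightarrow> ('s \<Rightarrow> ('g, 'f) tvec \<Rightarrow> real) \<Rightarrow> bool" where
  "momentum_map G MG S w gen J \<longleftrightarrow>
     (\<forall>x\<in>points S. J x \<in> lie_dual G MG) \<and>
     (\<forall>\<xi>\<in>lie_algebra G MG. smooth_fun S (\<lambda>x. J x \<xi>) \<and>
        (\<forall>x\<in>points S. \<forall>v\<in>tangent S x. tderiv S x (\<lambda>y. J y \<xi>) v = w x (gen \<xi> x) v))"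

definition level_set :: "('s, 'e) manifold \<Rightarrow> ('s \<Rightarrow> 'm) \<Rightarrow> 'm \<Rightarrow> 's set" where
  "level_set S J \<tau> = {x \<in> points S. J x = \<tau>}"

text \<open>\<open>orb x\<close> is the orbit of \<open>x\<close>: the set \<open>A\<close> is invariant and the action on it is transitive.\<close>

definition transitive_on :: "('s \<Rightarrow> 's set) \<Rightarrow> 's set \<Rightarrow> bool" where
  "transitive_on orb A \<longleftrightarrow> (\<forall>x\<in>A. orb x = A)"


section \<open>Coadjoint orbits as symplectic manifolds\<close>

text \<open>A manifold structure on the coadjoint orbit of \<open>\<mu>\<close> for which the orbit is a homogeneous space
  of \<open>H\<close> immersed in the dual of the Lie algebra: the coadjoint action is smooth and
  infinitesimally transitive, the inclusion into the dual is smooth (tested on elements of the Lie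
  algebra) with injective differential. Thus the tangent space at \<open>\<nu>\<close> is the Lie algebra of \<open>H\<close>
  modulo \<open>{\<xi>. ad\<^sup>*\<^sub>\<xi> \<nu> = 0}\<close>. In finite dimensions the orbit map of \<open>H\<close> is then a submersion, so
  this is the usual structure of \<open>H\<close> modulo the isotropy group and is uniquely determined.\<close>

definition orbit_manifold ::
    "'h monoid \<Rightarrow> ('h, 'f::lctvs) manifold \<Rightarrow> (('h, 'f) tvec \<Rightarrow> real) \<Rightarrow>
       (('h, 'f) tvec \<Rightarrow> real, 'e::lctvs) manifold \<Rightarrow> bool" where
  "orbit_manifold H MH \<mu> Orb \<longleftrightarrow>
     is_manifold Orb \<and> points Orb = coadjoint_orbit H MH \<mu> \<and>
     smooth_left_action H MH Orb (coadjoint_action H MH) \<and>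
     (\<forall>\<nu>\<in>points Orb. tangent Orb \<nu> =
        (\<lambda>\<xi>. left_generator H MH Orb (coadjoint_action H MH) \<xi> \<nu>) ` lie_algebra H MH) \<and>
     (\<forall>\<eta>\<in>lie_algebra H MH. smooth_fun Orb (\<lambda>\<nu>. \<nu> \<eta>)) \<and>
     (\<forall>\<nu>\<in>points Orb. \<forall>v\<in>tangent Orb \<nu>.
        (\<forall>\<eta>\<in>lie_algebra H MH. tderiv Orb \<nu> (\<lambda>\<kappa>. \<kappa> \<eta>) v = 0) \<longrightarrow> v = (\<lambda>_. 0))"

text \<open>The orbit (Kirillov--Kostant--Souriau) form; it is determined on tangent vectors because these
  are all values of generators.\<close>

definition orbit_symplectic_form ::
    "'h monoid \<Rightarrow> ('h, 'f::lctvs) manifold \<Rightarrow> (('h, 'f) tvec \<Rightarrow> real, 'e::lctvs) manifold \<Rightarrow>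
       (('h, 'f) tvec \<Rightarrow> real, 'e) two_form \<Rightarrow> bool" where
  "orbit_symplectic_form H MH Orb w \<longleftrightarrow> symplectic_form Orb w \<and>
     (\<forall>\<nu>\<in>points Orb. \<forall>\<xi>\<in>lie_algebra H MH. \<forall>\<eta>\<in>lie_algebra H MH.
        w \<nu> (left_generator H MH Orb (coadjoint_action H MH) \<xi> \<nu>)
            (left_generator H MH Orb (coadjoint_action H MH) \<eta> \<nu>) = \<nu> (lie_bracket H MH \<xi> \<eta>))"

end

theory Submission
  imports Defs
begin

text \<open>By transitivity of \<open>G\<close> on the level sets of \<open>J\<^sub>L\<close>, the class of \<open>x \<in> N = J\<^sub>R\<^sup>-\<^sup>1(\<sigma>)\<close> is
  \<open>{y \<in> N. J\<^sub>L y = J\<^sub>L x}\<close>, so \<open>J\<^sub>L\<close> descends to an injection \<open>\<Phi>\<close> of \<open>S\<^sub>\<sigma>\<close> into the dual of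
  the Lie algebra of \<open>H\<close>. The \<open>H\<close>-orbits in \<open>N\<close> are its components; these are open because \<open>N\<close>
  is locally connected, and local sections of the submersion \<open>\<pi>\<close> show that their images are open in
  \<open>S\<^sub>\<sigma>\<close>. As these images partition \<open>S\<^sub>\<sigma>\<close>, they are its components, and \<open>\<Phi>\<close> maps each of them
  onto a coadjoint orbit. The orbit receives its manifold structure and its form from \<open>S\<^sub>\<sigma>\<close> through
  \<open>\<Phi>\<close>. That this is the homogeneous structure with the Kirillov--Kostant--Souriau form follows from
  \<open>T N \<subseteq> ker dJ\<^sub>R = \<gg>\<^sub>S\<^sup>\<omega> = \<hh>\<^sub>S\<close>, which makes the generators of \<open>H\<close> span the tangent spaces of
  \<open>S\<^sub>\<sigma>\<close>, and from \<open>\<omega>(\<xi>\<^sub>S, \<eta>\<^sub>S) = \<langle>J\<^sub>L, [\<xi>, \<eta>]\<rangle>\<close>. No completeness of the model spaces is used: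
  the calculus rests on a mean value theorem for convex open sets, proved by bisection.\<close>

subsection \<open>Calculus in locally convex spaces\<close>

text \<open>The conclusion asks for some structure on the orbit satisfying
  \<open>orbit_manifold\<close>, so no quotient of \<open>H\<close> by an isotropy group has to be
  built; what has to be proved is that the transported structure qualifies. Smoothness of the
  coadjoint action and of the evaluations comes from local sections \<open>t\<close> with
  \<open>J\<^sub>L (t \<nu>) = \<nu>\<close>: along them the coadjoint action is the action of
  \<open>H\<close> on the level set, followed by the projection. Injectivity of the differential of
  the inclusion into the dual is nondegeneracy of the reduced form, because the derivative of the
  evaluation at \<eta> along the generator of \<xi> is, up to sign, the value of that form on the
  two generators. Since forms are weak, a second orthogonal need not give back a subspace; the
  identity for the generators of \<open>H\<close> is what turns tangent vectors of the level set
  into generators.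

  On the technical side, model spaces are closed subspaces, possibly without complements, and charts
  have partial domains. Smooth maps are therefore handled as germs (\<open>smooth_near\<close>,
  \<open>smooth_at\<close>), whose domains shrink tacitly under composition.\<close>

lemma tendsto_scaleR_lctvs:
  fixes x :: "'a::lctvs"
  assumes "(f \<longlongrightarrow> a) F" "(g \<longlongrightarrow> x) F"
  shows "((\<lambda>i. f i *\<^sub>R g i) \<longlongrightarrow> a *\<^sub>R x) F"
  using filterlim_compose[OF tendsto_scaleR_Pair_lctvs[of a x] filterlim_Pair[OF assms]] by simp

text \<open>The function space carries the product topology. Convergence of the direction sequences
  of \<open>iter_deriv\<close> is checked slot by slot through this.\<close>

lemma tendsto_fun_iff:
  fixes l :: "'i \<Rightarrow> 'a::topological_space"
  shows "(g \<longlongrightarrow> l) F \<longleftrightarrow> (\<forall>i. ((\<lambda>x. g x i) \<longlongrightarrow> l i) F)"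
proof -
  have "(g \<longlongrightarrow> l) F \<longleftrightarrow> limitin (product_topology (\<lambda>i. euclidean) UNIV) g l F"
    by (simp add: euclidean_product_topology)
  also have "\<dots> \<longleftrightarrow> (\<forall>i. ((\<lambda>x. g x i) \<longlongrightarrow> l i) F)"
    by (simp add: limitin_componentwise)
  finally show ?thesis .
qed

lemma ex_convex_open:
  fixes x :: "'a::lctvs"
  assumes "open U" "x \<in> U"
  obtains C where "convex C" "open C" "x \<in> C" "C \<subseteq> U"
  using locally_convex[folded convex_def, OF assms] by blast

text \<open>Convex neighbourhoods suffice by local convexity, and they are what a mean value theorem
  can use: it places increments in a convex open set, without seminorms.\<close>

lemma tendsto_convexI:
  fixes l :: "'a::lctvs"
  assumes "\<And>K. open K \<Longrightarrow> convex K \<Longrightarrow> l \<in> K \<Longrightarrow> eventually (\<lambda>i. f i \<in> K) F"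
  shows "(f \<longlongrightarrow> l) F"
proof (rule topological_tendstoI)
  fix S assume "open S" "l \<in> S"
  then obtain K where K: "convex K" "open K" "l \<in> K" "K \<subseteq> S" by (rule ex_convex_open)
  from assms[OF K(2,1,3)] show "\<forall>\<^sub>F i in F. f i \<in> S"
    by (rule eventually_mono) (use K in auto)
qed

text \<open>Differentiability at a point puts the nearby difference quotients with that endpoint
  into the open set \<open>K\<close>. A difference quotient over an interval is a convex combination
  of those over its two parts, so membership passes from subintervals to their union, and
  \<open>Bolzano\<close> reaches the whole interval. No integral of \<open>\<gamma>'\<close> is
  formed.\<close>

lemma mean_value_convex:
  fixes \<gamma> \<gamma>' :: "real \<Rightarrow> 'a::lctvs"
  assumes d: "\<And>t. 0 \<le> t \<Longrightarrow> t \<le> 1 \<Longrightarrow> ((\<lambda>h. (1 / h) *\<^sub>R (\<gamma> (t + h) - \<gamma> t)) \<longlongrightarrow> \<gamma>' t) (at 0)"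
    and K: "open K" "convex K" "\<And>t. 0 \<le> t \<Longrightarrow> t \<le> 1 \<Longrightarrow> \<gamma>' t \<in> K"
  shows "\<gamma> 1 - \<gamma> 0 \<in> K"
proof -
  \<comment> \<open>The guard \<open>a < b\<close> makes degenerate intervals harmless; their
    quotient would be a division by zero.\<close>
  define P where "P = (\<lambda>a b. a < b \<longrightarrow> (1 / (b - a)) *\<^sub>R (\<gamma> b - \<gamma> a) \<in> K)"
  have trans: "P a c" if "P a b" "P b c" "a \<le> b" "b \<le> c" for a b c
  proof (cases "a = b \<or> b = c")
    case True then show ?thesis using that by auto
  next
    case False
    then have lt: "a < b" "b < c" using that by auto
    \<comment> \<open>The weights are the relative lengths of the two parts.\<close>
    let ?u = "(b - a) / (c - a)" and ?v = "(c - b) / (c - a)"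
    have "?u *\<^sub>R ((1 / (b - a)) *\<^sub>R (\<gamma> b - \<gamma> a)) + ?v *\<^sub>R ((1 / (c - b)) *\<^sub>R (\<gamma> c - \<gamma> b)) \<in> K"
      by (rule convexD[OF K(2)]) (use that lt in \<open>auto simp: P_def simp flip: add_divide_distrib\<close>)
    also have "?u *\<^sub>R ((1 / (b - a)) *\<^sub>R (\<gamma> b - \<gamma> a)) + ?v *\<^sub>R ((1 / (c - b)) *\<^sub>R (\<gamma> c - \<gamma> b))
        = (1 / (c - a)) *\<^sub>R (\<gamma> c - \<gamma> a)"
      using lt by (simp flip: scaleR_add_right)
    finally show ?thesis by (simp add: P_def)
  qed
  have "P 0 1"
  proof (rule Bolzano)
    fix x :: real assume x: "0 \<le> x" "x \<le> 1"
    have "\<forall>\<^sub>F h in at 0. (1 / h) *\<^sub>R (\<gamma> (x + h) - \<gamma> x) \<in> K"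
      by (rule topological_tendstoD[OF d K(1) K(3)]) (use x in auto)
    then obtain e where e: "e > 0"
      "\<And>h. h \<noteq> 0 \<Longrightarrow> \<bar>h\<bar> < e \<Longrightarrow> (1 / h) *\<^sub>R (\<gamma> (x + h) - \<gamma> x) \<in> K"
      by (auto simp: eventually_at dist_real_def)
    \<comment> \<open>The derivative at \<open>x\<close> controls only quotients with
      \<open>x\<close> as an endpoint, so an interval around \<open>x\<close> is cut at
      \<open>x\<close>.\<close>
    have "P a b" if ab: "a \<le> x" "x \<le> b" "b - a < e" for a b
    proof (rule trans[OF _ _ ab(1,2)])
      show "P a x"
      proof (cases "a = x")
        case False
        have "(1 / (a - x)) *\<^sub>R (\<gamma> (x + (a - x)) - \<gamma> x) \<in> K"
          by (rule e(2)) (use False ab in auto)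
        moreover have "(1 / (a - x)) *\<^sub>R (\<gamma> (x + (a - x)) - \<gamma> x) = (1 / (x - a)) *\<^sub>R (\<gamma> x - \<gamma> a)"
          by (metis (no_types) add_diff_cancel_left' diff_add_cancel add.commute minus_diff_eq minus_divide_right scaleR_minus_left scaleR_minus_right)
        ultimately show ?thesis by (simp add: P_def)
      qed (simp add: P_def)
      show "P x b"
      proof (cases "b = x")
        case False
        have "(1 / (b - x)) *\<^sub>R (\<gamma> (x + (b - x)) - \<gamma> x) \<in> K"
          by (rule e(2)) (use False ab in auto)
        then show ?thesis by (simp add: P_def)
      qed (simp add: P_def)
    qed
    with e(1) show "\<exists>d>0. \<forall>a b. a \<le> x \<and> x \<le> b \<and> b - a < d \<longrightarrow> P a b" by blast
  qed (auto intro: trans)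
  then show ?thesis by (simp add: P_def)
qed

subsection \<open>Directional derivatives\<close>

lemma has_dir_deriv_unique:
  "has_dir_deriv f x v l \<Longrightarrow> has_dir_deriv f x v m \<Longrightarrow> l = m"
  unfolding has_dir_deriv_def by (rule tendsto_unique[OF at_neq_bot])

lemma dir_deriv_eqI: "has_dir_deriv f x v l \<Longrightarrow> dir_deriv f x v = l"
  unfolding has_dir_deriv_def dir_deriv_def by (rule tendsto_Lim[OF at_neq_bot])

lemma has_dir_deriv_dir_deriv: "has_dir_deriv f x v l \<Longrightarrow> has_dir_deriv f x v (dir_deriv f x v)"
  by (simp add: dir_deriv_eqI)

lemma tendsto_line: "((\<lambda>t::real. x + t *\<^sub>R v) \<longlongrightarrow> (x::'a::lctvs)) (at 0)"
proof -
  have "((\<lambda>t::real. x + t *\<^sub>R v) \<longlongrightarrow> x + 0 *\<^sub>R v) (at 0)"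
    by (intro tendsto_add tendsto_const tendsto_scaleR_lctvs tendsto_ident_at)
  then show ?thesis by simp
qed

lemma line_in_subspace: "subspace F \<Longrightarrow> x \<in> F \<Longrightarrow> v \<in> F \<Longrightarrow> x + t *\<^sub>R v \<in> F"
  by (intro subspace_add subspace_scale)

lemma eventually_line:
  fixes x :: "'a::lctvs"
  assumes "subspace F" "v \<in> F" "openin (top_of_set F) U" "x \<in> U"
  shows "\<forall>\<^sub>F t in at (0::real). x + t *\<^sub>R v \<in> U"
proof -
  from assms(3) obtain T where T: "open T" "U = F \<inter> T" by (auto simp: openin_open)
  have "\<forall>\<^sub>F t in at (0::real). x + t *\<^sub>R v \<in> T"
    by (rule topological_tendstoD[OF tendsto_line T(1)]) (use assms T in auto)
  then show ?thesis
    by (rule eventually_mono) (use T assms in \<open>auto intro: line_in_subspace\<close>)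
qed

lemma has_dir_deriv_cong:
  assumes "\<forall>\<^sub>F t in at (0::real). f (x + t *\<^sub>R v) = g (x + t *\<^sub>R v)" "f x = g x"
  shows "has_dir_deriv f x v l \<longleftrightarrow> has_dir_deriv g x v l"
  unfolding has_dir_deriv_def
  by (rule filterlim_cong[OF refl refl]) (use assms in \<open>auto elim: eventually_mono\<close>)

lemma dir_deriv_cong:
  assumes "\<forall>\<^sub>F t in at (0::real). f (x + t *\<^sub>R v) = g (x + t *\<^sub>R v)" "f x = g x"
  shows "dir_deriv f x v = dir_deriv g x v"
  using has_dir_deriv_cong[OF assms]
  unfolding dir_deriv_def t2_space_class.Lim_def has_dir_deriv_def[symmetric] by simp

lemma has_dir_deriv_cong_on:
  assumes "subspace F" "v \<in> F" "openin (top_of_set F) U" "x \<in> U" "\<And>y. y \<in> U \<Longrightarrow> f y = g y"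
  shows "has_dir_deriv f x v l \<longleftrightarrow> has_dir_deriv g x v l"
  by (rule has_dir_deriv_cong) (use eventually_line[OF assms(1-4)] assms(4,5) in \<open>auto elim: eventually_mono\<close>)

lemma dir_deriv_cong_on:
  assumes "subspace F" "v \<in> F" "openin (top_of_set F) U" "x \<in> U" "\<And>y. y \<in> U \<Longrightarrow> f y = g y"
  shows "dir_deriv f x v = dir_deriv g x v"
  by (rule dir_deriv_cong) (use eventually_line[OF assms(1-4)] assms(4,5) in \<open>auto elim: eventually_mono\<close>)

lemma has_dir_deriv_add:
  assumes "has_dir_deriv f x v l" "has_dir_deriv g x v m"
  shows "has_dir_deriv (\<lambda>y. f y + g y) x v (l + m)"
proof -
  have "((\<lambda>t. (1 / t) *\<^sub>R (f (x + t *\<^sub>R v) - f x) + (1 / t) *\<^sub>R (g (x + t *\<^sub>R v) - g x)) \<longlongrightarrow> l + m) (at 0)"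
    by (intro tendsto_add assms[unfolded has_dir_deriv_def])
  then show ?thesis unfolding has_dir_deriv_def by (simp add: algebra_simps)
qed

lemma has_dir_deriv_const [simp]: "has_dir_deriv (\<lambda>y. k) x v 0"
  by (simp add: has_dir_deriv_def)

lemma has_dir_deriv_scaleR:
  assumes "has_dir_deriv f x v l"
  shows "has_dir_deriv (\<lambda>y. a *\<^sub>R f y) x v (a *\<^sub>R l)"
proof -
  have "((\<lambda>t. a *\<^sub>R ((1 / t) *\<^sub>R (f (x + t *\<^sub>R v) - f x))) \<longlongrightarrow> a *\<^sub>R l) (at 0)"
    by (intro tendsto_scaleR_lctvs tendsto_const assms[unfolded has_dir_deriv_def])
  then show ?thesis unfolding has_dir_deriv_def by (simp add: algebra_simps)
qed

text \<open>The difference quotients lie in \<open>T\<close>, and closedness of \<open>T\<close>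
  keeps their limit there. This is how closedness of model spaces enters the calculus.\<close>

lemma has_dir_deriv_in_subspace:
  assumes F: "subspace F" "v \<in> F" "openin (top_of_set F) U" "x \<in> U"
    and T: "subspace T" "closed T" "\<And>y. y \<in> U \<Longrightarrow> f y \<in> T"
    and d: "has_dir_deriv f x v l"
  shows "l \<in> T"
proof (rule Lim_in_closed_set[OF T(2) _ at_neq_bot d[unfolded has_dir_deriv_def]])
  show "\<forall>\<^sub>F t in at 0. (1 / t) *\<^sub>R (f (x + t *\<^sub>R v) - f x) \<in> T"
    using eventually_line[OF F]
    by (rule eventually_mono) (use T F(4) in \<open>auto intro: subspace_scale subspace_diff\<close>)
qed

lemma has_dir_deriv_scale_dir:
  assumes "has_dir_deriv f x v l"
  shows "has_dir_deriv f x (a *\<^sub>R v) (a *\<^sub>R l)"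
proof (cases "a = 0")
  case True then show ?thesis by (simp add: has_dir_deriv_def)
next
  case False
  have "filterlim (\<lambda>t::real. t * a) (at 0) (at 0)"
    unfolding filterlim_at using False by (auto simp: eventually_at_filter intro!: tendsto_eq_intros)
  from filterlim_compose[OF assms[unfolded has_dir_deriv_def] this]
  have "((\<lambda>t. a *\<^sub>R ((1 / (t * a)) *\<^sub>R (f (x + (t * a) *\<^sub>R v) - f x))) \<longlongrightarrow> a *\<^sub>R l) (at 0)"
    by (intro tendsto_scaleR_lctvs tendsto_const)
  then show ?thesis using False unfolding has_dir_deriv_def by simp
qed

subsection \<open>Iterated derivatives\<close>

text \<open>Slot \<open>n\<close> and all later ones are free in a derivative of order
  \<open>n\<close>. Later proofs overwrite slot \<open>n\<close> with the direction of the next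
  differentiation, which leaves the derivative of order \<open>n\<close> unchanged.\<close>

lemma iter_deriv_cong_dirs:
  "(\<And>i. i < n \<Longrightarrow> v i = w i) \<Longrightarrow> iter_deriv n f x v = iter_deriv n f x w"
  by (induction n arbitrary: x) (auto simp: less_Suc_eq)

lemma iter_deriv_cong_on:
  assumes F: "subspace F" "openin (top_of_set F) U" and eq: "\<And>y. y \<in> U \<Longrightarrow> f y = g y"
    and x: "x \<in> U" "range v \<subseteq> F"
  shows "iter_deriv n f x v = iter_deriv n g x v"
  using x(1)
proof (induction n arbitrary: x)
  case (Suc n)
  show ?case unfolding iter_deriv.simps
    by (rule dir_deriv_cong_on[OF F(1) _ F(2)]) (use Suc x(2) in auto)
qed (simp add: eq)

lemma smooth_onD:
  assumes "smooth_on F U f" "x \<in> U" "range v \<subseteq> F"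
  shows "has_dir_deriv (\<lambda>y. iter_deriv n f y v) x (v n) (iter_deriv (Suc n) f x v)"
proof -
  have "\<exists>l. has_dir_deriv (\<lambda>y. iter_deriv n f y v) x (v n) l"
    using assms unfolding smooth_on_def by blast
  then show ?thesis by (auto intro: has_dir_deriv_dir_deriv)
qed

lemma smooth_onD1:
  assumes "smooth_on F U f" "x \<in> U" "v \<in> F"
  shows "has_dir_deriv f x v (dir_deriv f x v)"
  using smooth_onD[OF assms(1,2), of "\<lambda>_. v" 0] assms(3) by auto

lemma smooth_on_subset:
  assumes "smooth_on F U f" "F' \<subseteq> F" "U' \<subseteq> U"
  shows "smooth_on F' U' f"
  unfolding smooth_on_def
proof (intro allI conjI ballI impI)
  fix n x and v :: "nat \<Rightarrow> _" assume "x \<in> U'" "range v \<subseteq> F'"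
  then have "has_dir_deriv (\<lambda>y. iter_deriv n f y v) x (v n) (iter_deriv (Suc n) f x v)"
    by (intro smooth_onD[OF assms(1)]) (use assms in auto)
  then show "\<exists>l. has_dir_deriv (\<lambda>y. iter_deriv n f y v) x (v n) l" ..
next
  fix n
  have "continuous_on (U \<times> {v :: nat \<Rightarrow> _. range v \<subseteq> F}) (\<lambda>(x, v). iter_deriv n f x v)"
    using assms by (simp add: smooth_on_def)
  then show "continuous_on (U' \<times> {v :: nat \<Rightarrow> _. range v \<subseteq> F'}) (\<lambda>(x, v). iter_deriv n f x v)"
    by (rule continuous_on_subset) (use assms in auto)
qed

lemma smooth_on_cong:
  assumes F: "subspace F" "openin (top_of_set F) U" and eq: "\<And>y. y \<in> U \<Longrightarrow> f y = g y"
    and sm: "smooth_on F U f"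
  shows "smooth_on F U g"
  unfolding smooth_on_def
proof (intro allI conjI ballI impI)
  fix n x and v :: "nat \<Rightarrow> _" assume xv: "x \<in> U" "range v \<subseteq> F"
  have "has_dir_deriv (\<lambda>y. iter_deriv n g y v) x (v n) (iter_deriv (Suc n) f x v)"
    by (subst has_dir_deriv_cong_on[OF F(1) _ F(2) xv(1), where g = "\<lambda>y. iter_deriv n f y v"])
      (use xv smooth_onD[OF sm xv] iter_deriv_cong_on[OF F eq] in auto)
  then show "\<exists>l. has_dir_deriv (\<lambda>y. iter_deriv n g y v) x (v n) l" ..
next
  fix n
  have "continuous_on (U \<times> {v :: nat \<Rightarrow> _. range v \<subseteq> F}) (\<lambda>(x, v). iter_deriv n f x v)"
    using sm by (simp add: smooth_on_def)
  then show "continuous_on (U \<times> {v :: nat \<Rightarrow> _. range v \<subseteq> F}) (\<lambda>(x, v). iter_deriv n g x v)"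
    by (rule continuous_on_eq) (auto intro: iter_deriv_cong_on[OF F eq])
qed

text \<open>Only the base point is localised: a neighbourhood of \<open>x\<close>, with all
  directions allowed, is a neighbourhood in the product, so joint continuity is local in
  \<open>x\<close> as well.\<close>

lemma smooth_on_local:
  assumes F: "subspace F"
    and loc: "\<And>x. x \<in> U \<Longrightarrow> \<exists>V. openin (top_of_set F) V \<and> x \<in> V \<and> smooth_on F V f"
  shows "smooth_on F U f"
  unfolding smooth_on_def
proof (intro allI conjI ballI impI)
  fix n x and v :: "nat \<Rightarrow> _" assume xv: "x \<in> U" "range v \<subseteq> F"
  with loc obtain V where "x \<in> V" "smooth_on F V f" by blast
  with xv show "\<exists>l. has_dir_deriv (\<lambda>y. iter_deriv n f y v) x (v n) l"
    using smooth_onD by blast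
next
  fix n
  show "continuous_on (U \<times> {v :: nat \<Rightarrow> _. range v \<subseteq> F}) (\<lambda>(x, v). iter_deriv n f x v)"
    unfolding continuous_on_def
  proof (intro ballI)
    fix p assume p: "p \<in> U \<times> {v :: nat \<Rightarrow> _. range v \<subseteq> F}"
    then have "fst p \<in> U" by auto
    then obtain V where V: "openin (top_of_set F) V" "fst p \<in> V" "smooth_on F V f" using loc by blast
    then obtain T where T: "open T" "V = F \<inter> T" by (auto simp: openin_open)
    have c: "continuous_on (V \<times> {v :: nat \<Rightarrow> _. range v \<subseteq> F}) (\<lambda>(x, v). iter_deriv n f x v)"
      using V by (simp add: smooth_on_def)
    have "p \<in> V \<times> {v :: nat \<Rightarrow> _. range v \<subseteq> F}" using p V(2) by (simp add: mem_Times_iff)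
    with c have lim: "((\<lambda>(x, v). iter_deriv n f x v) \<longlongrightarrow> (case p of (x, v) \<Rightarrow> iter_deriv n f x v)) (at p within (V \<times> {v :: nat \<Rightarrow> _. range v \<subseteq> F}))"
      unfolding continuous_on_def by (rule bspec)
    have UF: "U \<subseteq> F" using loc openin_imp_subset by blast
    have "at p within (U \<times> {v :: nat \<Rightarrow> _. range v \<subseteq> F}) \<le> at p within (V \<times> {v :: nat \<Rightarrow> _. range v \<subseteq> F})"
      unfolding at_within_def le_filter_def eventually_inf_principal
    proof (intro allI impI)
      fix P assume P: "\<forall>\<^sub>F x in nhds p. x \<in> V \<times> {v :: nat \<Rightarrow> _. range v \<subseteq> F} - {p} \<longrightarrow> P x"
      have "\<forall>\<^sub>F x in nhds p. x \<in> T \<times> UNIV"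
        by (rule eventually_nhds_in_open) (use T V in \<open>auto intro: open_Times simp: mem_Times_iff\<close>)
      then show "\<forall>\<^sub>F x in nhds p. x \<in> U \<times> {v :: nat \<Rightarrow> _. range v \<subseteq> F} - {p} \<longrightarrow> P x"
        using P by eventually_elim (use T UF in auto)
    qed
    then show "((\<lambda>(x, v). iter_deriv n f x v) \<longlongrightarrow> (case p of (x, v) \<Rightarrow> iter_deriv n f x v)) (at p within (U \<times> {v :: nat \<Rightarrow> _. range v \<subseteq> F}))"
      using lim by (rule tendsto_mono)
  qed
qed

text \<open>The usual recursion for smoothness through the tangent maps changes the type of the domain at
  every order; this criterion replaces it by a class of functions over a fixed type.\<close>

lemma smooth_on_family:
  fixes A :: "('e::lctvs \<Rightarrow> (nat \<Rightarrow> 'e) \<Rightarrow> 'f::lctvs) set"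
  assumes F: "subspace F" "openin (top_of_set F) U"
    and cont: "\<And>\<phi>. \<phi> \<in> A \<Longrightarrow> continuous_on (U \<times> {v :: nat \<Rightarrow> _. range v \<subseteq> F}) (\<lambda>(x, v). \<phi> x v)"
    and step: "\<And>\<phi> n. \<phi> \<in> A \<Longrightarrow> \<exists>\<psi>\<in>A. \<forall>x\<in>U. \<forall>v. range v \<subseteq> F \<longrightarrow> has_dir_deriv (\<lambda>y. \<phi> y v) x (v n) (\<psi> x v)"
    and f: "(\<lambda>x v. f x) \<in> A"
  shows "smooth_on F U f"
proof -
  have *: "\<exists>\<phi>\<in>A. \<forall>x\<in>U. \<forall>v. range v \<subseteq> F \<longrightarrow> iter_deriv n f x v = \<phi> x v" for n
  proof (induction n)
    case 0 show ?case using f by (intro bexI[of _ "\<lambda>x v. f x"]) auto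
  next
    case (Suc n)
    then obtain \<phi> where \<phi>: "\<phi> \<in> A" "\<And>x v. x \<in> U \<Longrightarrow> range v \<subseteq> F \<Longrightarrow> iter_deriv n f x v = \<phi> x v" by blast
    obtain \<psi> where \<psi>: "\<psi> \<in> A" "\<And>x v. x \<in> U \<Longrightarrow> range v \<subseteq> F \<Longrightarrow> has_dir_deriv (\<lambda>y. \<phi> y v) x (v n) (\<psi> x v)"
      using step[OF \<phi>(1), of n] by blast
    have "iter_deriv (Suc n) f x v = \<psi> x v" if "x \<in> U" "range v \<subseteq> F" for x and v :: "nat \<Rightarrow> _"
    proof -
      have "iter_deriv (Suc n) f x v = dir_deriv (\<lambda>y. \<phi> y v) x (v n)"
        unfolding iter_deriv.simps by (rule dir_deriv_cong_on[OF F(1) _ F(2)]) (use that \<phi> in auto)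
      then show ?thesis using dir_deriv_eqI[OF \<psi>(2)[OF that]] by simp
    qed
    with \<psi>(1) show ?case by blast
  qed
  show ?thesis unfolding smooth_on_def
  proof (intro allI conjI ballI impI)
    fix n x and v :: "nat \<Rightarrow> _" assume xv: "x \<in> U" "range v \<subseteq> F"
    obtain \<phi> where \<phi>: "\<phi> \<in> A" "\<And>x v. x \<in> U \<Longrightarrow> range v \<subseteq> F \<Longrightarrow> iter_deriv n f x v = \<phi> x v" using *[of n] by blast
    obtain \<psi> where \<psi>: "has_dir_deriv (\<lambda>y. \<phi> y v) x (v n) (\<psi> x v)"
      using step[OF \<phi>(1), of n] xv by blast
    have "has_dir_deriv (\<lambda>y. iter_deriv n f y v) x (v n) (\<psi> x v)"
      by (subst has_dir_deriv_cong_on[OF F(1) _ F(2) xv(1), where g = "\<lambda>y. \<phi> y v"]) (use \<psi> \<phi> xv in auto)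
    then show "\<exists>l. has_dir_deriv (\<lambda>y. iter_deriv n f y v) x (v n) l" ..
  next
    fix n
    obtain \<phi> where \<phi>: "\<phi> \<in> A" "\<And>x v. x \<in> U \<Longrightarrow> range v \<subseteq> F \<Longrightarrow> iter_deriv n f x v = \<phi> x v" using *[of n] by blast
    show "continuous_on (U \<times> {v :: nat \<Rightarrow> _. range v \<subseteq> F}) (\<lambda>(x, v). iter_deriv n f x v)"
      by (rule continuous_on_eq[OF cont[OF \<phi>(1)]]) (use \<phi> in auto)
  qed
qed

text \<open>Derivatives of order \<open>Suc k\<close> are from here on opaque symbols matched by the
  lemmas below; unfolding would turn them into nested \<open>dir_deriv\<close> terms.\<close>

declare iter_deriv.simps(2) [simp del]

section \<open>Joint continuity, strict differentiability and multilinearity\<close>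

lemma iter_deriv_tendsto:
  assumes "smooth_on F U f" "x \<in> U" "range w \<subseteq> F"
    and "(y \<longlongrightarrow> x) G" "\<And>j. ((\<lambda>i. u i j) \<longlongrightarrow> w j) G"
    and "eventually (\<lambda>i. y i \<in> U \<and> range (u i) \<subseteq> F) G"
  shows "((\<lambda>i. iter_deriv k f (y i) (u i)) \<longlongrightarrow> iter_deriv k f x w) G"
proof -
  have c: "continuous_on (U \<times> {v. range v \<subseteq> F}) (\<lambda>(x, v). iter_deriv k f x v)"
    using assms(1) by (simp add: smooth_on_def)
  have "((\<lambda>i. case (y i, u i) of (x, v) \<Rightarrow> iter_deriv k f x v) \<longlongrightarrow> (case (x, w) of (x, v) \<Rightarrow> iter_deriv k f x v)) G"
    by (rule continuous_on_tendsto_compose[OF c])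
      (use assms in \<open>auto intro!: tendsto_Pair simp: tendsto_fun_iff elim: eventually_mono\<close>)
  then show ?thesis by simp
qed

text \<open>Strict differentiability: base point, step and all directions may vary with the index.
  The quotient is the increment, over the unit interval, of the derivative of order \<open>k\<close>
  along a segment, divided by the step. Its velocity is the derivative of order \<open>Suc k\<close>
  on the segment, which lies in \<open>K\<close> eventually by joint continuity, and
  \<open>mean_value_convex\<close> applies.\<close>

lemma iter_deriv_quotient_tendsto:
  fixes f :: "'e::lctvs \<Rightarrow> 'f::lctvs" and u :: "'i \<Rightarrow> nat \<Rightarrow> 'e"
  assumes F: "subspace F" "openin (top_of_set F) U" and sm: "smooth_on F U f"
    and x: "x \<in> U" "range w \<subseteq> F"
    and y: "(y \<longlongrightarrow> x) G" "eventually (\<lambda>i. y i \<in> F) G"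
    and \<tau>: "(\<tau> \<longlongrightarrow> 0) G" "eventually (\<lambda>i. \<tau> i \<noteq> 0) G"
    and u: "\<And>j. ((\<lambda>i. u i j) \<longlongrightarrow> w j) G" "eventually (\<lambda>i. range (u i) \<subseteq> F) G"
  shows "((\<lambda>i. (1 / \<tau> i) *\<^sub>R (iter_deriv k f (y i + \<tau> i *\<^sub>R u i k) (u i) - iter_deriv k f (y i) (u i)))
    \<longlongrightarrow> iter_deriv (Suc k) f x w) G"
proof (rule tendsto_convexI)
  fix K :: "'f set" assume K: "open K" "convex K" "iter_deriv (Suc k) f x w \<in> K"
  let ?D = "{v :: nat \<Rightarrow> 'e. range v \<subseteq> F}"
  obtain T where T: "open T" "U = F \<inter> T" using F(2) by (auto simp: openin_open)
  have c: "continuous_on (U \<times> ?D) (\<lambda>(x, v). iter_deriv (Suc k) f x v)"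
    using sm unfolding smooth_on_def by blast
  obtain O' where O': "open O'" "O' \<inter> (U \<times> ?D) = (\<lambda>(x, v). iter_deriv (Suc k) f x v) -` K \<inter> (U \<times> ?D)"
    using iffD1[OF continuous_on_open_invariant c, rule_format, OF K(1)] by (elim exE conjE)
  have "(x, w) \<in> O'" using O'(2) x K(3) by auto
  then obtain A B where AB: "open A" "open B" "x \<in> A" "w \<in> B" "A \<times> B \<subseteq> O'"
    using O'(1) by (metis mem_Sigma_iff open_prod_elim)
  \<comment> \<open>Convexity of \<open>C\<close> keeps the whole segment, not just its ends, inside
    the region where the derivative takes values in \<open>K\<close>.\<close>
  obtain C where C: "convex C" "open C" "x \<in> C" "C \<subseteq> A \<inter> T"
    by (rule ex_convex_open[of "A \<inter> T" x]) (use AB T x in auto)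
  have "((\<lambda>i. y i + \<tau> i *\<^sub>R u i k) \<longlongrightarrow> x + 0 *\<^sub>R w k) G"
    by (intro tendsto_add tendsto_scaleR_lctvs y u \<tau>)
  then have "eventually (\<lambda>i. y i + \<tau> i *\<^sub>R u i k \<in> C) G"
    using topological_tendstoD[OF _ C(2)] C(3) by force
  moreover have "eventually (\<lambda>i. y i \<in> C) G" by (rule topological_tendstoD[OF y(1) C(2,3)])
  moreover have "(u \<longlongrightarrow> w) G" using u by (simp add: tendsto_fun_iff)
  then have "eventually (\<lambda>i. u i \<in> B) G" by (rule topological_tendstoD[OF _ AB(2,4)])
  ultimately show "\<forall>\<^sub>F i in G. (1 / \<tau> i) *\<^sub>R (iter_deriv k f (y i + \<tau> i *\<^sub>R u i k) (u i) - iter_deriv k f (y i) (u i)) \<in> K"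
    using y(2) \<tau>(2) u(2)
  proof eventually_elim
    case (elim i)
    define t v where "t = \<tau> i" and "v = u i"
    let ?p = "\<lambda>s. y i + (s * t) *\<^sub>R v k"
    have v: "range v \<subseteq> F" "v \<in> B" "t \<noteq> 0" using elim by (auto simp: t_def v_def)
    have pU: "?p s \<in> U \<inter> A" if "0 \<le> s" "s \<le> 1" for s
    proof -
      have "(1 - s) *\<^sub>R y i + s *\<^sub>R (y i + t *\<^sub>R v k) \<in> C"
        by (rule convexD[OF C(1)]) (use elim that in \<open>auto simp: t_def v_def\<close>)
      also have "(1 - s) *\<^sub>R y i + s *\<^sub>R (y i + t *\<^sub>R v k) = ?p s" by (simp add: algebra_simps)
      finally have "?p s \<in> C" .
      moreover have "?p s \<in> F" by (rule line_in_subspace[OF F(1)]) (use elim v in auto)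
      ultimately show ?thesis using C(4) T by auto
    qed
    have "(\<lambda>s. (1 / t) *\<^sub>R iter_deriv k f (?p s) v) 1 - (\<lambda>s. (1 / t) *\<^sub>R iter_deriv k f (?p s) v) 0 \<in> K"
    proof (rule mean_value_convex[OF _ K(1,2)])
      fix s :: real assume s: "0 \<le> s" "s \<le> 1"
      have "filterlim (\<lambda>h::real. h * t) (at 0) (at 0)"
        unfolding filterlim_at using v(3) by (auto simp: eventually_at_filter intro!: tendsto_eq_intros)
      moreover have "has_dir_deriv (\<lambda>y. iter_deriv k f y v) (?p s) (v k) (iter_deriv (Suc k) f (?p s) v)"
        by (rule smooth_onD[OF sm]) (use pU[OF s] v in auto)
      ultimately have "((\<lambda>h. (1 / (h * t)) *\<^sub>R (iter_deriv k f (?p s + (h * t) *\<^sub>R v k) v - iter_deriv k f (?p s) v))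
          \<longlongrightarrow> iter_deriv (Suc k) f (?p s) v) (at 0)"
        unfolding has_dir_deriv_def by (rule filterlim_compose[rotated])
      moreover have "(1 / (h * t)) *\<^sub>R (iter_deriv k f (?p s + (h * t) *\<^sub>R v k) v - iter_deriv k f (?p s) v)
         = (1 / h) *\<^sub>R ((1 / t) *\<^sub>R iter_deriv k f (?p (s + h)) v - (1 / t) *\<^sub>R iter_deriv k f (?p s) v)" for h
        by (simp add: algebra_simps)
      ultimately show "((\<lambda>h. (1 / h) *\<^sub>R ((1 / t) *\<^sub>R iter_deriv k f (?p (s + h)) v - (1 / t) *\<^sub>R iter_deriv k f (?p s) v))
          \<longlongrightarrow> iter_deriv (Suc k) f (?p s) v) (at 0)" by simp
      have "(?p s, v) \<in> O' \<inter> (U \<times> ?D)" using pU[OF s] v AB by auto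
      then show "iter_deriv (Suc k) f (?p s) v \<in> K" unfolding O'(2) by simp
    qed
    then show ?case by (simp add: t_def v_def scaleR_diff_right)
  qed
qed

text \<open>Moving by \<open>a + b\<close> is a step along \<open>a\<close> followed by a step along
  \<open>b\<close> from the moving base point \<open>x + t *\<^sub>R a\<close>. The second step
  converges by strict differentiability; a derivative at the fixed point \<open>x\<close> would not
  suffice.\<close>

lemma iter_deriv_add_last:
  assumes F: "subspace F" "openin (top_of_set F) U" and sm: "smooth_on F U f"
    and x: "x \<in> U" "range v \<subseteq> F" "a \<in> F" "b \<in> F"
  shows "iter_deriv (Suc n) f x (v(n := a + b)) = iter_deriv (Suc n) f x (v(n := a)) + iter_deriv (Suc n) f x (v(n := b))"
proof (rule has_dir_deriv_unique)
  have r: "range (v(n := c)) \<subseteq> F" if "c \<in> F" for c using x that by auto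
  have c: "iter_deriv n f y (v(n := c)) = iter_deriv n f y v" for y c by (rule iter_deriv_cong_dirs) simp
  have D: "has_dir_deriv (\<lambda>y. iter_deriv n f y v) x c (iter_deriv (Suc n) f x (v(n := c)))" if "c \<in> F" for c
    using smooth_onD[OF sm x(1) r[OF that], of n] by (simp only: c fun_upd_same)
  show "has_dir_deriv (\<lambda>y. iter_deriv n f y v) x (a + b) (iter_deriv (Suc n) f x (v(n := a + b)))"
    by (rule D) (use x F in \<open>auto intro: subspace_add\<close>)
  have xF: "x \<in> F" using x F openin_imp_subset by blast
  have "((\<lambda>t. (1 / t) *\<^sub>R (iter_deriv n f ((x + t *\<^sub>R a) + t *\<^sub>R (v(n := b)) n) (v(n := b)) - iter_deriv n f (x + t *\<^sub>R a) (v(n := b))))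
      \<longlongrightarrow> iter_deriv (Suc n) f x (v(n := b))) (at 0)"
    by (rule iter_deriv_quotient_tendsto[OF F sm x(1) r[OF x(4)] tendsto_line])
      (use xF x in \<open>auto intro!: always_eventually line_in_subspace F tendsto_ident_at simp: eventually_at_filter\<close>)
  from tendsto_add[OF D[OF x(3), unfolded has_dir_deriv_def] this]
  show "has_dir_deriv (\<lambda>y. iter_deriv n f y v) x (a + b) (iter_deriv (Suc n) f x (v(n := a)) + iter_deriv (Suc n) f x (v(n := b)))"
    unfolding has_dir_deriv_def by (simp add: c algebra_simps)
qed

text \<open>The last slot is settled by \<open>iter_deriv_add_last\<close>. An earlier slot is a
  parameter of the remaining differentiations, so there the identity of lower order is
  differentiated once more.\<close>

lemma iter_deriv_add_slot:
  assumes F: "subspace F" "openin (top_of_set F) U" and sm: "smooth_on F U f"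
    and x: "x \<in> U" "range v \<subseteq> F" "a \<in> F" "b \<in> F" "j < n"
  shows "iter_deriv n f x (v(j := a + b)) = iter_deriv n f x (v(j := a)) + iter_deriv n f x (v(j := b))"
  using x
proof (induction n arbitrary: x)
  case (Suc n)
  show ?case
  proof (cases "j = n")
    case True
    show ?thesis unfolding True by (rule iter_deriv_add_last[OF F sm Suc.prems(1-4)])
  next
    case False
    with Suc.prems have j: "j < n" by simp
    have r: "range (v(j := c)) \<subseteq> F" if "c \<in> F" for c using Suc.prems that by auto
    have D: "has_dir_deriv (\<lambda>y. iter_deriv n f y (v(j := c))) x (v n) (iter_deriv (Suc n) f x (v(j := c)))" if "c \<in> F" for c
      using smooth_onD[OF sm Suc.prems(1) r[OF that], of n] False by auto
    show ?thesis
    proof (rule has_dir_deriv_unique[OF D])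
      show "a + b \<in> F" using Suc.prems F by (auto intro: subspace_add)
      show "has_dir_deriv (\<lambda>y. iter_deriv n f y (v(j := a + b))) x (v n) (iter_deriv (Suc n) f x (v(j := a)) + iter_deriv (Suc n) f x (v(j := b)))"
        by (subst has_dir_deriv_cong_on[OF F(1) _ F(2) Suc.prems(1), where g = "\<lambda>y. iter_deriv n f y (v(j := a)) + iter_deriv n f y (v(j := b))"])
          (use Suc.prems in \<open>auto intro!: has_dir_deriv_add D Suc.IH j\<close>)
    qed
  qed
qed simp

lemma iter_deriv_scale_slot:
  assumes F: "subspace F" "openin (top_of_set F) U" and sm: "smooth_on F U f"
    and x: "x \<in> U" "range v \<subseteq> F" "a \<in> F" "j < n"
  shows "iter_deriv n f x (v(j := r *\<^sub>R a)) = r *\<^sub>R iter_deriv n f x (v(j := a))"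
  using x
proof (induction n arbitrary: x)
  case (Suc n)
  have rF: "r *\<^sub>R a \<in> F" using Suc.prems F by (auto intro: subspace_scale)
  have rng: "range (v(j := c)) \<subseteq> F" if "c \<in> F" for c using Suc.prems that by auto
  show ?case
  proof (cases "j = n")
    case True
    have c: "iter_deriv n f y (v(n := c)) = iter_deriv n f y v" for y c by (rule iter_deriv_cong_dirs) simp
    have D: "has_dir_deriv (\<lambda>y. iter_deriv n f y v) x c (iter_deriv (Suc n) f x (v(n := c)))" if "c \<in> F" for c
      using smooth_onD[OF sm Suc.prems(1) rng[OF that], of n] unfolding True by (simp only: c fun_upd_same)
    show ?thesis unfolding True
      by (rule has_dir_deriv_unique[OF D[OF rF] has_dir_deriv_scale_dir[OF D]]) (rule Suc.prems)
  next
    case False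
    with Suc.prems have j: "j < n" by simp
    have D: "has_dir_deriv (\<lambda>y. iter_deriv n f y (v(j := c))) x (v n) (iter_deriv (Suc n) f x (v(j := c)))" if "c \<in> F" for c
      using smooth_onD[OF sm Suc.prems(1) rng[OF that], of n] False by auto
    show ?thesis
    proof (rule has_dir_deriv_unique[OF D[OF rF]])
      show "has_dir_deriv (\<lambda>y. iter_deriv n f y (v(j := r *\<^sub>R a))) x (v n) (r *\<^sub>R iter_deriv (Suc n) f x (v(j := a)))"
        by (subst has_dir_deriv_cong_on[OF F(1) _ F(2) Suc.prems(1), where g = "\<lambda>y. r *\<^sub>R iter_deriv n f y (v(j := a))"])
          (use Suc.prems in \<open>auto intro!: has_dir_deriv_scaleR D Suc.IH j\<close>)
    qed
  qed
qed simp

lemma dir_deriv_add: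
  assumes "subspace F" "openin (top_of_set F) U" "smooth_on F U f" "x \<in> U" "a \<in> F" "b \<in> F"
  shows "dir_deriv f x (a + b) = dir_deriv f x a + dir_deriv f x b"
  using iter_deriv_add_last[OF assms(1-4) _ assms(5,6), of "\<lambda>_. a" 0] assms(5) by (auto simp: iter_deriv.simps(2))

lemma dir_deriv_scale:
  assumes "smooth_on F U f" "x \<in> U" "a \<in> F"
  shows "dir_deriv f x (r *\<^sub>R a) = r *\<^sub>R dir_deriv f x a"
  by (rule dir_deriv_eqI[OF has_dir_deriv_scale_dir[OF smooth_onD1[OF assms]]])

lemma continuous_linear_dir_deriv:
  assumes "subspace F" "openin (top_of_set F) U" "smooth_on F U f" "x \<in> U"
  shows "continuous_linear_on F (dir_deriv f x)"
  unfolding continuous_linear_on_def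
proof (intro conjI ballI allI)
  have "((\<lambda>w. iter_deriv (Suc 0) f x (\<lambda>_. w)) \<longlongrightarrow> iter_deriv (Suc 0) f x (\<lambda>_. a)) (at a within F)" if "a \<in> F" for a
    by (rule iter_deriv_tendsto[OF assms(3,4)]) (use that assms(4) in \<open>auto simp: eventually_at_filter tendsto_ident_at\<close>)
  then show "continuous_on F (dir_deriv f x)"
    unfolding continuous_on_def by (simp add: iter_deriv.simps(2))
qed (use assms in \<open>auto simp: dir_deriv_scale intro: dir_deriv_add\<close>)

section \<open>The chain rule for derivatives of every order\<close>

lemma iter_deriv_curve:
  fixes g :: "'e::lctvs \<Rightarrow> 'f::lctvs" and W :: "real \<Rightarrow> nat \<Rightarrow> 'e"
  assumes F: "subspace F" "openin (top_of_set F) V" and sm: "smooth_on F V g"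
    and ev: "\<forall>\<^sub>F t in at 0. Y t \<in> V \<and> range (W t) \<subseteq> F" and 0: "Y 0 \<in> V" "range (W 0) \<subseteq> F"
    and y': "y' \<in> F" "((\<lambda>t. (1 / t) *\<^sub>R (Y t - Y 0)) \<longlongrightarrow> y') (at 0)"
    and w': "range w' \<subseteq> F" "\<And>j. ((\<lambda>t. (1 / t) *\<^sub>R (W t j - W 0 j)) \<longlongrightarrow> w' j) (at 0)"
  shows "((\<lambda>t. (1 / t) *\<^sub>R (iter_deriv k g (Y t) (W t) - iter_deriv k g (Y 0) (W 0))) \<longlongrightarrow>
     iter_deriv (Suc k) g (Y 0) ((W 0)(k := y')) + (\<Sum>j<k. iter_deriv k g (Y 0) ((W 0)(j := w' j)))) (at 0)"
proof -
  \<comment> \<open>The increment is split in two. In \<open>A'\<close> the base point moves while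
    the directions are already \<open>W t\<close>; in \<open>B'\<close> the base point rests and the
    directions are exchanged one at a time, where multilinearity turns each exchange into
    \<open>t\<close> times a value at the quotient \<open>p t j\<close>.\<close>
  define q where "q t = (1 / t) *\<^sub>R (Y t - Y 0)" for t
  define p where "p t j = (1 / t) *\<^sub>R (W t j - W 0 j)" for t j
  \<comment> \<open>Interpolates between the old and the new directions: the first \<open>j\<close>
    slots are new.\<close>
  define m where "m t j = (\<lambda>i. if i < j then W t i else W 0 i)" for t j
  have VF: "V \<subseteq> F" using F(2) by (rule openin_imp_subset)
  have t0: "\<forall>\<^sub>F t in at (0::real). t \<noteq> 0" by (simp add: eventually_at_filter)
  have W0: "((\<lambda>t. W t j) \<longlongrightarrow> W 0 j) (at 0)" for j
  proof -
    have "((\<lambda>t. W 0 j + t *\<^sub>R p t j) \<longlongrightarrow> W 0 j + 0 *\<^sub>R w' j) (at 0)"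
      unfolding p_def by (intro tendsto_add tendsto_const tendsto_scaleR_lctvs tendsto_ident_at w')
    moreover have "\<forall>\<^sub>F t in at 0. W 0 j + t *\<^sub>R p t j = W t j"
      using t0 by eventually_elim (simp add: p_def)
    ultimately show ?thesis by (simp add: Lim_transform_eventually)
  qed
  \<comment> \<open>Slot \<open>k\<close> is free at order \<open>k\<close>, so it can store the
    quotient \<open>q t\<close>. With \<open>Y t = Y 0 + t *\<^sub>R q t\<close> the strict quotient
    lemma then applies.\<close>
  have A: "((\<lambda>t. (1 / t) *\<^sub>R (iter_deriv k g (Y 0 + t *\<^sub>R ((W t)(k := q t)) k) ((W t)(k := q t)) - iter_deriv k g (Y 0) ((W t)(k := q t))))
     \<longlongrightarrow> iter_deriv (Suc k) g (Y 0) ((W 0)(k := y'))) (at 0)"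
  proof (rule iter_deriv_quotient_tendsto[OF F sm 0(1)])
    show "range ((W 0)(k := y')) \<subseteq> F" using 0 y' by auto
    show "((\<lambda>t. ((W t)(k := q t)) j) \<longlongrightarrow> ((W 0)(k := y')) j) (at 0)" for j
      using W0 y' by (simp add: q_def)
    show "\<forall>\<^sub>F t in at 0. range ((W t)(k := q t)) \<subseteq> F"
      using ev by eventually_elim
        (use VF 0 in \<open>auto simp: q_def intro!: subspace_scale subspace_diff F(1)\<close>)
    show "\<forall>\<^sub>F t in at (0::real). Y 0 \<in> F" using VF 0 by auto
  qed (use t0 in \<open>auto intro: tendsto_ident_at\<close>)
  have A': "((\<lambda>t. (1 / t) *\<^sub>R (iter_deriv k g (Y t) (W t) - iter_deriv k g (Y 0) (W t)))
     \<longlongrightarrow> iter_deriv (Suc k) g (Y 0) ((W 0)(k := y'))) (at 0)"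
  proof (rule Lim_transform_eventually[OF A])
    have c: "iter_deriv k g y (v(k := c)) = iter_deriv k g y v" for y v c by (rule iter_deriv_cong_dirs) simp
    show "\<forall>\<^sub>F t in at 0. (1 / t) *\<^sub>R (iter_deriv k g (Y 0 + t *\<^sub>R ((W t)(k := q t)) k) ((W t)(k := q t)) - iter_deriv k g (Y 0) ((W t)(k := q t)))
       = (1 / t) *\<^sub>R (iter_deriv k g (Y t) (W t) - iter_deriv k g (Y 0) (W t))"
      using t0 by eventually_elim (simp add: c q_def)
  qed
  have B: "((\<lambda>t. iter_deriv k g (Y 0) ((m t j)(j := p t j))) \<longlongrightarrow> iter_deriv k g (Y 0) ((W 0)(j := w' j))) (at 0)" for j
  proof (rule iter_deriv_tendsto[OF sm 0(1)])
    show "range ((W 0)(j := w' j)) \<subseteq> F" using 0 w'(1) by auto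
    show "((\<lambda>t. ((m t j)(j := p t j)) i) \<longlongrightarrow> ((W 0)(j := w' j)) i) (at 0)" for i
      using W0[of i] w'(2)[of j] by (cases "i = j"; cases "i < j") (auto simp: m_def p_def)
    show "\<forall>\<^sub>F t in at 0. Y 0 \<in> V \<and> range ((m t j)(j := p t j)) \<subseteq> F"
      using ev by eventually_elim
        (use 0 in \<open>auto simp: m_def p_def intro!: subspace_scale subspace_diff F(1)\<close>)
  qed (rule tendsto_const)
  have "((\<lambda>t. \<Sum>j<k. iter_deriv k g (Y 0) ((m t j)(j := p t j))) \<longlongrightarrow> (\<Sum>j<k. iter_deriv k g (Y 0) ((W 0)(j := w' j)))) (at 0)"
    by (intro tendsto_sum B)
  then have B': "((\<lambda>t. (1 / t) *\<^sub>R (iter_deriv k g (Y 0) (W t) - iter_deriv k g (Y 0) (W 0))) \<longlongrightarrow> (\<Sum>j<k. iter_deriv k g (Y 0) ((W 0)(j := w' j)))) (at 0)"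
  proof (rule Lim_transform_eventually)
    show "\<forall>\<^sub>F t in at 0. (\<Sum>j<k. iter_deriv k g (Y 0) ((m t j)(j := p t j))) = (1 / t) *\<^sub>R (iter_deriv k g (Y 0) (W t) - iter_deriv k g (Y 0) (W 0))"
      using ev t0
    proof eventually_elim
      case (elim t)
      have mF: "range (m t j) \<subseteq> F" for j using elim 0 by (auto simp: m_def)
      have *: "iter_deriv k g (Y 0) ((m t j)(j := p t j)) = (1 / t) *\<^sub>R (iter_deriv k g (Y 0) (m t (Suc j)) - iter_deriv k g (Y 0) (m t j))"
        if "j < k" for j
      proof -
        have d: "W t j - W 0 j \<in> F" "W 0 j \<in> F" using elim 0 by (auto intro!: subspace_diff F(1))
        \<comment> \<open>Passing from \<open>m t j\<close> to \<open>m t (Suc j)\<close> only adds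
          \<open>W t j - W 0 j\<close> in slot \<open>j\<close>.\<close>
        have "(m t j)(j := (W t j - W 0 j) + W 0 j) = m t (Suc j)" "(m t j)(j := W 0 j) = m t j"
          by (auto simp: m_def fun_eq_iff less_Suc_eq)
        then have "iter_deriv k g (Y 0) (m t (Suc j)) = iter_deriv k g (Y 0) ((m t j)(j := W t j - W 0 j)) + iter_deriv k g (Y 0) (m t j)"
          using iter_deriv_add_slot[OF F sm 0(1) mF[of j] d that] by simp
        moreover have "iter_deriv k g (Y 0) ((m t j)(j := p t j)) = (1 / t) *\<^sub>R iter_deriv k g (Y 0) ((m t j)(j := W t j - W 0 j))"
          unfolding p_def by (rule iter_deriv_scale_slot[OF F sm 0(1) mF[of j] d(1) that])
        ultimately show ?thesis by simp
      qed
      have "(\<Sum>j<k. iter_deriv k g (Y 0) ((m t j)(j := p t j))) = (\<Sum>j<k. (1 / t) *\<^sub>R (iter_deriv k g (Y 0) (m t (Suc j)) - iter_deriv k g (Y 0) (m t j)))"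
        by (intro sum.cong refl *) simp
      also have "\<dots> = (1 / t) *\<^sub>R (iter_deriv k g (Y 0) (m t k) - iter_deriv k g (Y 0) (m t 0))"
        using sum_lessThan_telescope[of "\<lambda>j. iter_deriv k g (Y 0) (m t j)" k]
        by (simp only: scaleR_sum_right[symmetric])
      also have "iter_deriv k g (Y 0) (m t k) = iter_deriv k g (Y 0) (W t)" by (rule iter_deriv_cong_dirs) (simp add: m_def)
      also have "m t 0 = W 0" by (simp add: m_def)
      finally show ?case .
    qed
  qed
  show ?thesis using tendsto_add[OF A' B'] by (simp add: algebra_simps)
qed

lemma has_dir_deriv_compose:
  assumes F: "subspace F" "openin (top_of_set F) U" and sf: "smooth_on F U f"
    and T: "subspace T" "closed T" "openin (top_of_set T) V" and sg: "smooth_on T V g"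
    and f: "f ` U \<subseteq> V" and x: "x \<in> U" "v \<in> F"
  shows "has_dir_deriv (\<lambda>y. g (f y)) x v (dir_deriv g (f x) (dir_deriv f x v))"
proof -
  have VT: "V \<subseteq> T" using T(3) by (rule openin_imp_subset)
  have D: "has_dir_deriv f x v (dir_deriv f x v)" by (rule smooth_onD1[OF sf x])
  have "dir_deriv f x v \<in> T"
    by (rule has_dir_deriv_in_subspace[OF F(1) x(2) F(2) x(1) T(1,2) _ D]) (use f VT in auto)
  \<comment> \<open>The case \<open>k = 0\<close>: there are no directions, so \<open>W\<close> is
    the constant \<open>0\<close>, the sum is empty and only the base point moves.\<close>
  then have "((\<lambda>t. (1 / t) *\<^sub>R (iter_deriv 0 g (f (x + t *\<^sub>R v)) (\<lambda>_. 0) - iter_deriv 0 g (f (x + 0 *\<^sub>R v)) (\<lambda>_. 0))) \<longlongrightarrow>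
     iter_deriv (Suc 0) g (f (x + 0 *\<^sub>R v)) ((\<lambda>_. 0)(0 := dir_deriv f x v)) + (\<Sum>j<(0::nat). iter_deriv 0 g (f (x + 0 *\<^sub>R v)) ((\<lambda>_. 0)(j := 0)))) (at 0)"
    using D f x eventually_line[OF F(1) x(2) F(2) x(1)]
    by (intro iter_deriv_curve[OF T(1,3) sg])
      (auto simp: has_dir_deriv_def subspace_0[OF T(1)] elim!: eventually_mono)
  then show ?thesis by (simp add: has_dir_deriv_def iter_deriv.simps(2))
qed

text \<open>The terms of the Faa di Bruno formula for the derivatives of \<open>g \<circ> f\<close>: \<open>s j\<close> selects the
  directions that enter the \<open>j\<close>-th argument of the \<open>k\<close>-th derivative of \<open>g\<close>.\<close>

inductive_set comp_family :: "('f::lctvs \<Rightarrow> 'h::lctvs) \<Rightarrow> ('e::lctvs \<Rightarrow> 'f) \<Rightarrow> ('e \<Rightarrow> (nat \<Rightarrow> 'e) \<Rightarrow> 'h) set" for g f where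
  base: "(\<lambda>x v. iter_deriv k g (f x) (\<lambda>j. iter_deriv (m j) f x (\<lambda>i. v (s j i)))) \<in> comp_family g f"
| zero: "(\<lambda>x v. 0) \<in> comp_family g f"
| add: "\<phi> \<in> comp_family g f \<Longrightarrow> \<psi> \<in> comp_family g f \<Longrightarrow> (\<lambda>x v. \<phi> x v + \<psi> x v) \<in> comp_family g f"

text \<open>The rule \<open>zero\<close> provides the empty sum.\<close>

lemma comp_family_sum:
  assumes "finite I" "\<And>j. j \<in> I \<Longrightarrow> \<phi> j \<in> comp_family g f"
  shows "(\<lambda>x v. \<Sum>j\<in>I. \<phi> j x v) \<in> comp_family g f"
  using assms by (induction I) (auto intro: comp_family.intros)

lemma continuous_on_iter_deriv_reindex:
  fixes f :: "'e::lctvs \<Rightarrow> 'f::lctvs" and s :: "nat \<Rightarrow> nat"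
  assumes "smooth_on F U f"
  shows "continuous_on (U \<times> {v. range v \<subseteq> F}) (\<lambda>(x, v). iter_deriv k f x (\<lambda>i. v (s i)))"
proof -
  have c: "continuous_on (U \<times> {v. range v \<subseteq> F}) (\<lambda>(x, v). iter_deriv k f x v)"
    using assms by (simp add: smooth_on_def)
  have p: "continuous_on (U \<times> {v :: nat \<Rightarrow> 'e. range v \<subseteq> F}) (\<lambda>p. (fst p, \<lambda>i. snd p (s i)))"
    by (intro continuous_on_Pair continuous_on_fst continuous_on_id continuous_on_coordinatewise_then_product
        continuous_on_product_then_coordinatewise[OF continuous_on_snd])
  have "continuous_on (U \<times> {v :: nat \<Rightarrow> 'e. range v \<subseteq> F}) (\<lambda>p. (\<lambda>(x, v). iter_deriv k f x v) (fst p, \<lambda>i. snd p (s i)))"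
    by (rule continuous_on_compose2[OF c p]) auto
  then show ?thesis by (simp add: case_prod_unfold)
qed

lemma iter_deriv_in_subspace:
  assumes F: "subspace F" "openin (top_of_set F) U" and sf: "smooth_on F U f"
    and T: "subspace T" "closed T" "f ` U \<subseteq> T" and x: "x \<in> U" "range v \<subseteq> F"
  shows "iter_deriv n f x v \<in> T"
  using x(1)
proof (induction n arbitrary: x)
  case (Suc n)
  show ?case
    by (rule has_dir_deriv_in_subspace[OF F(1) _ F(2) Suc.prems T(1,2) Suc.IH smooth_onD[OF sf Suc.prems x(2)]])
      (use x in auto)
qed (use T in auto)

text \<open>\<open>comp_family\<close> is closed under differentiation by
  \<open>iter_deriv_curve\<close>: a term yields one term in which the derivative falls on the base
  point of \<open>g\<close>, and \<open>k\<close> terms in which it falls on one of the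
  arguments.\<close>

lemma smooth_on_compose:
  fixes f :: "'e::lctvs \<Rightarrow> 'f::lctvs" and g :: "'f \<Rightarrow> 'h::lctvs"
  assumes F: "subspace F" "openin (top_of_set F) U" and sf: "smooth_on F U f"
    and T: "subspace T" "closed T" "openin (top_of_set T) V" and sg: "smooth_on T V g"
    and f: "f ` U \<subseteq> V"
  shows "smooth_on F U (\<lambda>x. g (f x))"
proof (rule smooth_on_family[OF F, where A = "comp_family g f"])
  let ?D = "{v :: nat \<Rightarrow> 'e. range v \<subseteq> F}"
  have VT: "V \<subseteq> T" using T(3) by (rule openin_imp_subset)
  have inT: "iter_deriv n f x v \<in> T" if "x \<in> U" "range v \<subseteq> F" for n x and v :: "nat \<Rightarrow> 'e"
    by (rule iter_deriv_in_subspace[OF F sf T(1,2) _ that]) (use f VT in auto)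
  show "continuous_on (U \<times> ?D) (\<lambda>(x, v). \<phi> x v)" if "\<phi> \<in> comp_family g f" for \<phi>
    using that
  proof induction
    case (base k m s)
    have c: "continuous_on (V \<times> {v. range v \<subseteq> T}) (\<lambda>(x, v). iter_deriv k g x v)"
      using sg by (simp add: smooth_on_def)
    have 1: "continuous_on (U \<times> ?D) (\<lambda>p. f (fst p))"
      using continuous_on_iter_deriv_reindex[OF sf, of 0] by (simp add: case_prod_unfold)
    have 2: "continuous_on (U \<times> ?D) (\<lambda>p. iter_deriv (m j) f (fst p) (\<lambda>i. snd p (s j i)))" for j
      using continuous_on_iter_deriv_reindex[OF sf, of "m j" "s j"] by (simp add: case_prod_unfold)
    have "continuous_on (U \<times> ?D) (\<lambda>p. (\<lambda>(x, v). iter_deriv k g x v) (f (fst p), \<lambda>j. iter_deriv (m j) f (fst p) (\<lambda>i. snd p (s j i))))"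
    proof (rule continuous_on_compose2[OF c])
      show "continuous_on (U \<times> ?D) (\<lambda>p. (f (fst p), \<lambda>j. iter_deriv (m j) f (fst p) (\<lambda>i. snd p (s j i))))"
        by (intro continuous_on_Pair 1 continuous_on_coordinatewise_then_product 2)
      show "(\<lambda>p. (f (fst p), \<lambda>j. iter_deriv (m j) f (fst p) (\<lambda>i. snd p (s j i)))) ` (U \<times> ?D) \<subseteq> V \<times> {v. range v \<subseteq> T}"
        using f by (auto intro!: inT)
    qed
    then show ?case by (simp add: case_prod_unfold)
  next
    case zero then show ?case by (simp add: case_prod_unfold)
  next
    case (add \<phi> \<psi>)
    then show ?case by (auto simp: case_prod_unfold intro!: continuous_on_add)
  qed
  show "\<exists>\<psi>\<in>comp_family g f. \<forall>x\<in>U. \<forall>v. range v \<subseteq> F \<longrightarrow> has_dir_deriv (\<lambda>y. \<phi> y v) x (v n) (\<psi> x v)"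
    if "\<phi> \<in> comp_family g f" for \<phi> n
    using that
  proof induction
    case (base k m s)
    \<comment> \<open>\<open>n\<close> is the direction of differentiation. In
      \<open>\<psi>0\<close> slot \<open>k\<close> receives a new argument, the first derivative of
      \<open>f\<close> in that direction; in \<open>\<psi>1 l\<close> the order of the argument in
      slot \<open>l\<close> is raised by one and \<open>n\<close> becomes its last
      direction.\<close>
    define s' where "s' j = (s j)(m j := n)" for j
    define \<psi>0 where "\<psi>0 = (\<lambda>x v. iter_deriv (Suc k) g (f x)
      (\<lambda>j. iter_deriv ((m(k := 1)) j) f x (\<lambda>i. v ((s(k := \<lambda>_. n)) j i))))"
    define \<psi>1 where "\<psi>1 = (\<lambda>l x v. iter_deriv k g (f x)
      (\<lambda>j. iter_deriv ((m(l := Suc (m l))) j) f x (\<lambda>i. v ((s(l := s' l)) j i))))"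
    have mem: "(\<lambda>x v. \<psi>0 x v + (\<Sum>l<k. \<psi>1 l x v)) \<in> comp_family g f"
      unfolding \<psi>0_def \<psi>1_def by (intro comp_family.add comp_family_sum comp_family.base) auto
    have D: "has_dir_deriv (\<lambda>y. iter_deriv k g (f y) (\<lambda>j. iter_deriv (m j) f y (\<lambda>i. v (s j i)))) x (v n)
        (\<psi>0 x v + (\<Sum>l<k. \<psi>1 l x v))" if xv: "x \<in> U" "range v \<subseteq> F" for x and v :: "nat \<Rightarrow> 'e"
    proof -
      define Y where "Y t = f (x + t *\<^sub>R v n)" for t
      define W where "W t = (\<lambda>j. iter_deriv (m j) f (x + t *\<^sub>R v n) (\<lambda>i. v (s j i)))" for t
      define y' where "y' = iter_deriv (Suc 0) f x (\<lambda>_. v n)"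
      define w' where "w' = (\<lambda>j. iter_deriv (Suc (m j)) f x (\<lambda>i. v (s' j i)))"
      have vn: "v n \<in> F" using xv by auto
      have ev: "\<forall>\<^sub>F t in at 0. x + t *\<^sub>R v n \<in> U" by (rule eventually_line[OF F(1) vn F(2) xv(1)])
      have W00: "W 0 = (\<lambda>j. iter_deriv (m j) f x (\<lambda>i. v (s j i)))" and Y0: "Y 0 = f x" by (simp_all add: W_def Y_def)
      have "((\<lambda>t. (1 / t) *\<^sub>R (iter_deriv k g (Y t) (W t) - iter_deriv k g (Y 0) (W 0))) \<longlongrightarrow>
         iter_deriv (Suc k) g (Y 0) ((W 0)(k := y')) + (\<Sum>j<k. iter_deriv k g (Y 0) ((W 0)(j := w' j)))) (at 0)"
      proof (rule iter_deriv_curve[OF T(1,3) sg])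
        show "\<forall>\<^sub>F t in at 0. Y t \<in> V \<and> range (W t) \<subseteq> T"
          using ev by eventually_elim (use f xv in \<open>auto simp: Y_def W_def intro!: inT\<close>)
        show "Y 0 \<in> V" "range (W 0) \<subseteq> T" "y' \<in> T" "range w' \<subseteq> T"
          using f xv by (auto simp: Y_def W_def y'_def w'_def intro!: inT)
        show "((\<lambda>t. (1 / t) *\<^sub>R (Y t - Y 0)) \<longlongrightarrow> y') (at 0)"
          using smooth_onD[OF sf xv(1), of "\<lambda>_. v n" 0] vn by (auto simp: has_dir_deriv_def Y_def y'_def)
        show "((\<lambda>t. (1 / t) *\<^sub>R (W t j - W 0 j)) \<longlongrightarrow> w' j) (at 0)" for j
        proof -
          have c: "iter_deriv (m j) f y (\<lambda>i. v (s' j i)) = iter_deriv (m j) f y (\<lambda>i. v (s j i))" for y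
            by (rule iter_deriv_cong_dirs) (simp add: s'_def)
          have "has_dir_deriv (\<lambda>y. iter_deriv (m j) f y (\<lambda>i. v (s' j i))) x (v (s' j (m j))) (iter_deriv (Suc (m j)) f x (\<lambda>i. v (s' j i)))"
            by (rule smooth_onD[OF sf xv(1)]) (use xv in auto)
          moreover have "s' j (m j) = n" by (simp add: s'_def)
          ultimately have "has_dir_deriv (\<lambda>y. iter_deriv (m j) f y (\<lambda>i. v (s j i))) x (v n) (w' j)"
            by (simp only: c w'_def)
          then show ?thesis by (simp add: has_dir_deriv_def W_def)
        qed
      qed
      moreover have "iter_deriv (Suc k) g (Y 0) ((W 0)(k := y')) = \<psi>0 x v"
        unfolding \<psi>0_def Y0 W00 y'_def by (intro arg_cong[where f = "iter_deriv (Suc k) g (f x)"]) (auto simp: fun_eq_iff)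
      moreover have "iter_deriv k g (Y 0) ((W 0)(l := w' l)) = \<psi>1 l x v" for l
        unfolding \<psi>1_def Y0 W00 w'_def
        by (intro arg_cong[where f = "iter_deriv k g (f x)"] ext) simp
      ultimately show ?thesis by (simp add: has_dir_deriv_def Y_def W_def)
    qed
    show ?case by (intro bexI[OF _ mem] ballI allI impI D)
  next
    case zero
    show ?case by (intro bexI[OF _ comp_family.zero]) simp
  next
    case (add \<phi> \<psi>)
    from add.IH obtain \<phi>' \<psi>' where
      \<phi>': "\<phi>' \<in> comp_family g f" "\<And>x v. x \<in> U \<Longrightarrow> range v \<subseteq> F \<Longrightarrow> has_dir_deriv (\<lambda>y. \<phi> y v) x (v n) (\<phi>' x v)"
      and \<psi>': "\<psi>' \<in> comp_family g f" "\<And>x v. x \<in> U \<Longrightarrow> range v \<subseteq> F \<Longrightarrow> has_dir_deriv (\<lambda>y. \<psi> y v) x (v n) (\<psi>' x v)"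
      by blast
    show ?case
      by (intro bexI[OF _ comp_family.add[OF \<phi>'(1) \<psi>'(1)]] ballI allI impI has_dir_deriv_add \<phi>' \<psi>')
  qed
  show "(\<lambda>x v. g (f x)) \<in> comp_family g f"
    using comp_family.base[of 0 g f] by simp
qed

section \<open>Affine maps, pairs and frozen directions\<close>

lemma continuous_linear_on_diff:
  assumes "subspace F" "continuous_linear_on F P" "a \<in> F" "b \<in> F"
  shows "P (a - b) = P a - P b"
proof -
  have "P (a - b) = P (a + (-1) *\<^sub>R b)" by simp
  also have "\<dots> = P a + (-1) *\<^sub>R P b"
    using assms unfolding continuous_linear_on_def by (metis subspace_scale)
  finally show ?thesis by simp
qed

lemma has_dir_deriv_affine:
  assumes "subspace F" "continuous_linear_on F P" "x \<in> F" "v \<in> F"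
  shows "has_dir_deriv (\<lambda>y. P y + k) x v (P v)"
proof -
  have "\<forall>\<^sub>F t in at (0::real). P v = (1 / t) *\<^sub>R (P (x + t *\<^sub>R v) + k - (P x + k))"
  proof -
    have "P (x + t *\<^sub>R v) = P x + t *\<^sub>R P v" for t
      using assms unfolding continuous_linear_on_def by (metis subspace_scale)
    then show ?thesis by (simp add: eventually_at_filter)
  qed
  then show ?thesis unfolding has_dir_deriv_def by (rule Lim_transform_eventually[OF tendsto_const])
qed

lemma smooth_on_affine:
  fixes P :: "'e::lctvs \<Rightarrow> 'f::lctvs"
  assumes F: "subspace F" "openin (top_of_set F) U" and P: "continuous_linear_on F P"
  shows "smooth_on F U (\<lambda>x. P x + k)"
proof (rule smooth_on_family[OF F])
  \<comment> \<open>Closed under differentiation: the affine map has the derivatives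
    \<open>P (v n)\<close>, which no longer depend on the base point.\<close>
  let ?A = "insert (\<lambda>x v. P x + k) (insert (\<lambda>x v. 0) (range (\<lambda>n x v. P (v n)))) :: ('e \<Rightarrow> (nat \<Rightarrow> 'e) \<Rightarrow> 'f) set"
  have UF: "U \<subseteq> F" using F by (simp add: openin_imp_subset)
  have cP: "continuous_on F P" using P by (simp add: continuous_linear_on_def)
  show "continuous_on (U \<times> {v. range v \<subseteq> F}) (\<lambda>(x, v). \<phi> x v)" if A: "\<phi> \<in> ?A" for \<phi>
  proof -
    have 1: "continuous_on (U \<times> {v :: nat \<Rightarrow> 'e. range v \<subseteq> F}) (\<lambda>p. P (fst p) + k)"
      by (intro continuous_on_add continuous_on_const continuous_on_compose2[OF cP] continuous_on_fst continuous_on_id)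
        (use UF in auto)
    have 2: "continuous_on (U \<times> {v :: nat \<Rightarrow> 'e. range v \<subseteq> F}) (\<lambda>p. P (snd p n))" for n
      by (intro continuous_on_compose2[OF cP] continuous_on_product_then_coordinatewise[OF continuous_on_snd] continuous_on_id) auto
    from A show ?thesis using 1 2 by (auto simp: case_prod_unfold)
  qed
  show "\<exists>\<psi>\<in>?A. \<forall>x\<in>U. \<forall>v. range v \<subseteq> F \<longrightarrow> has_dir_deriv (\<lambda>y. \<phi> y v) x (v n) (\<psi> x v)" if "\<phi> \<in> ?A" for \<phi> n
    using that
  proof (elim insertE rangeE)
    assume "\<phi> = (\<lambda>x v. P x + k)"
    then show ?thesis
      using UF by (intro bexI[of _ "\<lambda>x v. P (v n)"]) (auto intro!: has_dir_deriv_affine[OF F(1) P])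
  qed (auto intro!: bexI[of _ "\<lambda>x v. 0"])
qed simp

lemma smooth_on_const: "subspace F \<Longrightarrow> openin (top_of_set F) U \<Longrightarrow> smooth_on F U (\<lambda>x. k)"
  using smooth_on_affine[of F U "\<lambda>_. 0" k] by (simp add: continuous_linear_on_def)

lemma smooth_on_linear:
  "subspace F \<Longrightarrow> openin (top_of_set F) U \<Longrightarrow> continuous_linear_on F P \<Longrightarrow> smooth_on F U P"
  using smooth_on_affine[of F U P 0] by simp

lemma continuous_linear_on_id: "continuous_linear_on F (\<lambda>x. x)"
  by (simp add: continuous_linear_on_def)

lemma continuous_linear_on_fst: "continuous_linear_on F fst"
  by (auto simp: continuous_linear_on_def intro!: continuous_intros)

lemma continuous_linear_on_snd: "continuous_linear_on F snd"
  by (auto simp: continuous_linear_on_def intro!: continuous_intros)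

lemma has_dir_deriv_reindex:
  assumes "smooth_on F U f" "x \<in> U" "range v \<subseteq> F"
  shows "has_dir_deriv (\<lambda>y. iter_deriv k f y (\<lambda>i. v (s i))) x (v n) (iter_deriv (Suc k) f x (\<lambda>i. v ((s(k := n)) i)))"
proof -
  have c: "iter_deriv k f y (\<lambda>i. v ((s(k := n)) i)) = iter_deriv k f y (\<lambda>i. v (s i))" for y
    by (rule iter_deriv_cong_dirs) simp
  have "has_dir_deriv (\<lambda>y. iter_deriv k f y (\<lambda>i. v ((s(k := n)) i))) x (v ((s(k := n)) k)) (iter_deriv (Suc k) f x (\<lambda>i. v ((s(k := n)) i)))"
    by (rule smooth_onD[OF assms(1,2)]) (use assms(3) in auto)
  then show ?thesis by (simp only: c fun_upd_same)
qed

lemma has_dir_deriv_Pair: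
  "has_dir_deriv f x v l \<Longrightarrow> has_dir_deriv g x v m \<Longrightarrow> has_dir_deriv (\<lambda>y. (f y, g y)) x v (l, m)"
  unfolding has_dir_deriv_def using tendsto_Pair by (fastforce simp: scaleR_Pair)

lemma smooth_on_Pair:
  fixes f :: "'e::lctvs \<Rightarrow> 'f::lctvs" and g :: "'e \<Rightarrow> 'g::lctvs"
  assumes F: "subspace F" "openin (top_of_set F) U" and sm: "smooth_on F U f" "smooth_on F U g"
  shows "smooth_on F U (\<lambda>x. (f x, g x))"
proof (rule smooth_on_family[OF F])
  \<comment> \<open>\<open>s\<close> records which direction fills which slot; both components are
    differentiated in the same directions, so one \<open>s\<close> serves both.\<close>
  let ?A = "{\<lambda>x v. (iter_deriv k f x (\<lambda>i. v (s i)), iter_deriv k g x (\<lambda>i. v (s i))) | k s. True}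
     :: ('e \<Rightarrow> (nat \<Rightarrow> 'e) \<Rightarrow> 'f \<times> 'g) set"
  show "continuous_on (U \<times> {v. range v \<subseteq> F}) (\<lambda>(x, v). \<phi> x v)" if "\<phi> \<in> ?A" for \<phi>
    using that continuous_on_iter_deriv_reindex[OF sm(1)] continuous_on_iter_deriv_reindex[OF sm(2)]
    by (auto simp: case_prod_unfold intro!: continuous_on_Pair)
  show "\<exists>\<psi>\<in>?A. \<forall>x\<in>U. \<forall>v. range v \<subseteq> F \<longrightarrow> has_dir_deriv (\<lambda>y. \<phi> y v) x (v n) (\<psi> x v)" if "\<phi> \<in> ?A" for \<phi> n
  proof -
    from that obtain k s where \<phi>: "\<phi> = (\<lambda>x v. (iter_deriv k f x (\<lambda>i. v (s i)), iter_deriv k g x (\<lambda>i. v (s i))))" by auto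
    show ?thesis unfolding \<phi>
      by (rule bexI[of _ "\<lambda>x v. (iter_deriv (Suc k) f x (\<lambda>i. v ((s(k := n)) i)), iter_deriv (Suc k) g x (\<lambda>i. v ((s(k := n)) i)))"])
        (intro ballI allI impI has_dir_deriv_Pair has_dir_deriv_reindex[OF sm(1)] has_dir_deriv_reindex[OF sm(2)], blast+)
  qed
  show "(\<lambda>x v. (f x, g x)) \<in> ?A" by (auto intro!: exI[of _ 0])
qed

text \<open>Slot \<open>0\<close> belongs to the innermost differentiation, so freezing the first
  direction shifts the other directions up by one.\<close>

lemma iter_deriv_dir_deriv:
  "iter_deriv n (\<lambda>y. dir_deriv f y w) x v = iter_deriv (Suc n) f x (case_nat w v)"
  by (induction n arbitrary: x) (simp_all add: iter_deriv.simps(2))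

text \<open>Its iterated derivatives are those of \<open>f\<close> with \<open>w\<close> held in
  slot \<open>0\<close>. This is what makes \<open>Ad\<close> smooth in the group element.\<close>

lemma smooth_on_dir_deriv:
  fixes f :: "'e::lctvs \<Rightarrow> 'f::lctvs"
  assumes sm: "smooth_on F U f" and w: "w \<in> F"
  shows "smooth_on F U (\<lambda>y. dir_deriv f y w)"
  unfolding smooth_on_def iter_deriv_dir_deriv
proof (intro allI conjI ballI impI)
  fix n x and v :: "nat \<Rightarrow> 'e" assume xv: "x \<in> U" "range v \<subseteq> F"
  have "range (case_nat w v) \<subseteq> F" using xv w by (auto simp: image_subset_iff split: nat.split)
  from smooth_onD[OF sm xv(1) this, of "Suc n"]
  show "\<exists>l. has_dir_deriv (\<lambda>y. iter_deriv (Suc n) f y (case_nat w v)) x (v n) l" by auto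
next
  fix n
  let ?D = "{v :: nat \<Rightarrow> 'e. range v \<subseteq> F}"
  have c: "continuous_on (U \<times> ?D) (\<lambda>(x, v). iter_deriv (Suc n) f x v)"
    using sm unfolding smooth_on_def by blast
  have "continuous_on (U \<times> ?D) (\<lambda>p. case_nat w (snd p))"
  proof (rule continuous_on_coordinatewise_then_product)
    fix i show "continuous_on (U \<times> ?D) (\<lambda>p. case i of 0 \<Rightarrow> w | Suc x \<Rightarrow> snd p x)"
      by (cases i) (auto intro!: continuous_on_product_then_coordinatewise[OF continuous_on_snd] continuous_on_id)
  qed
  then have "continuous_on (U \<times> ?D) (\<lambda>p. (\<lambda>(x, v). iter_deriv (Suc n) f x v) (fst p, case_nat w (snd p)))"
    by (intro continuous_on_compose2[OF c] continuous_on_Pair continuous_on_fst continuous_on_id)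
      (use w in \<open>auto simp: image_subset_iff split: nat.split\<close>)
  then show "continuous_on (U \<times> ?D) (\<lambda>(x, v). iter_deriv (Suc n) f x (case_nat w v))"
    by (simp add: case_prod_unfold)
qed

subsection \<open>Germs of smooth maps\<close>

text \<open>The filter keeps the centre, unlike \<open>at x within F\<close>: an equality that holds
  eventually also holds at \<open>x\<close> itself when \<open>x\<close> lies in \<open>F\<close>,
  as derivatives at \<open>x\<close> require.\<close>

definition nbhds :: "'e::topological_space set \<Rightarrow> 'e \<Rightarrow> 'e filter" where
  "nbhds F x = inf (nhds x) (principal F)"

text \<open>A germ: the extent of the open set is forgotten, so that compositions and congruences
  need no bookkeeping of domains.\<close>

definition smooth_near :: "'e::lctvs set \<Rightarrow> 'e \<Rightarrow> ('e \<Rightarrow> 'f::lctvs) \<Rightarrow> bool" where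
  "smooth_near F x f \<longleftrightarrow> (\<exists>U. openin (top_of_set F) U \<and> x \<in> U \<and> smooth_on F U f)"

definition model_space :: "'e::lctvs set \<Rightarrow> bool" where
  "model_space F \<longleftrightarrow> subspace F \<and> closed F"

lemma eventually_nbhds:
  "eventually P (nbhds F x) \<longleftrightarrow> (\<exists>T. open T \<and> x \<in> T \<and> (\<forall>y\<in>T \<inter> F. P y))"
  unfolding nbhds_def eventually_inf_principal eventually_nhds by blast

lemma eventually_nbhds_openin:
  "x \<in> F \<Longrightarrow> eventually P (nbhds F x) \<longleftrightarrow> (\<exists>U. openin (top_of_set F) U \<and> x \<in> U \<and> (\<forall>y\<in>U. P y))"
  unfolding eventually_nbhds openin_open by (metis IntI Int_commute Int_iff)

lemma eventually_nbhds_in: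
  "openin (top_of_set F) U \<Longrightarrow> x \<in> U \<Longrightarrow> eventually (\<lambda>y. y \<in> U) (nbhds F x)"
  by (subst eventually_nbhds_openin) (auto dest: openin_imp_subset)

lemma eventually_nbhds_model: "eventually (\<lambda>y. y \<in> F) (nbhds F x)"
  unfolding nbhds_def eventually_inf_principal by simp

lemma filterlim_nbhds:
  "filterlim f (nbhds T y) G \<longleftrightarrow> (f \<longlongrightarrow> y) G \<and> eventually (\<lambda>i. f i \<in> T) G"
  unfolding nbhds_def by (simp add: filterlim_inf filterlim_principal)

lemma smooth_nearE:
  assumes "smooth_near F x f" "eventually P (nbhds F x)" "x \<in> F"
  obtains U where "openin (top_of_set F) U" "x \<in> U" "smooth_on F U f" "\<And>y. y \<in> U \<Longrightarrow> P y"
proof -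
  from assms(1) obtain U where U: "openin (top_of_set F) U" "x \<in> U" "smooth_on F U f"
    by (auto simp: smooth_near_def)
  from assms(2,3) obtain V where V: "openin (top_of_set F) V" "x \<in> V" "\<And>y. y \<in> V \<Longrightarrow> P y"
    by (auto simp: eventually_nbhds_openin)
  show thesis
    by (rule that[of "U \<inter> V"]) (use U V in \<open>auto intro: openin_Int smooth_on_subset\<close>)
qed

lemma smooth_nearI:
  "openin (top_of_set F) U \<Longrightarrow> x \<in> U \<Longrightarrow> smooth_on F U f \<Longrightarrow> smooth_near F x f"
  by (auto simp: smooth_near_def)

lemma smooth_near_in_model: "smooth_near F x f \<Longrightarrow> x \<in> F"
  unfolding smooth_near_def using openin_imp_subset by blast

lemma smooth_on_iff_near:
  assumes "subspace F" "openin (top_of_set F) U"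
  shows "smooth_on F U f \<longleftrightarrow> (\<forall>x\<in>U. smooth_near F x f)"
  using assms smooth_on_local[of F U f] unfolding smooth_near_def by blast

lemma smooth_near_cong:
  assumes "subspace F" "smooth_near F x f" "eventually (\<lambda>y. f y = g y) (nbhds F x)"
  shows "smooth_near F x g"
proof -
  obtain U where "openin (top_of_set F) U" "x \<in> U" "smooth_on F U f" "\<And>y. y \<in> U \<Longrightarrow> f y = g y"
    using smooth_nearE[OF assms(2,3) smooth_near_in_model[OF assms(2)]] by metis
  then show ?thesis using smooth_on_cong[OF assms(1)] smooth_nearI by metis
qed

lemma dir_deriv_cong_near:
  assumes "subspace F" "x \<in> F" "v \<in> F" "eventually (\<lambda>y. f y = g y) (nbhds F x)"
  shows "dir_deriv f x v = dir_deriv g x v" "has_dir_deriv f x v l \<longleftrightarrow> has_dir_deriv g x v l"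
proof -
  obtain U where "openin (top_of_set F) U" "x \<in> U" "\<And>y. y \<in> U \<Longrightarrow> f y = g y"
    using assms(2,4) by (auto simp: eventually_nbhds_openin)
  then show "dir_deriv f x v = dir_deriv g x v" "has_dir_deriv f x v l \<longleftrightarrow> has_dir_deriv g x v l"
    using dir_deriv_cong_on[OF assms(1,3)] has_dir_deriv_cong_on[OF assms(1,3)] by metis+
qed

lemma smooth_near_tendsto:
  assumes "smooth_near F x f"
  shows "(f \<longlongrightarrow> f x) (nbhds F x)"
proof -
  obtain U where U: "openin (top_of_set F) U" "x \<in> U" "smooth_on F U f"
    using assms by (auto simp: smooth_near_def)
  have xF: "x \<in> F" by (rule smooth_near_in_model[OF assms])
  have "((\<lambda>y. iter_deriv 0 f y (\<lambda>_. x)) \<longlongrightarrow> iter_deriv 0 f x (\<lambda>_. x)) (nbhds F x)"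
    by (rule iter_deriv_tendsto[OF U(3,2)])
      (use eventually_nbhds_in[OF U(1,2)] xF in \<open>auto simp: nbhds_def intro: tendsto_mono[OF _ filterlim_ident]\<close>)
  then show ?thesis by simp
qed

lemma smooth_near_has_dir_deriv:
  "smooth_near F x f \<Longrightarrow> v \<in> F \<Longrightarrow> has_dir_deriv f x v (dir_deriv f x v)"
  unfolding smooth_near_def using smooth_onD1 by blast

lemma smooth_near_continuous_linear:
  "subspace F \<Longrightarrow> smooth_near F x f \<Longrightarrow> continuous_linear_on F (dir_deriv f x)"
  unfolding smooth_near_def using continuous_linear_dir_deriv by blast

lemma dir_deriv_in_model:
  assumes "subspace F" "model_space T" "smooth_near F x f" "eventually (\<lambda>y. f y \<in> T) (nbhds F x)" "v \<in> F"
  shows "dir_deriv f x v \<in> T"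
proof -
  obtain U where U: "openin (top_of_set F) U" "x \<in> U" "smooth_on F U f" "\<And>y. y \<in> U \<Longrightarrow> f y \<in> T"
    using smooth_nearE[OF assms(3,4) smooth_near_in_model[OF assms(3)]] by metis
  show ?thesis
    by (rule has_dir_deriv_in_subspace[OF assms(1,5) U(1,2) _ _ U(4) smooth_onD1[OF U(3,2) assms(5)]])
      (use assms(2) in \<open>auto simp: model_space_def\<close>)
qed

text \<open>Continuity of \<open>f\<close> at \<open>x\<close> shrinks its domain until it maps into
  a set on which \<open>g\<close> is smooth.\<close>

lemma smooth_near_compose:
  assumes F: "subspace F" and T: "model_space T"
    and f: "smooth_near F x f" and g: "smooth_near T (f x) g"
    and fT: "eventually (\<lambda>y. f y \<in> T) (nbhds F x)"
  shows "smooth_near F x (\<lambda>y. g (f y))"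
    and "v \<in> F \<Longrightarrow> dir_deriv (\<lambda>y. g (f y)) x v = dir_deriv g (f x) (dir_deriv f x v)"
proof -
  obtain V where V: "openin (top_of_set T) V" "f x \<in> V" "smooth_on T V g"
    using g by (auto simp: smooth_near_def)
  have "filterlim f (nbhds T (f x)) (nbhds F x)"
    using smooth_near_tendsto[OF f] fT by (simp add: filterlim_nbhds)
  from eventually_compose_filterlim[OF eventually_nbhds_in[OF V(1,2)] this]
  obtain U where U: "openin (top_of_set F) U" "x \<in> U" "smooth_on F U f" "\<And>y. y \<in> U \<Longrightarrow> f y \<in> V"
    using smooth_nearE[OF f _ smooth_near_in_model[OF f]] by metis
  have T': "subspace T" "closed T" using T by (auto simp: model_space_def)
  have fU: "f ` U \<subseteq> V" using U by auto
  show "smooth_near F x (\<lambda>y. g (f y))"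
    by (rule smooth_nearI[OF U(1,2) smooth_on_compose[OF F U(1,3) T' V(1,3) fU]])
  show "dir_deriv (\<lambda>y. g (f y)) x v = dir_deriv g (f x) (dir_deriv f x v)" if "v \<in> F"
    by (rule dir_deriv_eqI[OF has_dir_deriv_compose[OF F U(1,3) T' V(1,3) fU U(2) that]])
qed

lemma smooth_near_mono:
  assumes "smooth_near F x f" "F' \<subseteq> F" "x \<in> F'"
  shows "smooth_near F' x f"
proof -
  obtain U where U: "openin (top_of_set F) U" "x \<in> U" "smooth_on F U f"
    using assms by (auto simp: smooth_near_def)
  have "openin (top_of_set F') (U \<inter> F')" using U(1) assms(2) by (auto simp: openin_open)
  then show ?thesis
    by (rule smooth_nearI) (use U assms in \<open>auto intro: smooth_on_subset\<close>)
qed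

lemma smooth_near_Pair:
  assumes F: "subspace F" and f: "smooth_near F x f" and g: "smooth_near F x g"
  shows "smooth_near F x (\<lambda>y. (f y, g y))"
    and "v \<in> F \<Longrightarrow> dir_deriv (\<lambda>y. (f y, g y)) x v = (dir_deriv f x v, dir_deriv g x v)"
proof -
  obtain U where U: "openin (top_of_set F) U" "x \<in> U" "smooth_on F U f"
    using f by (auto simp: smooth_near_def)
  obtain V where V: "openin (top_of_set F) V" "x \<in> V" "smooth_on F V g"
    using g by (auto simp: smooth_near_def)
  show "smooth_near F x (\<lambda>y. (f y, g y))"
    by (rule smooth_nearI[of F "U \<inter> V"])
      (use U V in \<open>auto intro!: smooth_on_Pair F openin_Int intro: smooth_on_subset\<close>)
  show "dir_deriv (\<lambda>y. (f y, g y)) x v = (dir_deriv f x v, dir_deriv g x v)" if "v \<in> F"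
    by (intro dir_deriv_eqI has_dir_deriv_Pair smooth_near_has_dir_deriv[OF _ that] f g)
qed

lemma smooth_near_affine:
  assumes "subspace F" "continuous_linear_on F P" "x \<in> F"
  shows "smooth_near F x (\<lambda>y. P y + k)" "smooth_near F x P" "v \<in> F \<Longrightarrow> dir_deriv P x v = P v"
proof -
  show "smooth_near F x (\<lambda>y. P y + k)" for k
    by (rule smooth_nearI[OF openin_subtopology_self assms(3) smooth_on_affine[OF assms(1) openin_subtopology_self assms(2)]])
  from this[of 0] show "smooth_near F x P" by simp
  show "dir_deriv P x v = P v" if "v \<in> F"
    using dir_deriv_eqI[OF has_dir_deriv_affine[OF assms that, of 0]] by simp
qed

lemma smooth_near_const: "subspace F \<Longrightarrow> x \<in> F \<Longrightarrow> smooth_near F x (\<lambda>y. k)"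
  by (rule smooth_nearI[OF openin_subtopology_self _ smooth_on_const[OF _ openin_subtopology_self]])

lemma smooth_near_id:
  "subspace F \<Longrightarrow> x \<in> F \<Longrightarrow> smooth_near F x (\<lambda>y. y)"
  "subspace F \<Longrightarrow> x \<in> F \<Longrightarrow> v \<in> F \<Longrightarrow> dir_deriv (\<lambda>y. y) x v = v"
  by (rule smooth_near_affine[OF _ continuous_linear_on_id]; assumption)+

lemma smooth_near_dir_deriv:
  assumes "smooth_near F x f" "w \<in> F"
  shows "smooth_near F x (\<lambda>y. dir_deriv f y w)"
  using assms smooth_on_dir_deriv unfolding smooth_near_def by blast

lemma model_space_Times: "model_space F \<Longrightarrow> model_space G \<Longrightarrow> model_space (F \<times> G)"
  unfolding model_space_def
  by (auto simp: closed_Times subspace_def zero_prod_def)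

subsection \<open>Charts and the manifold topology\<close>

text \<open>The manifold axioms without the Hausdorff property: the part that products, submanifolds
  and transported structures inherit through charts alone.\<close>

definition smooth_atlas :: "('a, 'e::lctvs) manifold \<Rightarrow> bool" where
  "smooth_atlas M \<longleftrightarrow>
     (\<forall>c\<in>atlas M. is_chart (points M) c) \<and>
     (\<Union>c\<in>atlas M. cdom c) = points M \<and>
     (\<forall>c\<in>atlas M. \<forall>d\<in>atlas M. smooth_transition c d)"

abbreviation mnear :: "('a, 'e::lctvs) manifold \<Rightarrow> 'a \<Rightarrow> 'a filter" where
  "mnear M x \<equiv> nhdsin (mtop M) x"

lemma is_manifold_smooth_atlas: "is_manifold M \<Longrightarrow> smooth_atlas M"
  by (auto simp: is_manifold_def smooth_atlas_def)

lemma openin_top_of_set_iff_nbhds: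
  "openin (top_of_set F) A \<longleftrightarrow> A \<subseteq> F \<and> (\<forall>x\<in>A. eventually (\<lambda>y. y \<in> A) (nbhds F x))"
proof (intro iffI conjI ballI)
  assume A: "A \<subseteq> F \<and> (\<forall>x\<in>A. eventually (\<lambda>y. y \<in> A) (nbhds F x))"
  show "openin (top_of_set F) A"
  proof (subst openin_subopen, intro ballI)
    fix x assume x: "x \<in> A"
    then have xF: "x \<in> F" and e: "eventually (\<lambda>y. y \<in> A) (nbhds F x)" using A by auto
    show "\<exists>T. openin (top_of_set F) T \<and> x \<in> T \<and> T \<subseteq> A"
      using e unfolding eventually_nbhds_openin[OF xF] by (auto simp: subset_eq)
  qed
qed (auto intro: eventually_nbhds_in dest: openin_imp_subset)

lemma is_chartD:
  assumes "is_chart X c"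
  shows "cdom c \<subseteq> X" "inj_on (cmap c) (cdom c)" "subspace (cmodel c)" "closed (cmodel c)"
    "model_space (cmodel c)" "openin (top_of_set (cmodel c)) (cmap c ` cdom c)"
  using assms by (auto simp: is_chart_def model_space_def)

lemma cinv_cmap: "is_chart X c \<Longrightarrow> x \<in> cdom c \<Longrightarrow> cinv c (cmap c x) = x"
  by (simp add: cinv_def is_chart_def)

lemma cmap_cinv: "y \<in> cmap c ` cdom c \<Longrightarrow> cmap c (cinv c y) = y"
  by (simp add: cinv_def f_inv_into_f)

lemma cinv_in: "y \<in> cmap c ` cdom c \<Longrightarrow> cinv c y \<in> cdom c"
  by (simp add: cinv_def inv_into_into)

lemma cmap_in_model: "is_chart X c \<Longrightarrow> x \<in> cdom c \<Longrightarrow> cmap c x \<in> cmodel c"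
  using is_chartD(6) openin_imp_subset by fastforce

lemma eventually_chart_image:
  "is_chart X c \<Longrightarrow> x \<in> cdom c \<Longrightarrow> eventually (\<lambda>y. y \<in> cmap c ` cdom c) (nbhds (cmodel c) (cmap c x))"
  by (rule eventually_nbhds_in[OF is_chartD(6)]) auto

lemma smooth_transition_near:
  assumes c: "is_chart X c" and d: "is_chart Y d" and t: "smooth_transition c d" and x: "x \<in> cdom c" "x \<in> cdom d"
  shows "smooth_near (cmodel c) (cmap c x) (\<lambda>y. cmap d (cinv c y))"
    "eventually (\<lambda>y. y \<in> cmap c ` cdom c \<and> cinv c y \<in> cdom d) (nbhds (cmodel c) (cmap c x))"
    "filterlim (\<lambda>y. cmap d (cinv c y)) (nbhds (cmodel d) (cmap d x)) (nbhds (cmodel c) (cmap c x))"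
proof -
  have o: "openin (top_of_set (cmodel c)) (cmap c ` (cdom c \<inter> cdom d))"
    and s: "smooth_on (cmodel c) (cmap c ` (cdom c \<inter> cdom d)) (\<lambda>y. cmap d (cinv c y))"
    using t by (auto simp: smooth_transition_def comp_def)
  have i: "cmap c x \<in> cmap c ` (cdom c \<inter> cdom d)" using x by auto
  show n: "smooth_near (cmodel c) (cmap c x) (\<lambda>y. cmap d (cinv c y))"
    by (rule smooth_nearI[OF o i s])
  show e: "eventually (\<lambda>y. y \<in> cmap c ` cdom c \<and> cinv c y \<in> cdom d) (nbhds (cmodel c) (cmap c x))"
    by (rule eventually_mono[OF eventually_nbhds_in[OF o i]]) (auto simp: cinv_cmap[OF c])
  show "filterlim (\<lambda>y. cmap d (cinv c y)) (nbhds (cmodel d) (cmap d x)) (nbhds (cmodel c) (cmap c x))"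
    unfolding filterlim_nbhds using smooth_near_tendsto[OF n] e
    by (auto simp: cinv_cmap[OF c x(1)] intro: cmap_in_model[OF d] elim!: eventually_mono)
qed

text \<open>Openness of the overlap is replaced by a condition at each of its points, which is the
  form the germ calculus delivers.\<close>

lemma smooth_transitionI:
  assumes c: "is_chart X c"
    and near: "\<And>x. x \<in> cdom c \<Longrightarrow> x \<in> cdom d \<Longrightarrow> smooth_near (cmodel c) (cmap c x) (\<lambda>y. cmap d (cinv c y))"
      "\<And>x. x \<in> cdom c \<Longrightarrow> x \<in> cdom d \<Longrightarrow> eventually (\<lambda>y. cinv c y \<in> cdom d) (nbhds (cmodel c) (cmap c x))"
  shows "smooth_transition c d"
proof -
  have o: "openin (top_of_set (cmodel c)) (cmap c ` (cdom c \<inter> cdom d))"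
    unfolding openin_top_of_set_iff_nbhds
  proof (intro conjI ballI)
    show "cmap c ` (cdom c \<inter> cdom d) \<subseteq> cmodel c" using cmap_in_model[OF c] by auto
  next
    fix z assume "z \<in> cmap c ` (cdom c \<inter> cdom d)"
    then obtain x where x: "x \<in> cdom c" "x \<in> cdom d" "z = cmap c x" by auto
    show "\<forall>\<^sub>F y in nbhds (cmodel c) z. y \<in> cmap c ` (cdom c \<inter> cdom d)"
      unfolding x(3) using near(2)[OF x(1,2)] eventually_chart_image[OF c x(1)]
      by eventually_elim (metis IntI imageI cmap_cinv cinv_in)
  qed
  have "smooth_on (cmodel c) (cmap c ` (cdom c \<inter> cdom d)) (\<lambda>y. cmap d (cinv c y))"
    by (subst smooth_on_iff_near[OF is_chartD(3)[OF c] o]) (use near(1) in auto)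
  with o show ?thesis by (simp add: smooth_transition_def comp_def)
qed

lemma compatible_chartD:
  assumes "compatible_chart M c"
  shows "is_chart (points M) c" "d \<in> atlas M \<Longrightarrow> smooth_transition c d" "d \<in> atlas M \<Longrightarrow> smooth_transition d c"
  using assms by (auto simp: compatible_chart_def)

lemma atlas_compatible: "smooth_atlas M \<Longrightarrow> c \<in> atlas M \<Longrightarrow> compatible_chart M c"
  by (auto simp: compatible_chart_def smooth_atlas_def)

lemma atlas_cover: "smooth_atlas M \<Longrightarrow> x \<in> points M \<Longrightarrow> \<exists>c\<in>atlas M. x \<in> cdom c"
  by (auto simp: smooth_atlas_def)

text \<open>Near each point of the overlap the transition factors through an atlas chart
  \<open>d\<close>, with which both charts are compatible.\<close>

lemma compatible_transition:
  assumes M: "smooth_atlas M" and c: "compatible_chart M c" and c': "compatible_chart M c'"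
  shows "smooth_transition c c'"
proof (rule smooth_transitionI)
  note cc = compatible_chartD(1)[OF c] and cc' = compatible_chartD(1)[OF c']
  show "is_chart (points M) c" by (rule cc)
  fix x assume x: "x \<in> cdom c" "x \<in> cdom c'"
  then have "x \<in> points M" using is_chartD(1)[OF cc] by auto
  then obtain d where d: "d \<in> atlas M" "x \<in> cdom d" using atlas_cover[OF M] by blast
  note cd = compatible_chartD(1)[OF atlas_compatible[OF M d(1)]]
  note 1 = smooth_transition_near[OF cc cd compatible_chartD(2)[OF c d(1)] x(1) d(2)]
  note 2 = smooth_transition_near[OF cd cc' compatible_chartD(3)[OF c' d(1)] d(2) x(2)]
  have eq: "eventually (\<lambda>y. cinv d (cmap d (cinv c y)) = cinv c y) (nbhds (cmodel c) (cmap c x))"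
    using 1(2) by eventually_elim (simp add: cinv_cmap[OF cd])
  show "eventually (\<lambda>y. cinv c y \<in> cdom c') (nbhds (cmodel c) (cmap c x))"
    using eventually_compose_filterlim[OF 2(2) 1(3)] eq by eventually_elim simp
  have s: "smooth_near (cmodel c) (cmap c x) (\<lambda>y. cmap c' (cinv d (cmap d (cinv c y))))"
    by (rule smooth_near_compose(1)[OF is_chartD(3)[OF cc] is_chartD(5)[OF cd] 1(1)])
      (use 1(3) 2(1) in \<open>simp_all add: cinv_cmap[OF cc x(1)] filterlim_nbhds\<close>)
  show "smooth_near (cmodel c) (cmap c x) (\<lambda>y. cmap c' (cinv c y))"
    by (rule smooth_near_cong[OF is_chartD(3)[OF cc] s]) (use eq in \<open>auto elim: eventually_mono\<close>)
qed

text \<open>\<open>topology\<close> is meaningful only for a family satisfying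
  \<open>istopology\<close>. The intersection axiom is the one that uses injectivity of the
  charts.\<close>

lemma openin_mtop:
  assumes M: "smooth_atlas M"
  shows "openin (mtop M) W \<longleftrightarrow> W \<subseteq> points M \<and> (\<forall>c\<in>atlas M. openin (top_of_set (cmodel c)) (cmap c ` (W \<inter> cdom c)))"
proof -
  have "istopology (\<lambda>W. W \<subseteq> points M \<and> (\<forall>c\<in>atlas M. openin (top_of_set (cmodel c)) (cmap c ` (W \<inter> cdom c))))"
    unfolding istopology_def
  proof (intro conjI allI impI ballI, goal_cases)
    case (2 S T c)
    have inj: "inj_on (cmap c) (cdom c)" using M 2 is_chartD(2) by (auto simp: smooth_atlas_def)
    have "cmap c ` (S \<inter> T \<inter> cdom c) = cmap c ` (S \<inter> cdom c) \<inter> cmap c ` (T \<inter> cdom c)"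
      using inj by (auto simp: inj_on_def)
    then show ?case using 2 by (auto intro: openin_Int)
  next
    case (4 K c)
    have "cmap c ` (\<Union>K \<inter> cdom c) = (\<Union>W\<in>K. cmap c ` (W \<inter> cdom c))" by auto
    then show ?case using 4 by (auto intro: openin_Union)
  qed auto
  then show ?thesis by (simp add: mtop_def topology_inverse')
qed

lemma topspace_mtop [simp]:
  assumes M: "smooth_atlas M"
  shows "topspace (mtop M) = points M"
proof
  show "topspace (mtop M) \<subseteq> points M" using openin_mtop[OF M] openin_topspace by blast
  have "cmap c ` (points M \<inter> cdom c) = cmap c ` cdom c" if "c \<in> atlas M" for c
    using M that is_chartD(1) by (fastforce simp: smooth_atlas_def)
  then have "openin (mtop M) (points M)"
    unfolding openin_mtop[OF M] using M by (auto simp: smooth_atlas_def is_chart_def)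
  then show "points M \<subseteq> topspace (mtop M)" by (rule openin_subset)
qed

lemma openin_iff_nhdsin:
  "openin X W \<longleftrightarrow> W \<subseteq> topspace X \<and> (\<forall>x\<in>W. eventually (\<lambda>y. y \<in> W) (nhdsin X x))"
proof (intro iffI conjI ballI)
  assume A: "W \<subseteq> topspace X \<and> (\<forall>x\<in>W. eventually (\<lambda>y. y \<in> W) (nhdsin X x))"
  show "openin X W"
  proof (subst openin_subopen, intro ballI)
    fix x assume "x \<in> W"
    with A show "\<exists>T. openin X T \<and> x \<in> T \<and> T \<subseteq> W"
      unfolding eventually_nhdsin by (meson subset_iff)
  qed
qed (auto simp: eventually_nhdsin dest: openin_subset)

lemma openin_mtop_compatible:
  assumes M: "smooth_atlas M" and W: "openin (mtop M) W" and c: "compatible_chart M c"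
  shows "openin (top_of_set (cmodel c)) (cmap c ` (W \<inter> cdom c))"
  unfolding openin_top_of_set_iff_nbhds
proof (intro conjI ballI)
  note cc = compatible_chartD(1)[OF c]
  show "cmap c ` (W \<inter> cdom c) \<subseteq> cmodel c" using cmap_in_model[OF cc] by auto
  fix z assume "z \<in> cmap c ` (W \<inter> cdom c)"
  then obtain x where x: "x \<in> W" "x \<in> cdom c" "z = cmap c x" by auto
  then have "x \<in> points M" using is_chartD(1)[OF cc] by auto
  then obtain d where d: "d \<in> atlas M" "x \<in> cdom d" using atlas_cover[OF M] by blast
  note cd = compatible_chartD(1)[OF atlas_compatible[OF M d(1)]]
  note 1 = smooth_transition_near[OF cc cd compatible_chartD(2)[OF c d(1)] x(2) d(2)]
  have "openin (top_of_set (cmodel d)) (cmap d ` (W \<inter> cdom d))"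
    using W d by (simp add: openin_mtop[OF M])
  then have "\<forall>\<^sub>F y in nbhds (cmodel d) (cmap d x). y \<in> cmap d ` (W \<inter> cdom d)"
    by (rule eventually_nbhds_in) (use x d in auto)
  from eventually_compose_filterlim[OF this 1(3)]
  show "\<forall>\<^sub>F y in nbhds (cmodel c) z. y \<in> cmap c ` (W \<inter> cdom c)"
    unfolding x(3) using 1(2)
  proof eventually_elim
    case (elim y)
    then have "cinv c y \<in> W" using is_chartD(2)[OF cd] by (auto simp: inj_on_def)
    then show ?case using elim cmap_cinv[of y c] cinv_in[of y c] by (metis IntI imageI)
  qed
qed

text \<open>A chart identifies the neighbourhood filter of the manifold with that of its model
  space. Topological statements about manifolds are reduced to coordinates by this
  equivalence.\<close>

lemma eventually_mnear:
  assumes M: "smooth_atlas M" and c: "compatible_chart M c" and x: "x \<in> cdom c"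
  shows "eventually P (mnear M x) \<longleftrightarrow> eventually (\<lambda>y. P (cinv c y)) (nbhds (cmodel c) (cmap c x))"
proof
  note cc = compatible_chartD(1)[OF c]
  have xM: "x \<in> points M" using is_chartD(1)[OF cc] x by auto
  {
    assume "eventually P (mnear M x)"
    then obtain W where W: "openin (mtop M) W" "x \<in> W" "\<And>y. y \<in> W \<Longrightarrow> P y"
      using xM by (auto simp: eventually_nhdsin M)
    show "eventually (\<lambda>y. P (cinv c y)) (nbhds (cmodel c) (cmap c x))"
      using eventually_nbhds_in[OF openin_mtop_compatible[OF M W(1) c], of "cmap c x"] W x
      by (auto elim!: eventually_mono simp: cinv_cmap[OF cc])
  }
  assume P: "eventually (\<lambda>y. P (cinv c y)) (nbhds (cmodel c) (cmap c x))"
  from eventually_conj[OF P eventually_chart_image[OF cc x]]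
  obtain U where U: "openin (top_of_set (cmodel c)) U" "cmap c x \<in> U" "\<And>y. y \<in> U \<Longrightarrow> P (cinv c y) \<and> y \<in> cmap c ` cdom c"
    by (auto simp: eventually_nbhds_openin cmap_in_model[OF cc x])
  define W where "W = cinv c ` U"
  have Wc: "W \<subseteq> cdom c" unfolding W_def using U(3) by (intro image_subsetI cinv_in) blast
  have mem: "y \<in> W \<longleftrightarrow> cmap c y \<in> U" if "y \<in> cdom c" for y
    using that U cmap_cinv cinv_cmap[OF cc] by (force simp: W_def)
  have "openin (mtop M) W"
    unfolding openin_mtop[OF M]
  proof (intro conjI ballI)
    show "W \<subseteq> points M" using Wc is_chartD(1)[OF cc] by auto
    fix d assume d: "d \<in> atlas M"
    note cd = compatible_chartD(1)[OF atlas_compatible[OF M d]]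
    show "openin (top_of_set (cmodel d)) (cmap d ` (W \<inter> cdom d))"
      unfolding openin_top_of_set_iff_nbhds
    proof (intro conjI ballI)
      show "cmap d ` (W \<inter> cdom d) \<subseteq> cmodel d" using cmap_in_model[OF cd] by auto
      fix z assume "z \<in> cmap d ` (W \<inter> cdom d)"
      then obtain y where y: "y \<in> W" "y \<in> cdom d" "z = cmap d y" by auto
      with Wc have yc: "y \<in> cdom c" by auto
      note 1 = smooth_transition_near[OF cd cc compatible_chartD(3)[OF c d] y(2) yc]
      have "\<forall>\<^sub>F y in nbhds (cmodel c) (cmap c y). y \<in> U"
        by (rule eventually_nbhds_in[OF U(1)]) (use mem[OF yc] y in auto)
      from eventually_compose_filterlim[OF this 1(3)] 1(2)
      show "\<forall>\<^sub>F y in nbhds (cmodel d) z. y \<in> cmap d ` (W \<inter> cdom d)"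
        unfolding y(3)
      proof eventually_elim
        case (elim y)
        then have "cinv d y \<in> W" using mem by simp
        then show ?case using elim cmap_cinv[of y d] cinv_in[of y d] by (metis IntI imageI)
      qed
    qed
  qed
  moreover have "x \<in> W" using mem[OF x] U by simp
  moreover have "P y" if "y \<in> W" for y using that U by (auto simp: W_def)
  ultimately show "eventually P (mnear M x)" by (auto simp: eventually_nhdsin)
qed

lemma filterlim_cinv:
  assumes "smooth_atlas M" "compatible_chart M c" "x \<in> cdom c"
  shows "filterlim (cinv c) (mnear M x) (nbhds (cmodel c) (cmap c x))"
  unfolding filterlim_iff eventually_mnear[OF assms] by simp

lemma eventually_mnear_cdom:
  assumes "smooth_atlas M" "compatible_chart M c" "x \<in> cdom c"
  shows "eventually (\<lambda>y. y \<in> cdom c) (mnear M x)"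
  unfolding eventually_mnear[OF assms]
  using eventually_chart_image[OF compatible_chartD(1)[OF assms(2)] assms(3)]
  by eventually_elim (simp add: cinv_in)

lemma eventually_mnear_self: "x \<in> points M \<Longrightarrow> smooth_atlas M \<Longrightarrow> eventually P (mnear M x) \<Longrightarrow> P x"
  by (auto simp: eventually_nhdsin)

lemma eventually_mnear_points: "smooth_atlas M \<Longrightarrow> eventually (\<lambda>y. y \<in> points M) (mnear M x)"
  unfolding eventually_nhdsin by (metis openin_topspace topspace_mtop)

subsection \<open>Germs of smooth maps between manifolds\<close>

text \<open>One pair of compatible charts is enough, by \<open>smooth_at_chart\<close> below.
  Convergence is part of the definition since outside the domain of \<open>d\<close> the coordinate
  expression says nothing about \<open>f\<close>.\<close>

definition smooth_at ::
    "('a, 'e::lctvs) manifold \<Rightarrow> ('b, 'f::lctvs) manifold \<Rightarrow> ('a \<Rightarrow> 'b) \<Rightarrow> 'a \<Rightarrow> bool" where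
  "smooth_at M N f x \<longleftrightarrow> x \<in> points M \<and> f x \<in> points N \<and> filterlim f (mnear N (f x)) (mnear M x) \<and>
     (\<exists>c d. compatible_chart M c \<and> compatible_chart N d \<and> x \<in> cdom c \<and> f x \<in> cdom d \<and>
        smooth_near (cmodel c) (cmap c x) (\<lambda>y. cmap d (f (cinv c y))))"

lemma smooth_atD:
  assumes "smooth_at M N f x"
  shows "x \<in> points M" "f x \<in> points N" "filterlim f (mnear N (f x)) (mnear M x)"
  using assms by (auto simp: smooth_at_def)

lemma smooth_at_eventually_cdom:
  assumes "smooth_at M N f x" "smooth_atlas N" "compatible_chart N d" "f x \<in> cdom d"
  shows "eventually (\<lambda>y. f y \<in> cdom d) (mnear M x)"
  by (rule eventually_compose_filterlim[OF eventually_mnear_cdom[OF assms(2-4)] smooth_atD(3)[OF assms(1)]])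

text \<open>In other charts the coordinate expression is the given one with transition maps composed
  on both sides.\<close>

lemma smooth_at_chart:
  assumes M: "smooth_atlas M" and N: "smooth_atlas N" and f: "smooth_at M N f x"
    and c: "compatible_chart M c" "x \<in> cdom c" and d: "compatible_chart N d" "f x \<in> cdom d"
  shows "smooth_near (cmodel c) (cmap c x) (\<lambda>y. cmap d (f (cinv c y)))"
    and "eventually (\<lambda>y. f (cinv c y) \<in> cdom d) (nbhds (cmodel c) (cmap c x))"
    and "eventually (\<lambda>y. cmap d (f (cinv c y)) \<in> cmodel d) (nbhds (cmodel c) (cmap c x))"
proof -
  from f obtain c' d' where c': "compatible_chart M c'" "x \<in> cdom c'" and d': "compatible_chart N d'" "f x \<in> cdom d'"
    and s: "smooth_near (cmodel c') (cmap c' x) (\<lambda>y. cmap d' (f (cinv c' y)))" by (auto simp: smooth_at_def)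
  note C = compatible_chartD(1)[OF c(1)] and C' = compatible_chartD(1)[OF c'(1)]
  note D = compatible_chartD(1)[OF d(1)] and D' = compatible_chartD(1)[OF d'(1)]
  note 1 = smooth_transition_near[OF C C' compatible_transition[OF M c(1) c'(1)] c(2) c'(2)]
  note 2 = smooth_transition_near[OF D' D compatible_transition[OF N d'(1) d(1)] d'(2) d(2)]
  have e': "eventually (\<lambda>y. f (cinv c' y) \<in> cdom d') (nbhds (cmodel c') (cmap c' x))"
    using smooth_at_eventually_cdom[OF f N d'] unfolding eventually_mnear[OF M c'] .
  show e: "eventually (\<lambda>y. f (cinv c y) \<in> cdom d) (nbhds (cmodel c) (cmap c x))"
    using smooth_at_eventually_cdom[OF f N d] unfolding eventually_mnear[OF M c] .
  then show "eventually (\<lambda>y. cmap d (f (cinv c y)) \<in> cmodel d) (nbhds (cmodel c) (cmap c x))"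
    by eventually_elim (rule cmap_in_model[OF D])
  have s1: "smooth_near (cmodel c') (cmap c' x) (\<lambda>y. cmap d (cinv d' (cmap d' (f (cinv c' y)))))"
    by (rule smooth_near_compose(1)[OF is_chartD(3)[OF C'] is_chartD(5)[OF D'] s])
      (use 2(1) e' in \<open>auto simp: cinv_cmap[OF C' c'(2)] elim!: eventually_mono intro: cmap_in_model[OF D']\<close>)
  have "smooth_near (cmodel c) (cmap c x) (\<lambda>z. (\<lambda>y. cmap d (cinv d' (cmap d' (f (cinv c' y))))) (cmap c' (cinv c z)))"
    by (rule smooth_near_compose(1)[OF is_chartD(3)[OF C] is_chartD(5)[OF C'] 1(1)])
      (use s1 1(3) in \<open>simp_all add: cinv_cmap[OF C c(2)] filterlim_nbhds\<close>)
  then show "smooth_near (cmodel c) (cmap c x) (\<lambda>y. cmap d (f (cinv c y)))"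
    by (rule smooth_near_cong[OF is_chartD(3)[OF C]])
      (use eventually_compose_filterlim[OF e' 1(3)] 1(2) in \<open>eventually_elim, simp add: cinv_cmap[OF C'] cinv_cmap[OF D']\<close>)
qed

text \<open>Convergence of \<open>f\<close> follows: the coordinate expression is continuous, and
  \<open>cinv d\<close> carries this back once \<open>f\<close> stays in the domain of
  \<open>d\<close>.\<close>

lemma smooth_atI:
  assumes M: "smooth_atlas M" and N: "smooth_atlas N"
    and c: "compatible_chart M c" "x \<in> cdom c" and d: "compatible_chart N d" "f x \<in> cdom d"
    and e: "eventually (\<lambda>y. f y \<in> cdom d) (mnear M x)"
    and s: "smooth_near (cmodel c) (cmap c x) (\<lambda>y. cmap d (f (cinv c y)))"
  shows "smooth_at M N f x"
  unfolding smooth_at_def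
proof (intro conjI exI)
  note C = compatible_chartD(1)[OF c(1)] and D = compatible_chartD(1)[OF d(1)]
  show "x \<in> points M" "f x \<in> points N" using is_chartD(1)[OF C] is_chartD(1)[OF D] c d by auto
  have e1: "\<forall>\<^sub>F y in nbhds (cmodel c) (cmap c x). f (cinv c y) \<in> cdom d"
    using e unfolding eventually_mnear[OF M c] .
  have "filterlim (\<lambda>y. cmap d (f (cinv c y))) (nbhds (cmodel d) (cmap d (f x))) (nbhds (cmodel c) (cmap c x))"
    unfolding filterlim_nbhds using smooth_near_tendsto[OF s] e1
    by (auto simp: cinv_cmap[OF C c(2)] elim!: eventually_mono intro: cmap_in_model[OF D])
  from filterlim_compose[OF filterlim_cinv[OF N d] this]
  have "filterlim (\<lambda>y. f (cinv c y)) (mnear N (f x)) (nbhds (cmodel c) (cmap c x))"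
    by (rule filterlim_mono_eventually[OF _ order_refl order_refl])
      (use e1 in \<open>auto elim!: eventually_mono simp: cinv_cmap[OF D]\<close>)
  then show "filterlim f (mnear N (f x)) (mnear M x)"
    unfolding filterlim_iff eventually_mnear[OF M c] by simp
qed (fact c d s)+

lemma smooth_at_compose:
  assumes M: "smooth_atlas M" and N: "smooth_atlas N" and P: "smooth_atlas P"
    and f: "smooth_at M N f x" and g: "smooth_at N P g (f x)"
  shows "smooth_at M P (\<lambda>y. g (f y)) x"
proof -
  obtain c where c: "c \<in> atlas M" "x \<in> cdom c" using atlas_cover[OF M smooth_atD(1)[OF f]] by auto
  obtain d where d: "d \<in> atlas N" "f x \<in> cdom d" using atlas_cover[OF N smooth_atD(2)[OF f]] by auto
  obtain e where e: "e \<in> atlas P" "g (f x) \<in> cdom e" using atlas_cover[OF P smooth_atD(2)[OF g]] by auto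
  note c' = atlas_compatible[OF M c(1)] and d' = atlas_compatible[OF N d(1)] and e' = atlas_compatible[OF P e(1)]
  note C = compatible_chartD(1)[OF c'] and D = compatible_chartD(1)[OF d']
  note 1 = smooth_at_chart[OF M N f c' c(2) d' d(2)] and 2 = smooth_at_chart[OF N P g d' d(2) e' e(2)]
  have "smooth_near (cmodel c) (cmap c x) (\<lambda>y. cmap e (g (cinv d (cmap d (f (cinv c y))))))"
    by (rule smooth_near_compose(1)[OF is_chartD(3)[OF C] is_chartD(5)[OF D] 1(1) _ 1(3)])
      (use 2(1) in \<open>simp add: cinv_cmap[OF C c(2)]\<close>)
  then have s: "smooth_near (cmodel c) (cmap c x) (\<lambda>y. cmap e (g (f (cinv c y))))"
    by (rule smooth_near_cong[OF is_chartD(3)[OF C]]) (use 1(2) in \<open>auto elim!: eventually_mono simp: cinv_cmap[OF D]\<close>)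
  have "eventually (\<lambda>y. g (f y) \<in> cdom e) (mnear M x)"
    by (rule eventually_compose_filterlim[OF smooth_at_eventually_cdom[OF g P e' e(2)] smooth_atD(3)[OF f]])
  from smooth_atI[OF M P c' c(2) e' e(2) this s] show ?thesis .
qed

lemma smooth_at_cong:
  assumes M: "smooth_atlas M" and N: "smooth_atlas N"
    and f: "smooth_at M N f x" and eq: "eventually (\<lambda>y. f y = g y) (mnear M x)"
  shows "smooth_at M N g x"
proof -
  obtain c where c: "c \<in> atlas M" "x \<in> cdom c" using atlas_cover[OF M smooth_atD(1)[OF f]] by auto
  obtain d where d: "d \<in> atlas N" "f x \<in> cdom d" using atlas_cover[OF N smooth_atD(2)[OF f]] by auto
  note c' = atlas_compatible[OF M c(1)] and d' = atlas_compatible[OF N d(1)]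
  have fg: "f x = g x" by (rule eventually_mnear_self[OF smooth_atD(1)[OF f] M eq])
  show ?thesis
  proof (rule smooth_atI[OF M N c' c(2) d'])
    show "g x \<in> cdom d" using d fg by simp
    show "eventually (\<lambda>y. g y \<in> cdom d) (mnear M x)"
      using smooth_at_eventually_cdom[OF f N d' d(2)] eq by eventually_elim simp
    show "smooth_near (cmodel c) (cmap c x) (\<lambda>y. cmap d (g (cinv c y)))"
      by (rule smooth_near_cong[OF is_chartD(3)[OF compatible_chartD(1)[OF c']] smooth_at_chart(1)[OF M N f c' c(2) d' d(2)]])
        (use eq in \<open>auto simp: eventually_mnear[OF M c' c(2)] elim: eventually_mono\<close>)
  qed
qed

lemma smooth_at_id:
  assumes M: "smooth_atlas M" and x: "x \<in> points M"
  shows "smooth_at M M (\<lambda>y. y) x"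
proof -
  obtain c where c: "c \<in> atlas M" "x \<in> cdom c" using atlas_cover[OF M x] by auto
  note c' = atlas_compatible[OF M c(1)]
  note C = compatible_chartD(1)[OF c']
  show ?thesis
  proof (rule smooth_atI[OF M M c' c(2) c' c(2) eventually_mnear_cdom[OF M c' c(2)]])
    show "smooth_near (cmodel c) (cmap c x) (\<lambda>y. cmap c (cinv c y))"
      by (rule smooth_near_cong[OF is_chartD(3)[OF C] smooth_near_id(1)[OF is_chartD(3)[OF C] cmap_in_model[OF C c(2)]]])
        (use eventually_chart_image[OF C c(2)] in \<open>auto elim!: eventually_mono simp: cmap_cinv\<close>)
  qed
qed

lemma smooth_at_const:
  assumes M: "smooth_atlas M" and N: "smooth_atlas N" and x: "x \<in> points M" "k \<in> points N"
  shows "smooth_at M N (\<lambda>y. k) x"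
proof -
  obtain c where c: "c \<in> atlas M" "x \<in> cdom c" using atlas_cover[OF M x(1)] by auto
  obtain d where d: "d \<in> atlas N" "k \<in> cdom d" using atlas_cover[OF N x(2)] by auto
  note c' = atlas_compatible[OF M c(1)] and d' = atlas_compatible[OF N d(1)]
  note C = compatible_chartD(1)[OF c']
  show ?thesis
    by (rule smooth_atI[OF M N c' c(2) d' d(2)])
      (use d in \<open>auto intro: smooth_near_const[OF is_chartD(3)[OF C] cmap_in_model[OF C c(2)]]\<close>)
qed

text \<open>\<open>smooth_map\<close> is stated with \<open>continuous_map\<close>, germs with
  filters; this translates between the two.\<close>

lemma continuous_map_iff_nhdsin:
  "continuous_map X Y f \<longleftrightarrow> (\<forall>x\<in>topspace X. f x \<in> topspace Y \<and> filterlim f (nhdsin Y (f x)) (nhdsin X x))"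
proof (intro iffI ballI conjI)
  fix x assume c: "continuous_map X Y f" and x: "x \<in> topspace X"
  then show "f x \<in> topspace Y" by (auto simp: continuous_map_def)
  show "filterlim f (nhdsin Y (f x)) (nhdsin X x)"
    unfolding filterlim_iff
  proof (intro allI impI)
    fix P assume "eventually P (nhdsin Y (f x))"
    then obtain W where W: "openin Y W" "f x \<in> W" "\<And>y. y \<in> W \<Longrightarrow> P y"
      using \<open>f x \<in> topspace Y\<close> by (auto simp: eventually_nhdsin)
    have "openin X {y \<in> topspace X. f y \<in> W}" using c W(1) by (auto simp: continuous_map_def)
    then show "eventually (\<lambda>y. P (f y)) (nhdsin X x)"
      unfolding eventually_nhdsin using W x by blast
  qed
next
  assume A: "\<forall>x\<in>topspace X. f x \<in> topspace Y \<and> filterlim f (nhdsin Y (f x)) (nhdsin X x)"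
  show "continuous_map X Y f"
    unfolding continuous_map_def
  proof (intro conjI allI impI)
    show "f \<in> topspace X \<rightarrow> topspace Y" using A by auto
    fix W assume W: "openin Y W"
    show "openin X {x \<in> topspace X. f x \<in> W}"
      unfolding openin_iff_nhdsin
    proof (intro conjI ballI)
      fix x assume x: "x \<in> {x \<in> topspace X. f x \<in> W}"
      with W have "eventually (\<lambda>y. y \<in> W) (nhdsin Y (f x))" unfolding openin_iff_nhdsin[of Y W] by auto
      then have "eventually (\<lambda>y. f y \<in> W) (nhdsin X x)"
        by (rule eventually_compose_filterlim) (use A x in auto)
      moreover have "eventually (\<lambda>y. y \<in> topspace X) (nhdsin X x)"
        using openin_iff_nhdsin[of X "topspace X"] x by auto
      ultimately show "eventually (\<lambda>y. y \<in> {x \<in> topspace X. f x \<in> W}) (nhdsin X x)"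
        by eventually_elim simp
    qed auto
  qed
qed

lemma smooth_map_iff_smooth_at:
  assumes M: "smooth_atlas M" and N: "smooth_atlas N"
  shows "smooth_map M N f \<longleftrightarrow> (\<forall>x\<in>points M. smooth_at M N f x)"
proof
  assume f: "smooth_map M N f"
  show "\<forall>x\<in>points M. smooth_at M N f x"
  proof
    fix x assume x: "x \<in> points M"
    have cont: "f x \<in> points N" "filterlim f (mnear N (f x)) (mnear M x)"
      using f x by (auto simp: smooth_map_def continuous_map_iff_nhdsin M N)
    obtain c where c: "c \<in> atlas M" "x \<in> cdom c" using atlas_cover[OF M x] by auto
    obtain d where d: "d \<in> atlas N" "f x \<in> cdom d" using atlas_cover[OF N cont(1)] by auto
    note c' = atlas_compatible[OF M c(1)] and d' = atlas_compatible[OF N d(1)]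
    note C = compatible_chartD(1)[OF c'] and D = compatible_chartD(1)[OF d']
    let ?A = "{x \<in> cdom c. f x \<in> cdom d}"
    have s: "smooth_on (cmodel c) (cmap c ` ?A) (\<lambda>y. cmap d (f (cinv c y)))"
      using f c d by (auto simp: smooth_map_def comp_def)
    have e: "eventually (\<lambda>y. f y \<in> cdom d) (mnear M x)"
      by (rule eventually_compose_filterlim[OF eventually_mnear_cdom[OF N d' d(2)] cont(2)])
    \<comment> \<open>Smoothness on a set yields a germ when the set is open; here continuity of
      \<open>f\<close> is what makes the coordinate domain open.\<close>
    have "openin (top_of_set (cmodel c)) (cmap c ` ?A)"
      unfolding openin_top_of_set_iff_nbhds
    proof (intro conjI ballI)
      show "cmap c ` ?A \<subseteq> cmodel c" using cmap_in_model[OF C] by auto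
      fix z assume "z \<in> cmap c ` ?A"
      then obtain y where y: "y \<in> cdom c" "f y \<in> cdom d" "z = cmap c y" by auto
      then have yM: "y \<in> points M" using is_chartD(1)[OF C] by auto
      have "eventually (\<lambda>y. f y \<in> cdom d) (mnear M y)"
        by (rule eventually_compose_filterlim[OF eventually_mnear_cdom[OF N d' y(2)]])
          (use f yM in \<open>auto simp: smooth_map_def continuous_map_iff_nhdsin M\<close>)
      then show "\<forall>\<^sub>F y in nbhds (cmodel c) z. y \<in> cmap c ` ?A"
        unfolding eventually_mnear[OF M c' y(1)] y(3)
        using eventually_chart_image[OF C y(1)]
      proof eventually_elim
        case (elim y)
        then have "cmap c (cinv c y) \<in> cmap c ` ?A" by (intro imageI) (simp add: cinv_in)
        then show ?case using elim by (simp add: cmap_cinv)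
      qed
    qed
    then have "smooth_near (cmodel c) (cmap c x) (\<lambda>y. cmap d (f (cinv c y)))"
      by (rule smooth_nearI[OF _ _ s]) (use c d in auto)
    from smooth_atI[OF M N c' c(2) d' d(2) e this] show "smooth_at M N f x" .
  qed
next
  assume f: "\<forall>x\<in>points M. smooth_at M N f x"
  show "smooth_map M N f"
    unfolding smooth_map_def
  proof (intro conjI ballI)
    show "continuous_map (mtop M) (mtop N) f"
      unfolding continuous_map_iff_nhdsin using f by (auto simp: M N intro: smooth_atD(2,3))
    fix c d assume c: "c \<in> atlas M" and d: "d \<in> atlas N"
    note c' = atlas_compatible[OF M c(1)] and d' = atlas_compatible[OF N d(1)]
    note C = compatible_chartD(1)[OF c'] and D = compatible_chartD(1)[OF d']
    show "smooth_on (cmodel c) (cmap c ` {x \<in> cdom c. f x \<in> cdom d}) (cmap d \<circ> f \<circ> cinv c)"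
    proof (rule smooth_on_local[OF is_chartD(3)[OF C]])
      fix z assume "z \<in> cmap c ` {x \<in> cdom c. f x \<in> cdom d}"
      then obtain x where x: "x \<in> cdom c" "f x \<in> cdom d" "z = cmap c x" by auto
      then have "x \<in> points M" using is_chartD(1)[OF C] by auto
      with f have "smooth_at M N f x" by auto
      from smooth_at_chart(1)[OF M N this c' x(1) d' x(2)]
      show "\<exists>V. openin (top_of_set (cmodel c)) V \<and> z \<in> V \<and> smooth_on (cmodel c) V (cmap d \<circ> f \<circ> cinv c)"
        by (simp add: smooth_near_def x(3) comp_def)
    qed
  qed
qed

subsection \<open>Vector-valued functions\<close>

text \<open>Vector-valued functions, chart maps among them, thereby obey the same composition and
  congruence rules as maps between manifolds.\<close>

definition vector_manifold :: "('f::lctvs, 'f) manifold" where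
  "vector_manifold = Manifold UNIV {Chart UNIV (\<lambda>x. x) UNIV}"

lemma cinv_Chart_UNIV [simp]: "cinv (Chart UNIV (\<lambda>x. x) UNIV) = (\<lambda>x. x)"
  by (rule ext) (simp add: cinv_def inv_into_f_eq)

lemma smooth_atlas_vector: "smooth_atlas vector_manifold"
  unfolding smooth_atlas_def vector_manifold_def
  by (auto simp: is_chart_def smooth_transition_def comp_def intro: smooth_on_linear continuous_linear_on_id)

lemma vector_chart:
  "compatible_chart vector_manifold (Chart UNIV (\<lambda>x. x) UNIV)"
  by (rule atlas_compatible[OF smooth_atlas_vector]) (simp add: vector_manifold_def)

lemma smooth_at_vector_iff:
  assumes M: "smooth_atlas M" and c: "compatible_chart M c" "x \<in> cdom c"
  shows "smooth_at M vector_manifold f x \<longleftrightarrow> smooth_near (cmodel c) (cmap c x) (\<lambda>y. f (cinv c y))"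
proof
  assume "smooth_at M vector_manifold f x"
  from smooth_at_chart(1)[OF M smooth_atlas_vector this c vector_chart]
  show "smooth_near (cmodel c) (cmap c x) (\<lambda>y. f (cinv c y))" by simp
next
  assume s: "smooth_near (cmodel c) (cmap c x) (\<lambda>y. f (cinv c y))"
  show "smooth_at M vector_manifold f x"
    by (rule smooth_atI[OF M smooth_atlas_vector c vector_chart]) (use s in auto)
qed

lemma smooth_fun_iff_smooth_at:
  assumes M: "smooth_atlas M"
  shows "smooth_fun M f \<longleftrightarrow> (\<forall>x\<in>points M. smooth_at M vector_manifold f x)"
proof -
  have 1: "smooth_on (cmodel c) (cmap c ` cdom c) (\<lambda>y. f (cinv c y)) \<longleftrightarrow> (\<forall>x\<in>cdom c. smooth_at M vector_manifold f x)"
    if c: "c \<in> atlas M" for c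
  proof -
    note c' = atlas_compatible[OF M c]
    note C = compatible_chartD(1)[OF c']
    show ?thesis
      unfolding smooth_on_iff_near[OF is_chartD(3)[OF C] is_chartD(6)[OF C]]
      using smooth_at_vector_iff[OF M c'] by auto
  qed
  then have "smooth_fun M f \<longleftrightarrow> (\<forall>c\<in>atlas M. \<forall>x\<in>cdom c. smooth_at M vector_manifold f x)"
    by (simp add: smooth_fun_def comp_def)
  also have "\<dots> \<longleftrightarrow> (\<forall>x\<in>points M. smooth_at M vector_manifold f x)"
  proof -
    have "points M = (\<Union>c\<in>atlas M. cdom c)" using M by (simp add: smooth_atlas_def)
    then show ?thesis by blast
  qed
  finally show ?thesis .
qed

lemma smooth_at_cmap:
  assumes M: "smooth_atlas M" and c: "compatible_chart M c" "x \<in> cdom c"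
  shows "smooth_at M vector_manifold (cmap c) x"
  unfolding smooth_at_vector_iff[OF assms]
  using compatible_transition[OF M c(1) c(1)] compatible_chartD(1)[OF c(1)] c(2)
  by (metis smooth_transition_near(1))

lemma smooth_at_cmap_compose:
  assumes "smooth_atlas M" "smooth_atlas N" "smooth_at M N f x" "compatible_chart N d" "f x \<in> cdom d"
  shows "smooth_at M vector_manifold (\<lambda>y. cmap d (f y)) x"
  using smooth_at_compose[OF assms(1,2) smooth_atlas_vector assms(3) smooth_at_cmap[OF assms(2,4,5)]] .

subsection \<open>Tangent vectors and tangent maps\<close>

lemma charts_atD:
  assumes "smooth_atlas M" "c \<in> charts_at M x"
  shows "compatible_chart M c" "x \<in> cdom c" "is_chart (points M) c" "c \<in> atlas M" "x \<in> points M"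
    "subspace (cmodel c)" "model_space (cmodel c)" "cmap c x \<in> cmodel c" "cinv c (cmap c x) = x"
proof -
  show x: "x \<in> cdom c" and a: "c \<in> atlas M"
    using assms(2) by (simp_all add: charts_at_def)
  show c: "compatible_chart M c" by (rule atlas_compatible[OF assms(1) a])
  show i: "is_chart (points M) c" by (rule compatible_chartD(1)[OF c])
  show "x \<in> points M" "subspace (cmodel c)" "model_space (cmodel c)" "cmap c x \<in> cmodel c" "cinv c (cmap c x) = x"
    using is_chartD[OF i] x cmap_in_model[OF i x] cinv_cmap[OF i x] by auto
qed

lemma charts_at_ex: "smooth_atlas M \<Longrightarrow> x \<in> points M \<Longrightarrow> \<exists>c. c \<in> charts_at M x"
  using atlas_cover by (fastforce simp: charts_at_def)

lemma charts_at_some: "smooth_atlas M \<Longrightarrow> x \<in> points M \<Longrightarrow> (SOME c. c \<in> charts_at M x) \<in> charts_at M x"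
  using charts_at_ex by (metis someI_ex)

lemma tangentD:
  assumes "v \<in> tangent M x"
  shows "c \<notin> charts_at M x \<Longrightarrow> v c = 0" "c \<in> charts_at M x \<Longrightarrow> v c \<in> cmodel c"
    "c \<in> charts_at M x \<Longrightarrow> d \<in> charts_at M x \<Longrightarrow> v d = dir_deriv (\<lambda>y. cmap d (cinv c y)) (cmap c x) (v c)"
  using assms unfolding tangent_def comp_def by blast+

lemma charts_at_transition_near:
  assumes M: "smooth_atlas M" and c: "c \<in> charts_at M x" and d: "d \<in> charts_at M x"
  shows "smooth_near (cmodel c) (cmap c x) (\<lambda>y. cmap d (cinv c y))"
    "eventually (\<lambda>y. y \<in> cmap c ` cdom c \<and> cinv c y \<in> cdom d) (nbhds (cmodel c) (cmap c x))"
    "filterlim (\<lambda>y. cmap d (cinv c y)) (nbhds (cmodel d) (cmap d x)) (nbhds (cmodel c) (cmap c x))"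
  using smooth_transition_near[OF charts_atD(3)[OF M c] charts_atD(3)[OF M d]
      compatible_chartD(2)[OF charts_atD(1)[OF M c] charts_atD(4)[OF M d]] charts_atD(2)[OF M c] charts_atD(2)[OF M d]] .

text \<open>The chain rule for the transition from the chart chosen by \<open>tderiv\<close> to
  \<open>c\<close>; the compatibility of the components of \<open>v\<close> absorbs its
  derivative.\<close>

lemma tderiv_chart:
  assumes M: "smooth_atlas M" and f: "smooth_at M vector_manifold f x" and v: "v \<in> tangent M x"
    and c: "c \<in> charts_at M x"
  shows "tderiv M x f v = dir_deriv (\<lambda>y. f (cinv c y)) (cmap c x) (v c)"
proof -
  define c' where "c' = (SOME c. c \<in> charts_at M x)"
  have c': "c' \<in> charts_at M x"
    unfolding c'_def by (rule charts_at_some[OF M charts_atD(5)[OF M c]])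
  note t = charts_at_transition_near[OF M c' c]
  have s: "smooth_near (cmodel c) (cmap c x) (\<lambda>y. f (cinv c y))"
    using f smooth_at_vector_iff[OF M charts_atD(1)[OF M c] charts_atD(2)[OF M c]] by blast
  have "tderiv M x f v = dir_deriv (\<lambda>y. f (cinv c' y)) (cmap c' x) (v c')"
    by (simp add: tderiv_def c'_def[symmetric] Let_def comp_def)
  also have "\<dots> = dir_deriv (\<lambda>z. (\<lambda>y. f (cinv c y)) (cmap c (cinv c' z))) (cmap c' x) (v c')"
    by (rule dir_deriv_cong_near(1)[OF charts_atD(6,8)[OF M c'] tangentD(2)[OF v c']])
      (use t(2) in \<open>auto elim!: eventually_mono simp: cinv_cmap[OF charts_atD(3)[OF M c]]\<close>)
  also have "\<dots> = dir_deriv (\<lambda>y. f (cinv c y)) (cmap c (cinv c' (cmap c' x))) (dir_deriv (\<lambda>z. cmap c (cinv c' z)) (cmap c' x) (v c'))"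
    by (rule smooth_near_compose(2)[OF charts_atD(6)[OF M c'] charts_atD(7)[OF M c] t(1) _ _ tangentD(2)[OF v c']])
      (use s t(3) in \<open>simp_all add: charts_atD(9)[OF M c'] filterlim_nbhds\<close>)
  also have "\<dots> = dir_deriv (\<lambda>y. f (cinv c y)) (cmap c x) (v c)"
    using tangentD(3)[OF v c' c] charts_atD(9)[OF M c'] by simp
  finally show ?thesis .
qed

lemma tderiv_cmap:
  assumes M: "smooth_atlas M" and v: "v \<in> tangent M x" and c: "c \<in> charts_at M x"
  shows "tderiv M x (cmap c) v = v c"
  unfolding tderiv_chart[OF M smooth_at_cmap[OF M charts_atD(1,2)[OF M c]] v c]
  by (rule tangentD(3)[OF v c c, symmetric])

lemma tangent_eqI:
  assumes "smooth_atlas M" "u \<in> tangent M x" "v \<in> tangent M x" "c \<in> charts_at M x" "u c = v c"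
  shows "u = v"
proof
  fix d show "u d = v d"
  proof (cases "d \<in> charts_at M x")
    case True
    show ?thesis
      unfolding tangentD(3)[OF assms(2,4) True] tangentD(3)[OF assms(3,4) True] assms(5) ..
  qed (simp add: tangentD(1)[OF assms(2)] tangentD(1)[OF assms(3)])
qed

lemma tmap_apply:
  assumes M: "smooth_atlas M" and N: "smooth_atlas N" and f: "smooth_at M N f x" and v: "v \<in> tangent M x"
    and d: "d \<in> charts_at N (f x)"
  shows "tmap M N f x v d = tderiv M x (\<lambda>y. cmap d (f y)) v"
    "c \<in> charts_at M x \<Longrightarrow> tmap M N f x v d = dir_deriv (\<lambda>y. cmap d (f (cinv c y))) (cmap c x) (v c)"
proof -
  show 1: "tmap M N f x v d = tderiv M x (\<lambda>y. cmap d (f y)) v" using d by (simp add: tmap_def comp_def)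
  show "tmap M N f x v d = dir_deriv (\<lambda>y. cmap d (f (cinv c y))) (cmap c x) (v c)" if c: "c \<in> charts_at M x"
    unfolding 1 by (rule tderiv_chart[OF M smooth_at_cmap_compose[OF M N f charts_atD(1,2)[OF N d]] v c])
qed

lemma tmap_in_tangent:
  assumes M: "smooth_atlas M" and N: "smooth_atlas N" and f: "smooth_at M N f x" and v: "v \<in> tangent M x"
  shows "tmap M N f x v \<in> tangent N (f x)"
proof -
  obtain c where c: "c \<in> charts_at M x" using charts_at_ex[OF M smooth_atD(1)[OF f]] by auto
  note A = charts_atD[OF M c]
  have vc: "v c \<in> cmodel c" by (rule tangentD(2)[OF v c])
  show ?thesis
    unfolding tangent_def mem_Collect_eq
  proof (intro conjI allI ballI impI)
    fix d assume "d \<notin> charts_at N (f x)" then show "tmap M N f x v d = 0" by (simp add: tmap_def)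
  next
    fix d assume d: "d \<in> charts_at N (f x)"
    note D = charts_atD[OF N d]
    note s = smooth_at_chart[OF M N f A(1,2) D(1,2)]
    show "tmap M N f x v d \<in> cmodel d"
      unfolding tmap_apply(2)[OF M N f v d c]
      by (rule dir_deriv_in_model[OF A(6) D(7) s(1,3) vc])
    fix e assume e: "e \<in> charts_at N (f x)"
    note t = charts_at_transition_near[OF N d e]
    have "tmap M N f x v e = dir_deriv (\<lambda>y. cmap e (f (cinv c y))) (cmap c x) (v c)"
      by (rule tmap_apply(2)[OF M N f v e c])
    also have "\<dots> = dir_deriv (\<lambda>y. (\<lambda>z. cmap e (cinv d z)) (cmap d (f (cinv c y)))) (cmap c x) (v c)"
      by (rule dir_deriv_cong_near(1)[OF A(6,8) vc])
        (use s(2) in \<open>auto elim!: eventually_mono simp: cinv_cmap[OF D(3)]\<close>)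
    also have "\<dots> = dir_deriv (\<lambda>z. cmap e (cinv d z)) (cmap d (f (cinv c (cmap c x)))) (dir_deriv (\<lambda>y. cmap d (f (cinv c y))) (cmap c x) (v c))"
      by (rule smooth_near_compose(2)[OF A(6) D(7) s(1) _ s(3) vc]) (use t(1) in \<open>simp add: A(9)\<close>)
    finally show "tmap M N f x v e = dir_deriv (cmap e \<circ> cinv d) (cmap d (f x)) (tmap M N f x v d)"
      by (simp add: A(9) tmap_apply(2)[OF M N f v d c] comp_def)
  qed
qed

lemma tderiv_compose:
  assumes M: "smooth_atlas M" and N: "smooth_atlas N" and f: "smooth_at M N f x" and v: "v \<in> tangent M x"
    and g: "smooth_at N vector_manifold g (f x)"
  shows "tderiv N (f x) g (tmap M N f x v) = tderiv M x (\<lambda>y. g (f y)) v"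
proof -
  obtain c where c: "c \<in> charts_at M x" using charts_at_ex[OF M smooth_atD(1)[OF f]] by auto
  obtain d where d: "d \<in> charts_at N (f x)" using charts_at_ex[OF N smooth_atD(2)[OF f]] by auto
  note A = charts_atD[OF M c] and D = charts_atD[OF N d]
  have vc: "v c \<in> cmodel c" by (rule tangentD(2)[OF v c])
  note s = smooth_at_chart[OF M N f A(1,2) D(1,2)]
  have g': "smooth_near (cmodel d) (cmap d (f x)) (\<lambda>z. g (cinv d z))"
    using g smooth_at_vector_iff[OF N D(1,2)] by blast
  have "tderiv M x (\<lambda>y. g (f y)) v = dir_deriv (\<lambda>y. g (f (cinv c y))) (cmap c x) (v c)"
    by (rule tderiv_chart[OF M smooth_at_compose[OF M N smooth_atlas_vector f g] v c])
  also have "\<dots> = dir_deriv (\<lambda>y. (\<lambda>z. g (cinv d z)) (cmap d (f (cinv c y)))) (cmap c x) (v c)"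
    by (rule dir_deriv_cong_near(1)[OF A(6,8) vc])
      (use s(2) in \<open>auto elim!: eventually_mono simp: cinv_cmap[OF D(3)]\<close>)
  also have "\<dots> = dir_deriv (\<lambda>z. g (cinv d z)) (cmap d (f (cinv c (cmap c x)))) (dir_deriv (\<lambda>y. cmap d (f (cinv c y))) (cmap c x) (v c))"
    by (rule smooth_near_compose(2)[OF A(6) D(7) s(1) _ s(3) vc]) (use g' in \<open>simp add: A(9)\<close>)
  also have "\<dots> = tderiv N (f x) g (tmap M N f x v)"
    unfolding tderiv_chart[OF N g tmap_in_tangent[OF M N f v] d] tmap_apply(2)[OF M N f v d c] by (simp add: A(9))
  finally show ?thesis ..
qed

lemma tmap_compose:
  assumes M: "smooth_atlas M" and N: "smooth_atlas N" and P: "smooth_atlas P"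
    and f: "smooth_at M N f x" and g: "smooth_at N P g (f x)" and v: "v \<in> tangent M x"
  shows "tmap N P g (f x) (tmap M N f x v) = tmap M P (\<lambda>y. g (f y)) x v"
proof
  fix e
  show "tmap N P g (f x) (tmap M N f x v) e = tmap M P (\<lambda>y. g (f y)) x v e"
  proof (cases "e \<in> charts_at P (g (f x))")
    case e: True
    note E = charts_atD[OF P e]
    show ?thesis
      unfolding tmap_apply(1)[OF N P g tmap_in_tangent[OF M N f v] e]
        tmap_apply(1)[where f = "\<lambda>y. g (f y)", OF M P smooth_at_compose[OF M N P f g] v e]
      by (rule tderiv_compose[OF M N f v smooth_at_cmap_compose[OF N P g E(1,2)]])
  qed (simp add: tmap_def)
qed

lemma tderiv_cong:
  assumes M: "smooth_atlas M" and x: "x \<in> points M" and v: "v \<in> tangent M x"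
    and eq: "eventually (\<lambda>y. f y = g y) (mnear M x)"
  shows "tderiv M x f v = tderiv M x g v"
proof -
  define c where "c = (SOME c. c \<in> charts_at M x)"
  have c: "c \<in> charts_at M x" unfolding c_def by (rule charts_at_some[OF M x])
  note A = charts_atD[OF M c]
  have "dir_deriv (\<lambda>y. f (cinv c y)) (cmap c x) (v c) = dir_deriv (\<lambda>y. g (cinv c y)) (cmap c x) (v c)"
    by (rule dir_deriv_cong_near(1)[OF A(6,8) tangentD(2)[OF v c]])
      (use eq in \<open>simp add: eventually_mnear[OF M A(1,2)]\<close>)
  then show ?thesis by (simp add: tderiv_def c_def[symmetric] Let_def comp_def)
qed

lemma tmap_cong:
  fixes M :: "('a, 'e::lctvs) manifold" and N :: "('b, 'f::lctvs) manifold"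
  assumes M: "smooth_atlas M" and x: "x \<in> points M" and v: "v \<in> tangent M x"
    and eq: "eventually (\<lambda>y. f y = g y) (mnear M x)"
  shows "tmap M N f x v = tmap M N g x v"
proof
  fix d :: "('b, 'f) chart"
  have "f x = g x" by (rule eventually_mnear_self[OF x M eq])
  moreover have "tderiv M x (cmap d \<circ> f) v = tderiv M x (cmap d \<circ> g) v"
    by (rule tderiv_cong[OF M x v]) (use eq in \<open>auto elim: eventually_mono\<close>)
  ultimately show "tmap M N f x v d = tmap M N g x v d" by (simp add: tmap_def)
qed

lemma tmap_id:
  assumes M: "smooth_atlas M" and v: "v \<in> tangent M x"
  shows "tmap M M (\<lambda>y. y) x v = v"
proof
  fix d
  show "tmap M M (\<lambda>y. y) x v d = v d"
    using tangentD(1)[OF v] tderiv_cmap[OF M v] by (simp add: tmap_def comp_def)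
qed

lemma tderiv_linear:
  assumes M: "smooth_atlas M" and f: "smooth_at M vector_manifold f x"
    and u: "u \<in> tangent M x" and v: "v \<in> tangent M x"
  shows "tderiv M x f (tadd u v) = tderiv M x f u + tderiv M x f v"
    "tderiv M x f (tscale a u) = a *\<^sub>R tderiv M x f u"
proof -
  define c where "c = (SOME c. c \<in> charts_at M x)"
  have c: "c \<in> charts_at M x" unfolding c_def by (rule charts_at_some[OF M smooth_atD(1)[OF f]])
  note A = charts_atD[OF M c]
  have "smooth_near (cmodel c) (cmap c x) (\<lambda>y. f (cinv c y))"
    using f smooth_at_vector_iff[OF M A(1,2)] by blast
  from smooth_near_continuous_linear[OF A(6) this] tangentD(2)[OF u c] tangentD(2)[OF v c]
  show "tderiv M x f (tadd u v) = tderiv M x f u + tderiv M x f v"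
    "tderiv M x f (tscale a u) = a *\<^sub>R tderiv M x f u"
    by (simp_all add: tderiv_def c_def[symmetric] Let_def comp_def tadd_def tscale_def continuous_linear_on_def)
qed

lemma tmap_linear:
  assumes M: "smooth_atlas M" and N: "smooth_atlas N" and f: "smooth_at M N f x"
    and u: "u \<in> tangent M x" and v: "v \<in> tangent M x"
  shows "tmap M N f x (tadd u v) = tadd (tmap M N f x u) (tmap M N f x v)"
    "tmap M N f x (tscale a u) = tscale a (tmap M N f x u)"
proof -
  have "tderiv M x (cmap d \<circ> f) (tadd u v) = tderiv M x (cmap d \<circ> f) u + tderiv M x (cmap d \<circ> f) v"
    "tderiv M x (cmap d \<circ> f) (tscale a u) = a *\<^sub>R tderiv M x (cmap d \<circ> f) u" if "d \<in> charts_at N (f x)" for d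
    using tderiv_linear[OF M smooth_at_cmap_compose[OF M N f charts_atD(1,2)[OF N that]] u v]
    by (simp_all add: comp_def)
  then show "tmap M N f x (tadd u v) = tadd (tmap M N f x u) (tmap M N f x v)"
    "tmap M N f x (tscale a u) = tscale a (tmap M N f x u)"
    by (auto simp: tmap_def tadd_def tscale_def fun_eq_iff)
qed

lemma tmap_zero: "tmap M N f x (\<lambda>_. 0) = (\<lambda>_. 0)"
proof -
  have "has_dir_deriv g y 0 0" for g :: "'d::lctvs \<Rightarrow> 'e::lctvs" and y by (simp add: has_dir_deriv_def)
  from dir_deriv_eqI[OF this] show ?thesis
    by (auto simp: tmap_def tderiv_def fun_eq_iff Let_def)
qed

lemma coord_tvec:
  assumes M: "smooth_atlas M" and c: "c \<in> charts_at M x"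
  shows "w \<in> cmodel c \<Longrightarrow> coord_tvec M x c w \<in> tangent M x" "w \<in> cmodel c \<Longrightarrow> coord_tvec M x c w c = w"
    "v \<in> tangent M x \<Longrightarrow> coord_tvec M x c (v c) = v"
proof -
  note A = charts_atD[OF M c]
  show cc: "coord_tvec M x c w c = w" if w: "w \<in> cmodel c" for w
  proof -
    have "coord_tvec M x c w c = dir_deriv (\<lambda>y. cmap c (cinv c y)) (cmap c x) w"
      using c by (simp add: coord_tvec_def comp_def)
    also have "\<dots> = dir_deriv (\<lambda>y. y) (cmap c x) w"
      by (rule dir_deriv_cong_near(1)[OF A(6,8) w])
        (use eventually_chart_image[OF A(3,2)] in \<open>auto elim!: eventually_mono simp: cmap_cinv\<close>)
    finally show ?thesis using smooth_near_id(2)[OF A(6,8) w] by simp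
  qed
  show "coord_tvec M x c w \<in> tangent M x" if w: "w \<in> cmodel c"
    unfolding tangent_def mem_Collect_eq
  proof (intro conjI allI ballI impI)
    fix d assume "d \<notin> charts_at M x" then show "coord_tvec M x c w d = 0" by (simp add: coord_tvec_def)
  next
    fix d assume d: "d \<in> charts_at M x"
    note D = charts_atD[OF M d]
    note t = charts_at_transition_near[OF M c d]
    have cd: "coord_tvec M x c w d = dir_deriv (\<lambda>y. cmap d (cinv c y)) (cmap c x) w" if "d \<in> charts_at M x" for d
      using that by (simp add: coord_tvec_def comp_def)
    show "coord_tvec M x c w d \<in> cmodel d"
      unfolding cd[OF d] by (rule dir_deriv_in_model[OF A(6) D(7) t(1) _ w]) (use t(3) in \<open>simp add: filterlim_nbhds\<close>)
    fix e assume e: "e \<in> charts_at M x"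
    have "coord_tvec M x c w e = dir_deriv (\<lambda>y. (\<lambda>z. cmap e (cinv d z)) (cmap d (cinv c y))) (cmap c x) w"
      unfolding cd[OF e]
      by (rule dir_deriv_cong_near(1)[OF A(6,8) w])
        (use t(2) in \<open>auto elim!: eventually_mono simp: cinv_cmap[OF D(3)]\<close>)
    also have "\<dots> = dir_deriv (\<lambda>z. cmap e (cinv d z)) (cmap d (cinv c (cmap c x))) (dir_deriv (\<lambda>y. cmap d (cinv c y)) (cmap c x) w)"
      by (rule smooth_near_compose(2)[OF A(6) D(7) t(1) _ _ w])
        (use t(3) charts_at_transition_near(1)[OF M d e] in \<open>simp_all add: A(9) filterlim_nbhds\<close>)
    finally show "coord_tvec M x c w e = dir_deriv (cmap e \<circ> cinv d) (cmap d x) (coord_tvec M x c w d)"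
      by (simp add: A(9) cd[OF d] comp_def)
  qed
  show "coord_tvec M x c (v c) = v" if v: "v \<in> tangent M x"
  proof
    fix d show "coord_tvec M x c (v c) d = v d"
      using tangentD(1)[OF v, of d] tangentD(3)[OF v c, of d]
      by (cases "d \<in> charts_at M x") (simp_all add: coord_tvec_def comp_def)
  qed
qed

subsection \<open>Products\<close>

abbreviation prod_chart :: "('a, 'e) chart \<Rightarrow> ('b, 'f) chart \<Rightarrow> ('a \<times> 'b, 'e \<times> 'f) chart" where
  "prod_chart c d \<equiv> Chart (cdom c \<times> cdom d) (map_prod (cmap c) (cmap d)) (cmodel c \<times> cmodel d)"

lemma points_prod [simp]: "points (prod_manifold M N) = points M \<times> points N"
  by (simp add: prod_manifold_def)

lemma atlas_prod: "atlas (prod_manifold M N) = {prod_chart c d | c d. c \<in> atlas M \<and> d \<in> atlas N}"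
  by (simp add: prod_manifold_def)

lemma is_chart_prod:
  assumes c: "is_chart X c" and d: "is_chart Y d"
  shows "is_chart (X \<times> Y) (prod_chart c d)"
proof -
  note C = is_chartD[OF c] and D = is_chartD[OF d]
  have "model_space (cmodel c \<times> cmodel d)" by (rule model_space_Times[OF C(5) D(5)])
  moreover have "openin (top_of_set (cmodel c \<times> cmodel d)) (map_prod (cmap c) (cmap d) ` (cdom c \<times> cdom d))"
    using openin_Times[OF C(6) D(6)] by (simp add: map_prod_surj_on[of "cmap c" _ _ "cmap d"])
  ultimately show ?thesis
    using C(1,2) D(1,2) by (auto simp: is_chart_def model_space_def intro: map_prod_inj_on)
qed

lemma cinv_prod_chart:
  assumes "is_chart X c" "is_chart Y d" "a \<in> cmap c ` cdom c" "b \<in> cmap d ` cdom d"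
  shows "cinv (prod_chart c d) (a, b) = (cinv c a, cinv d b)"
proof -
  have "inj_on (map_prod (cmap c) (cmap d)) (cdom c \<times> cdom d)"
    using is_chartD(2)[OF assms(1)] is_chartD(2)[OF assms(2)] by (rule map_prod_inj_on)
  then show ?thesis
    unfolding cinv_def[of "prod_chart c d"] chart.sel
    by (rule inv_into_f_eq) (use assms(3,4) in \<open>auto simp: cmap_cinv cinv_in\<close>)
qed

lemma filterlim_fst_nbhds: "filterlim fst (nbhds F x) (nbhds (F \<times> G) (x, y))"
  and filterlim_snd_nbhds: "filterlim snd (nbhds G y) (nbhds (F \<times> G) (x, y))"
proof -
  have "(fst \<longlongrightarrow> x) (nhds (x, y))" "(snd \<longlongrightarrow> y) (nhds (x, y))"
    using tendsto_fst[OF filterlim_ident, of "(x, y)"] tendsto_snd[OF filterlim_ident, of "(x, y)"] by simp_all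
  then have "(fst \<longlongrightarrow> x) (nbhds (F \<times> G) (x, y))" "(snd \<longlongrightarrow> y) (nbhds (F \<times> G) (x, y))"
    by (auto simp: nbhds_def intro: tendsto_mono[rotated])
  then show "filterlim fst (nbhds F x) (nbhds (F \<times> G) (x, y))" "filterlim snd (nbhds G y) (nbhds (F \<times> G) (x, y))"
    using eventually_nbhds_model[of "F \<times> G" "(x, y)"] unfolding filterlim_nbhds by (auto elim!: eventually_mono)
qed

lemma smooth_near_map_prod:
  assumes F: "model_space F" and G: "model_space G" and f: "smooth_near F x f" and g: "smooth_near G y g"
  shows "smooth_near (F \<times> G) (x, y) (\<lambda>p. (f (fst p), g (snd p)))"
proof -
  have sFG: "subspace (F \<times> G)" using model_space_Times[OF F G] by (simp add: model_space_def)
  have xy: "(x, y) \<in> F \<times> G" using smooth_near_in_model[OF f] smooth_near_in_model[OF g] by simp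
  have 1: "smooth_near (F \<times> G) (x, y) (\<lambda>p. f (fst p))"
    by (rule smooth_near_compose(1)[OF sFG F smooth_near_affine(2)[OF sFG continuous_linear_on_fst xy]])
      (use f eventually_nbhds_model[of "F \<times> G" "(x, y)"] in \<open>auto elim!: eventually_mono\<close>)
  have 2: "smooth_near (F \<times> G) (x, y) (\<lambda>p. g (snd p))"
    by (rule smooth_near_compose(1)[OF sFG G smooth_near_affine(2)[OF sFG continuous_linear_on_snd xy]])
      (use g eventually_nbhds_model[of "F \<times> G" "(x, y)"] in \<open>auto elim!: eventually_mono\<close>)
  show ?thesis by (rule smooth_near_Pair(1)[OF sFG 1 2])
qed

lemma smooth_atlas_prod:
  assumes M: "smooth_atlas M" and N: "smooth_atlas N"
  shows "smooth_atlas (prod_manifold M N)"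
  unfolding smooth_atlas_def
proof (intro conjI ballI)
  have C: "is_chart (points M) c" if "c \<in> atlas M" for c using M that by (auto simp: smooth_atlas_def)
  have D: "is_chart (points N) d" if "d \<in> atlas N" for d using N that by (auto simp: smooth_atlas_def)
  fix e assume "e \<in> atlas (prod_manifold M N)"
  then obtain c d where e: "e = prod_chart c d" "c \<in> atlas M" "d \<in> atlas N" by (auto simp: atlas_prod)
  show ce: "is_chart (points (prod_manifold M N)) e"
    unfolding e(1) points_prod by (rule is_chart_prod[OF C[OF e(2)] D[OF e(3)]])
  fix e' assume "e' \<in> atlas (prod_manifold M N)"
  then obtain c' d' where e': "e' = prod_chart c' d'" "c' \<in> atlas M" "d' \<in> atlas N" by (auto simp: atlas_prod)
  note c = C[OF e(2)] and d = D[OF e(3)] and c' = C[OF e'(2)] and d' = D[OF e'(3)]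
  have tc: "smooth_transition c c'" "smooth_transition d d'" using M N e e' by (auto simp: smooth_atlas_def)
  show "smooth_transition e e'"
  proof (rule smooth_transitionI[OF ce])
    fix p assume "p \<in> cdom e" "p \<in> cdom e'"
    then obtain x y where p: "p = (x, y)" "x \<in> cdom c" "x \<in> cdom c'" "y \<in> cdom d" "y \<in> cdom d'"
      unfolding e(1) e'(1) by auto
    note 1 = smooth_transition_near[OF c c' tc(1) p(2,3)] and 2 = smooth_transition_near[OF d d' tc(2) p(4,5)]
    have ep: "cmap e p = (cmap c x, cmap d y)" "cmodel e = cmodel c \<times> cmodel d" by (simp_all add: e(1) p(1))
    have ev: "\<forall>\<^sub>F q in nbhds (cmodel e) (cmap e p). (fst q \<in> cmap c ` cdom c \<and> cinv c (fst q) \<in> cdom c') \<and>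
        (snd q \<in> cmap d ` cdom d \<and> cinv d (snd q) \<in> cdom d')"
      unfolding ep by (rule eventually_conj)
        (rule eventually_compose_filterlim[OF 1(2) filterlim_fst_nbhds] eventually_compose_filterlim[OF 2(2) filterlim_snd_nbhds])+
    have cinv: "cinv e q = (cinv c (fst q), cinv d (snd q))"
      if "fst q \<in> cmap c ` cdom c" "snd q \<in> cmap d ` cdom d" for q
      using cinv_prod_chart[OF c d that] by (simp add: e(1))
    show "\<forall>\<^sub>F q in nbhds (cmodel e) (cmap e p). cinv e q \<in> cdom e'"
      using ev by eventually_elim (simp add: cinv e'(1))
    have "smooth_near (cmodel e) (cmap e p) (\<lambda>q. (cmap c' (cinv c (fst q)), cmap d' (cinv d (snd q))))"
      unfolding ep by (rule smooth_near_map_prod[OF is_chartD(5)[OF c] is_chartD(5)[OF d] 1(1) 2(1)])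
    then show "smooth_near (cmodel e) (cmap e p) (\<lambda>q. cmap e' (cinv e q))"
      by (rule smooth_near_cong[OF is_chartD(3)[OF ce]]) (use ev in \<open>eventually_elim, simp add: cinv e'(1)\<close>)
  qed
next
  have "points M = (\<Union>c\<in>atlas M. cdom c)" "points N = (\<Union>c\<in>atlas N. cdom c)" using M N by (auto simp: smooth_atlas_def)
  then show "(\<Union>e\<in>atlas (prod_manifold M N). cdom e) = points (prod_manifold M N)"
    unfolding atlas_prod points_prod by fastforce
qed

lemma smooth_at_fst_snd:
  assumes M: "smooth_atlas M" and N: "smooth_atlas N" and x: "x \<in> points M" "y \<in> points N"
  shows "smooth_at (prod_manifold M N) M fst (x, y)" "smooth_at (prod_manifold M N) N snd (x, y)"
proof -
  note P = smooth_atlas_prod[OF M N]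
  obtain c where c: "c \<in> atlas M" "x \<in> cdom c" using atlas_cover[OF M x(1)] by auto
  obtain d where d: "d \<in> atlas N" "y \<in> cdom d" using atlas_cover[OF N x(2)] by auto
  note c' = atlas_compatible[OF M c(1)] and d' = atlas_compatible[OF N d(1)]
  note C = compatible_chartD(1)[OF c'] and D = compatible_chartD(1)[OF d']
  let ?e = "prod_chart c d"
  have e: "compatible_chart (prod_manifold M N) ?e"
    by (rule atlas_compatible[OF P]) (use c d in \<open>auto simp: atlas_prod\<close>)
  have xy: "(x, y) \<in> cdom ?e" using c d by simp
  note E = compatible_chartD(1)[OF e]
  have ev: "\<forall>\<^sub>F q in nbhds (cmodel ?e) (cmap ?e (x, y)). q \<in> cmap ?e ` cdom ?e"
    by (rule eventually_chart_image[OF E xy])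
  have cinv: "cinv ?e q = (cinv c (fst q), cinv d (snd q))" "fst q \<in> cmap c ` cdom c" "snd q \<in> cmap d ` cdom d" if "q \<in> cmap ?e ` cdom ?e" for q
    using that cinv_prod_chart[OF C D, of "fst q" "snd q"] by auto
  have sP: "subspace (cmodel ?e)" "cmap ?e (x, y) \<in> cmodel ?e"
    using is_chartD(3)[OF E] cmap_in_model[OF E xy] by auto
  show "smooth_at (prod_manifold M N) M fst (x, y)"
  proof (rule smooth_atI[OF P M e xy c'])
    show "fst (x, y) \<in> cdom c" using c by simp
    show "\<forall>\<^sub>F q in mnear (prod_manifold M N) (x, y). fst q \<in> cdom c"
      using eventually_mnear_cdom[OF P e xy] by eventually_elim auto
    show "smooth_near (cmodel ?e) (cmap ?e (x, y)) (\<lambda>q. cmap c (fst (cinv ?e q)))"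
      by (rule smooth_near_cong[OF sP(1) smooth_near_affine(2)[OF sP(1) continuous_linear_on_fst sP(2)]])
        (use ev in \<open>eventually_elim, simp add: cinv cmap_cinv del: chart.sel\<close>)
  qed
  show "smooth_at (prod_manifold M N) N snd (x, y)"
  proof (rule smooth_atI[OF P N e xy d'])
    show "snd (x, y) \<in> cdom d" using d by simp
    show "\<forall>\<^sub>F q in mnear (prod_manifold M N) (x, y). snd q \<in> cdom d"
      using eventually_mnear_cdom[OF P e xy] by eventually_elim auto
    show "smooth_near (cmodel ?e) (cmap ?e (x, y)) (\<lambda>q. cmap d (snd (cinv ?e q)))"
      by (rule smooth_near_cong[OF sP(1) smooth_near_affine(2)[OF sP(1) continuous_linear_on_snd sP(2)]])
        (use ev in \<open>eventually_elim, simp add: cinv cmap_cinv del: chart.sel\<close>)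
  qed
qed

lemma smooth_at_Pair:
  assumes K: "smooth_atlas K" and M: "smooth_atlas M" and N: "smooth_atlas N"
    and f: "smooth_at K M f x" and g: "smooth_at K N g x"
  shows "smooth_at K (prod_manifold M N) (\<lambda>y. (f y, g y)) x"
proof -
  note P = smooth_atlas_prod[OF M N]
  obtain b where b: "b \<in> atlas K" "x \<in> cdom b" using atlas_cover[OF K smooth_atD(1)[OF f]] by auto
  obtain c where c: "c \<in> atlas M" "f x \<in> cdom c" using atlas_cover[OF M smooth_atD(2)[OF f]] by auto
  obtain d where d: "d \<in> atlas N" "g x \<in> cdom d" using atlas_cover[OF N smooth_atD(2)[OF g]] by auto
  note b' = atlas_compatible[OF K b(1)] and c' = atlas_compatible[OF M c(1)] and d' = atlas_compatible[OF N d(1)]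
  have e: "compatible_chart (prod_manifold M N) (prod_chart c d)"
    by (rule atlas_compatible[OF P]) (use c d in \<open>auto simp: atlas_prod\<close>)
  show ?thesis
  proof (rule smooth_atI[OF K P b' b(2) e])
    show "(f x, g x) \<in> cdom (prod_chart c d)" using c d by simp
    show "\<forall>\<^sub>F y in mnear K x. (f y, g y) \<in> cdom (prod_chart c d)"
      using smooth_at_eventually_cdom[OF f M c' c(2)] smooth_at_eventually_cdom[OF g N d' d(2)]
      by eventually_elim simp
    show "smooth_near (cmodel b) (cmap b x) (\<lambda>y. cmap (prod_chart c d) (f (cinv b y), g (cinv b y)))"
      using smooth_near_Pair(1)[OF is_chartD(3)[OF compatible_chartD(1)[OF b']]
          smooth_at_chart(1)[OF K M f b' b(2) c' c(2)] smooth_at_chart(1)[OF K N g b' b(2) d' d(2)]]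
      by simp
  qed
qed

subsection \<open>Submanifolds\<close>

lemma points_submanifold [simp]: "points (submanifold M A) = A"
  by (simp add: submanifold_def)

abbreviation restricted_chart :: "'a set \<Rightarrow> ('a, 'e) chart \<Rightarrow> 'e set \<Rightarrow> ('a, 'e) chart" where
  "restricted_chart A c F \<equiv> Chart (cdom c \<inter> A) (cmap c) F"

lemma atlas_submanifold: "atlas (submanifold M A) = {restricted_chart A c F | c F. slice_chart M A c F}"
  by (simp add: submanifold_def)

lemma cinv_restricted:
  assumes "is_chart X c" "y \<in> cmap c ` (cdom c \<inter> A)"
  shows "cinv (restricted_chart A c F) y = cinv c y"
proof -
  obtain x where x: "x \<in> cdom c" "x \<in> A" "y = cmap c x" using assms(2) by auto
  have "inj_on (cmap c) (cdom c \<inter> A)" using is_chartD(2)[OF assms(1)] by (rule inj_on_subset) auto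
  then show ?thesis using x cinv_cmap[OF assms(1) x(1)] by (simp add: cinv_def)
qed

lemma slice_chartD:
  assumes "slice_chart M A c F" "A \<subseteq> points M"
  shows "compatible_chart M c" "is_chart (points M) c" "subspace F" "F \<subseteq> cmodel c"
    "cmap c ` (cdom c \<inter> A) = cmap c ` cdom c \<inter> F" "is_chart A (restricted_chart A c F)"
proof -
  show c: "compatible_chart M c" and F: "subspace F" "F \<subseteq> cmodel c" and eq: "cmap c ` (cdom c \<inter> A) = cmap c ` cdom c \<inter> F"
    using assms by (auto simp: slice_chart_def)
  show C: "is_chart (points M) c" by (rule compatible_chartD(1)[OF c])
  have "openin (top_of_set F) (cmap c ` cdom c \<inter> F)"
    using is_chartD(6)[OF C] F(2) by (auto simp: openin_open)
  moreover have "closed F" using assms by (simp add: slice_chart_def)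
  moreover have "inj_on (cmap c) (cdom c \<inter> A)" using is_chartD(2)[OF C] by (rule inj_on_subset) auto
  ultimately show "is_chart A (restricted_chart A c F)"
    using F eq by (simp add: is_chart_def)
qed

lemma eventually_nbhds_subspace:
  "F \<subseteq> E \<Longrightarrow> eventually P (nbhds F z) \<longleftrightarrow> eventually (\<lambda>y. y \<in> F \<longrightarrow> P y) (nbhds E z)"
  unfolding nbhds_def eventually_inf_principal by (auto elim: eventually_mono)

lemma slice_chart_eventually:
  assumes s: "slice_chart M A c F" "A \<subseteq> points M" and x: "x \<in> cdom c" "x \<in> A"
  shows "\<forall>\<^sub>F y in nbhds F (cmap c x). y \<in> cmap c ` (cdom c \<inter> A) \<and> cinv (restricted_chart A c F) y = cinv c y"
proof -
  note S = slice_chartD[OF s]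
  have "\<forall>\<^sub>F y in nbhds F (cmap c x). y \<in> cmap (restricted_chart A c F) ` cdom (restricted_chart A c F)"
    using eventually_chart_image[OF S(6), of x] x by simp
  then show ?thesis by eventually_elim (use cinv_restricted[OF S(2)] in auto)
qed

text \<open>Slice charts are compatible with the ambient atlas, so their transitions are smooth on
  the ambient model space and remain so on the subspace \<open>F\<close>.\<close>

lemma smooth_atlas_submanifold:
  assumes M: "smooth_atlas M" and A: "is_submanifold M A"
  shows "smooth_atlas (submanifold M A)"
  unfolding smooth_atlas_def
proof (intro conjI ballI)
  have AM: "A \<subseteq> points M" using A by (simp add: is_submanifold_def)
  fix c' assume "c' \<in> atlas (submanifold M A)"
  then obtain c F where c': "c' = restricted_chart A c F" and s: "slice_chart M A c F" by (auto simp: atlas_submanifold)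
  note S = slice_chartD[OF s AM]
  show i: "is_chart (points (submanifold M A)) c'" using S(6) by (simp add: c')
  fix d' assume "d' \<in> atlas (submanifold M A)"
  then obtain d G where d': "d' = restricted_chart A d G" and s': "slice_chart M A d G" by (auto simp: atlas_submanifold)
  note S' = slice_chartD[OF s' AM]
  show "smooth_transition c' d'"
  proof (rule smooth_transitionI[OF i])
    fix x assume "x \<in> cdom c'" "x \<in> cdom d'"
    then have x: "x \<in> cdom c" "x \<in> cdom d" "x \<in> A" by (auto simp: c' d')
    note t = smooth_transition_near[OF S(2) S'(2) compatible_transition[OF M S(1) S'(1)] x(1,2)]
    note ev = slice_chart_eventually[OF s AM x(1,3)]
    have xF: "cmap c x \<in> F" using S(5) x by blast
    have "\<forall>\<^sub>F y in nbhds F (cmap c x). y \<in> F \<longrightarrow> cinv c y \<in> cdom d"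
      using t(2) unfolding eventually_nbhds_subspace[OF S(4)] by (auto elim: eventually_mono)
    then show "\<forall>\<^sub>F y in nbhds (cmodel c') (cmap c' x). cinv c' y \<in> cdom d'"
      unfolding c' d' chart.sel using ev eventually_nbhds_model[of F "cmap c x"]
      by eventually_elim (auto simp: cinv_cmap[OF S(2)])
    have "smooth_near F (cmap c x) (\<lambda>y. cmap d (cinv c y))"
      by (rule smooth_near_mono[OF t(1) S(4) xF])
    then show "smooth_near (cmodel c') (cmap c' x) (\<lambda>y. cmap d' (cinv c' y))"
      unfolding c' d' chart.sel
      by (rule smooth_near_cong[OF S(3)]) (use ev in \<open>eventually_elim, simp\<close>)
  qed
next
  show "(\<Union>c\<in>atlas (submanifold M A). cdom c) = points (submanifold M A)"
    using A unfolding is_submanifold_def atlas_submanifold points_submanifold by fastforce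
qed

lemma submanifold_chart_at:
  assumes M: "smooth_atlas M" and A: "is_submanifold M A" and x: "x \<in> A"
  obtains c F where "slice_chart M A c F" "x \<in> cdom c" "restricted_chart A c F \<in> charts_at (submanifold M A) x"
    "compatible_chart (submanifold M A) (restricted_chart A c F)"
proof -
  obtain c F where s: "slice_chart M A c F" "x \<in> cdom c" using A x by (auto simp: is_submanifold_def)
  have a: "restricted_chart A c F \<in> atlas (submanifold M A)" using s by (auto simp: atlas_submanifold)
  then show thesis
    using that[OF s] x s atlas_compatible[OF smooth_atlas_submanifold[OF M A] a] by (auto simp: charts_at_def)
qed

lemma smooth_at_inclusion:
  assumes M: "smooth_atlas M" and A: "is_submanifold M A" and x: "x \<in> A"
  shows "smooth_at (submanifold M A) M (\<lambda>y. y) x"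
proof -
  have AM: "A \<subseteq> points M" using A by (simp add: is_submanifold_def)
  note N = smooth_atlas_submanifold[OF M A]
  obtain c F where s: "slice_chart M A c F" "x \<in> cdom c" and c': "compatible_chart (submanifold M A) (restricted_chart A c F)"
    by (rule submanifold_chart_at[OF M A x])
  note S = slice_chartD[OF s(1) AM]
  have xc: "x \<in> cdom (restricted_chart A c F)" using s x by simp
  have xF: "cmap c x \<in> F" using S(5) s(2) x by blast
  show ?thesis
  proof (rule smooth_atI[where f = "\<lambda>y. y", OF N M c' xc S(1) s(2)])
    show "\<forall>\<^sub>F y in mnear (submanifold M A) x. y \<in> cdom c"
      using eventually_mnear_cdom[OF N c' xc] by eventually_elim simp
    show "smooth_near (cmodel (restricted_chart A c F)) (cmap (restricted_chart A c F) x) (\<lambda>y. cmap c (cinv (restricted_chart A c F) y))"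
      unfolding chart.sel
      by (rule smooth_near_cong[OF S(3) smooth_near_id(1)[OF S(3) xF]])
        (use slice_chart_eventually[OF s(1) AM s(2) x] in \<open>eventually_elim, auto simp: cinv_cmap[OF S(2)]\<close>)
  qed
qed

text \<open>A slice chart keeps the coordinate map of the ambient chart, so the coordinate
  expression of \<open>f\<close> does not change.\<close>

lemma smooth_at_into_submanifold:
  assumes K: "smooth_atlas K" and M: "smooth_atlas M" and A: "is_submanifold M A"
    and f: "smooth_at K M f x" and fA: "eventually (\<lambda>y. f y \<in> A) (mnear K x)"
  shows "smooth_at K (submanifold M A) f x"
proof -
  have AM: "A \<subseteq> points M" using A by (simp add: is_submanifold_def)
  have fx: "f x \<in> A" by (rule eventually_mnear_self[OF smooth_atD(1)[OF f] K fA])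
  note N = smooth_atlas_submanifold[OF M A]
  obtain c F where s: "slice_chart M A c F" "f x \<in> cdom c" and c': "compatible_chart (submanifold M A) (restricted_chart A c F)"
    by (rule submanifold_chart_at[OF M A fx])
  note S = slice_chartD[OF s(1) AM]
  obtain b where b: "b \<in> atlas K" "x \<in> cdom b" using atlas_cover[OF K smooth_atD(1)[OF f]] by auto
  note b' = atlas_compatible[OF K b(1)]
  show ?thesis
  proof (rule smooth_atI[OF K N b' b(2) c'])
    show "f x \<in> cdom (restricted_chart A c F)" using s fx by simp
    show "\<forall>\<^sub>F y in mnear K x. f y \<in> cdom (restricted_chart A c F)"
      using fA smooth_at_eventually_cdom[OF f M S(1) s(2)] by eventually_elim simp
    show "smooth_near (cmodel b) (cmap b x) (\<lambda>y. cmap (restricted_chart A c F) (f (cinv b y)))"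
      using smooth_at_chart(1)[OF K M f b' b(2) S(1) s(2)] by simp
  qed
qed

lemma tmap_inclusion_inj:
  assumes M: "smooth_atlas M" and A: "is_submanifold M A" and x: "x \<in> A"
    and u: "u \<in> tangent (submanifold M A) x" and v: "v \<in> tangent (submanifold M A) x"
    and eq: "tmap (submanifold M A) M (\<lambda>y. y) x u = tmap (submanifold M A) M (\<lambda>y. y) x v"
  shows "u = v"
proof -
  have AM: "A \<subseteq> points M" using A by (simp add: is_submanifold_def)
  note N = smooth_atlas_submanifold[OF M A]
  obtain c F where s: "slice_chart M A c F" "x \<in> cdom c" and c': "restricted_chart A c F \<in> charts_at (submanifold M A) x"
    by (rule submanifold_chart_at[OF M A x])
  note S = slice_chartD[OF s(1) AM]
  \<comment> \<open>\<open>c\<close> is merely compatible with the ambient atlas and need not occur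
    as an index of ambient tangent vectors, so its coordinate is recovered as the derivative of the
    function \<open>cmap c\<close>.\<close>
  have "w (restricted_chart A c F) = tderiv M x (cmap c) (tmap (submanifold M A) M (\<lambda>y. y) x w)" if w: "w \<in> tangent (submanifold M A) x" for w
    using tderiv_cmap[OF N w c'] tderiv_compose[OF N M smooth_at_inclusion[OF M A x] w smooth_at_cmap[OF M S(1) s(2)]] by simp
  from this[OF u] this[OF v] eq have "u (restricted_chart A c F) = v (restricted_chart A c F)" by simp
  then show ?thesis by (rule tangent_eqI[OF N u v c'])
qed

text \<open>In a slice chart membership in \<open>A\<close> is membership in \<open>F\<close>, so
  both sides become the same statement about coordinates.\<close>

lemma eventually_mnear_submanifold:
  assumes M: "smooth_atlas M" and A: "is_submanifold M A" and x: "x \<in> A"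
  shows "eventually P (mnear (submanifold M A) x) \<longleftrightarrow> eventually (\<lambda>y. y \<in> A \<longrightarrow> P y) (mnear M x)"
proof -
  have AM: "A \<subseteq> points M" using A by (simp add: is_submanifold_def)
  note N = smooth_atlas_submanifold[OF M A]
  obtain c F where s: "slice_chart M A c F" "x \<in> cdom c" and c': "compatible_chart (submanifold M A) (restricted_chart A c F)"
    by (rule submanifold_chart_at[OF M A x])
  note S = slice_chartD[OF s(1) AM]
  have xc: "x \<in> cdom (restricted_chart A c F)" using s x by simp
  have "eventually P (mnear (submanifold M A) x) \<longleftrightarrow> eventually (\<lambda>y. P (cinv (restricted_chart A c F) y)) (nbhds F (cmap c x))"
    using eventually_mnear[OF N c' xc] by simp
  also have "\<dots> \<longleftrightarrow> eventually (\<lambda>y. P (cinv c y)) (nbhds F (cmap c x))"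
    by (rule eventually_cong[OF slice_chart_eventually[OF s(1) AM s(2) x]]) auto
  also have "\<dots> \<longleftrightarrow> eventually (\<lambda>y. y \<in> F \<longrightarrow> P (cinv c y)) (nbhds (cmodel c) (cmap c x))"
    by (rule eventually_nbhds_subspace[OF S(4)])
  also have "\<dots> \<longleftrightarrow> eventually (\<lambda>y. cinv c y \<in> A \<longrightarrow> P (cinv c y)) (nbhds (cmodel c) (cmap c x))"
  proof (rule eventually_cong[OF eventually_chart_image[OF S(2) s(2)]])
    fix y assume y: "y \<in> cmap c ` cdom c"
    have "y \<in> F \<longleftrightarrow> cinv c y \<in> A"
    proof
      assume "y \<in> F"
      then have "y \<in> cmap c ` (cdom c \<inter> A)" using S(5) y by blast
      then show "cinv c y \<in> A" by (auto simp: cinv_cmap[OF S(2)])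
    next
      assume "cinv c y \<in> A"
      then have "cmap c (cinv c y) \<in> cmap c ` (cdom c \<inter> A)" using cinv_in[OF y] by blast
      then show "y \<in> F" using S(5) by (auto simp: cmap_cinv[OF y])
    qed
    then show "(y \<in> F \<longrightarrow> P (cinv c y)) = (cinv c y \<in> A \<longrightarrow> P (cinv c y))" by simp
  qed
  also have "\<dots> \<longleftrightarrow> eventually (\<lambda>y. y \<in> A \<longrightarrow> P y) (mnear M x)"
    by (rule eventually_mnear[OF M S(1) s(2), symmetric])
  finally show ?thesis .
qed

text \<open>Transitivity of \<open>H\<close> is assumed on components in the subspace topology,
  while components are shown to be open in the manifold topology; the two have to coincide.\<close>

lemma mtop_submanifold:
  assumes M: "smooth_atlas M" and A: "is_submanifold M A"
  shows "mtop (submanifold M A) = subtopology (mtop M) A"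
proof (rule topology_eq[THEN iffD2], intro allI)
  have AM: "A \<subseteq> points M" using A by (simp add: is_submanifold_def)
  note N = smooth_atlas_submanifold[OF M A]
  fix W
  have "openin (mtop (submanifold M A)) W \<longleftrightarrow> W \<subseteq> A \<and> (\<forall>x\<in>W. eventually (\<lambda>y. y \<in> A \<longrightarrow> y \<in> W) (mnear M x))"
    unfolding openin_iff_nhdsin[of _ W] topspace_mtop[OF N] points_submanifold
    by (intro conj_cong refl ball_cong eventually_mnear_submanifold[OF M A]) auto
  also have "\<dots> \<longleftrightarrow> openin (subtopology (mtop M) A) W"
  proof
    assume R: "W \<subseteq> A \<and> (\<forall>x\<in>W. eventually (\<lambda>y. y \<in> A \<longrightarrow> y \<in> W) (mnear M x))"
    show "openin (subtopology (mtop M) A) W"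
    proof (subst openin_subopen, intro ballI)
      fix x assume x: "x \<in> W"
      then have "x \<in> points M" "eventually (\<lambda>y. y \<in> A \<longrightarrow> y \<in> W) (mnear M x)" using R AM by auto
      then obtain T where T: "openin (mtop M) T" "x \<in> T" "\<And>y. y \<in> T \<Longrightarrow> y \<in> A \<Longrightarrow> y \<in> W"
        unfolding eventually_nhdsin topspace_mtop[OF M] by blast
      show "\<exists>V. openin (subtopology (mtop M) A) V \<and> x \<in> V \<and> V \<subseteq> W"
        by (rule exI[of _ "A \<inter> T"]) (use T R x in \<open>auto intro: openin_subtopology_Int2\<close>)
    qed
  next
    assume "openin (subtopology (mtop M) A) W"
    then obtain T where T: "openin (mtop M) T" "W = T \<inter> A" by (auto simp: openin_subtopology)
    then show "W \<subseteq> A \<and> (\<forall>x\<in>W. eventually (\<lambda>y. y \<in> A \<longrightarrow> y \<in> W) (mnear M x))"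
      unfolding eventually_nhdsin by auto
  qed
  finally show "openin (mtop (submanifold M A)) W = openin (subtopology (mtop M) A) W" .
qed

lemma is_submanifold_open:
  assumes M: "smooth_atlas M" and C: "openin (mtop M) C"
  shows "is_submanifold M C"
  unfolding is_submanifold_def
proof (intro conjI ballI)
  show CM: "C \<subseteq> points M" using openin_subset[OF C] by (simp add: M)
  fix x assume x: "x \<in> C"
  then obtain c where c: "c \<in> atlas M" "x \<in> cdom c" using atlas_cover[OF M] CM by blast
  note c' = atlas_compatible[OF M c(1)]
  note cc = compatible_chartD(1)[OF c']
  \<comment> \<open>A slice chart whose \<open>F\<close> is the full model space must have its
    domain inside \<open>C\<close>, so the chart is cut down to \<open>C\<close> beforehand.\<close>
  let ?r = "restricted_chart C c (cmodel c)"
  have o: "openin (top_of_set (cmodel c)) (cmap c ` (cdom c \<inter> C))"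
    using openin_mtop_compatible[OF M C c'] by (simp add: Int_commute)
  have r: "is_chart (points M) ?r"
    using is_chartD[OF cc] o by (auto simp: is_chart_def intro: inj_on_subset)
  have near: "\<forall>\<^sub>F y in nbhds (cmodel c) (cmap c y). y \<in> cmap c ` (cdom c \<inter> C) \<and> cinv ?r y = cinv c y"
    if y: "y \<in> cdom c" "y \<in> C" for y
    using eventually_nbhds_in[OF o, of "cmap c y"] y
    by (auto elim!: eventually_mono intro: cinv_restricted[OF cc])
  have "compatible_chart M ?r"
    unfolding compatible_chart_def
  proof (intro conjI ballI r)
    fix d assume d: "d \<in> atlas M"
    note cd = compatible_chartD(1)[OF atlas_compatible[OF M d]]
    show "smooth_transition ?r d"
    proof (rule smooth_transitionI[OF r])
      fix y assume "y \<in> cdom ?r" "y \<in> cdom d"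
      then have y: "y \<in> cdom c" "y \<in> C" "y \<in> cdom d" by auto
      note t = smooth_transition_near[OF cc cd compatible_chartD(2)[OF c' d] y(1,3)]
      show "smooth_near (cmodel ?r) (cmap ?r y) (\<lambda>y. cmap d (cinv ?r y))"
        unfolding chart.sel by (rule smooth_near_cong[OF is_chartD(3)[OF cc] t(1)])
          (use near[OF y(1,2)] in \<open>eventually_elim, simp\<close>)
      show "\<forall>\<^sub>F y in nbhds (cmodel ?r) (cmap ?r y). cinv ?r y \<in> cdom d"
        unfolding chart.sel using near[OF y(1,2)] t(2) by eventually_elim simp
    qed
    show "smooth_transition d ?r"
    proof (rule smooth_transitionI[OF cd])
      fix y assume "y \<in> cdom d" "y \<in> cdom ?r"
      then have y: "y \<in> cdom c" "y \<in> C" "y \<in> cdom d" by auto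
      note t = smooth_transition_near[OF cd cc compatible_chartD(3)[OF c' d] y(3,1)]
      show "smooth_near (cmodel d) (cmap d y) (\<lambda>z. cmap ?r (cinv d z))"
        using t(1) by simp
      have "\<forall>\<^sub>F z in mnear M y. z \<in> C" using C y unfolding openin_iff_nhdsin by blast
      then have "\<forall>\<^sub>F z in nbhds (cmodel d) (cmap d y). cinv d z \<in> C"
        unfolding eventually_mnear[OF M atlas_compatible[OF M d] y(3)] .
      then show "\<forall>\<^sub>F z in nbhds (cmodel d) (cmap d y). cinv d z \<in> cdom ?r"
        using t(2) by eventually_elim simp
    qed
  qed
  then have "slice_chart M C ?r (cmodel c)"
    using is_chartD(3,4)[OF cc] openin_imp_subset[OF o] by (auto simp: slice_chart_def)
  then show "\<exists>c F. slice_chart M C c F \<and> x \<in> cdom c" using c x by (intro exI[of _ ?r] exI[of _ "cmodel c"]) simp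
qed

subsection \<open>Transporting a manifold structure along an injective map\<close>

text \<open>Only the charts of the atlas are transported, not all compatible ones. Closedness of a form
  then carries over chart by chart, without coordinate invariance of the exterior derivative.\<close>

abbreviation pushed_chart :: "'a set \<Rightarrow> ('a \<Rightarrow> 'b) \<Rightarrow> ('a, 'e) chart \<Rightarrow> ('b, 'e) chart" where
  "pushed_chart C \<phi> c \<equiv> Chart (\<phi> ` (cdom c \<inter> C)) (\<lambda>y. cmap c (inv_into C \<phi> y)) (cmodel c)"

definition push_manifold :: "('a, 'e::lctvs) manifold \<Rightarrow> 'a set \<Rightarrow> ('a \<Rightarrow> 'b) \<Rightarrow> ('b, 'e) manifold" where
  "push_manifold M C \<phi> = Manifold (\<phi> ` C) (pushed_chart C \<phi> ` atlas M)"

lemma points_push [simp]: "points (push_manifold M C \<phi>) = \<phi> ` C"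
  by (simp add: push_manifold_def)

lemma atlas_push: "atlas (push_manifold M C \<phi>) = pushed_chart C \<phi> ` atlas M"
  by (simp add: push_manifold_def)

locale pushed_manifold =
  fixes M :: "('a, 'e::lctvs) manifold" and C :: "'a set" and \<phi> :: "'a \<Rightarrow> 'b"
  assumes M: "smooth_atlas M" and C: "openin (mtop M) C" and inj: "inj_on \<phi> C"
begin

abbreviation "N \<equiv> push_manifold M C \<phi>"
abbreviation "\<psi> \<equiv> inv_into C \<phi>"
abbreviation "p \<equiv> pushed_chart C \<phi>"

lemma C_points: "C \<subseteq> points M"
  using openin_subset[OF C] by (simp add: M)

lemma psi_phi [simp]: "x \<in> C \<Longrightarrow> \<psi> (\<phi> x) = x"
  by (simp add: inj)

lemma image_eq: "cmap (p c) ` cdom (p c) = cmap c ` (cdom c \<inter> C)"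
  by (force simp: image_iff)

lemma cinv_eq:
  assumes c: "c \<in> atlas M" and z: "z \<in> cmap c ` (cdom c \<inter> C)"
  shows "cinv (p c) z = \<phi> (cinv c z)" "cinv c z \<in> C" "cinv c z \<in> cdom c"
proof -
  note cc = compatible_chartD(1)[OF atlas_compatible[OF M c]]
  obtain x where x: "x \<in> cdom c" "x \<in> C" "z = cmap c x" using z by auto
  have cx: "cinv c z = x" using cinv_cmap[OF cc x(1)] x(3) by simp
  then show "cinv c z \<in> C" "cinv c z \<in> cdom c" using x by auto
  have "inj_on (\<lambda>y. cmap c (\<psi> y)) (\<phi> ` (cdom c \<inter> C))"
    using is_chartD(2)[OF cc] by (auto simp: inj_on_def)
  then have "inv_into (\<phi> ` (cdom c \<inter> C)) (\<lambda>y. cmap c (\<psi> y)) z = \<phi> x"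
    by (rule inv_into_f_eq) (use x in auto)
  then show "cinv (p c) z = \<phi> (cinv c z)" by (simp add: cinv_def[of "p c"] cx)
qed

lemma openin_image: "c \<in> atlas M \<Longrightarrow> openin (top_of_set (cmodel c)) (cmap c ` (cdom c \<inter> C))"
  using openin_mtop_compatible[OF M C atlas_compatible[OF M]] by (simp add: Int_commute)

lemma is_chart_pushed:
  assumes c: "c \<in> atlas M"
  shows "is_chart (\<phi> ` C) (p c)"
proof -
  note cc = compatible_chartD(1)[OF atlas_compatible[OF M c]]
  have "inj_on (cmap (p c)) (cdom (p c))" using is_chartD(2)[OF cc] by (auto simp: inj_on_def)
  moreover have "openin (top_of_set (cmodel (p c))) (cmap (p c) ` cdom (p c))"
    unfolding image_eq using openin_image[OF c] by simp
  ultimately show ?thesis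
    using is_chartD(3,4)[OF cc] unfolding is_chart_def by auto
qed

lemma eventually_image:
  assumes "c \<in> atlas M" "x \<in> cdom c" "x \<in> C"
  shows "\<forall>\<^sub>F z in nbhds (cmodel c) (cmap c x). z \<in> cmap c ` (cdom c \<inter> C)"
  by (rule eventually_nbhds_in[OF openin_image]) (use assms in auto)

text \<open>The map \<open>\<phi>\<close> cancels in the transitions, which are those of
  \<open>M\<close> cut down to \<open>C\<close>.\<close>

lemma smooth_atlas: "smooth_atlas N"
  unfolding smooth_atlas_def
proof (intro conjI ballI)
  fix c' assume "c' \<in> atlas N"
  then obtain c where c: "c \<in> atlas M" "c' = p c" by (auto simp: atlas_push)
  note cc = compatible_chartD(1)[OF atlas_compatible[OF M c(1)]]
  show i: "is_chart (points N) c'" using is_chart_pushed[OF c(1)] by (simp add: c(2))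
  fix d' assume "d' \<in> atlas N"
  then obtain d where d: "d \<in> atlas M" "d' = p d" by (auto simp: atlas_push)
  show "smooth_transition c' d'"
  proof (rule smooth_transitionI[OF i])
    fix y assume y: "y \<in> cdom c'" "y \<in> cdom d'"
    then obtain x where x: "y = \<phi> x" "x \<in> cdom c" "x \<in> cdom d" "x \<in> C"
      using inj_on_eq_iff[OF inj] by (auto simp: c(2) d(2))
    have tcd: "smooth_transition c d" using M c d by (auto simp: smooth_atlas_def)
    note t = smooth_transition_near[OF cc compatible_chartD(1)[OF atlas_compatible[OF M d(1)]] tcd x(2,3)]
    note ev = eventually_image[OF c(1) x(2,4)]
    have m: "cmap c' y = cmap c x" "cmodel c' = cmodel c" using x by (simp_all add: c(2))
    show "smooth_near (cmodel c') (cmap c' y) (\<lambda>z. cmap d' (cinv c' z))"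
      unfolding m by (rule smooth_near_cong[OF is_chartD(3)[OF cc] t(1)])
        (use ev in \<open>eventually_elim, simp add: c(2) d(2) cinv_eq[OF c(1)]\<close>)
    show "\<forall>\<^sub>F z in nbhds (cmodel c') (cmap c' y). cinv c' z \<in> cdom d'"
      unfolding m using ev t(2) by eventually_elim (simp add: c(2) d(2) cinv_eq[OF c(1)])
  qed
next
  have "C = (\<Union>c\<in>atlas M. cdom c) \<inter> C" using C_points M by (auto simp: smooth_atlas_def)
  then have "\<phi> ` C = \<phi> ` ((\<Union>c\<in>atlas M. cdom c) \<inter> C)" by simp
  also have "\<dots> = (\<Union>c\<in>atlas N. cdom c)" unfolding atlas_push by auto
  finally show "(\<Union>c\<in>atlas N. cdom c) = points N" by simp
qed

lemma pushed_chart_at: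
  assumes "c \<in> charts_at M x" "x \<in> C"
  shows "p c \<in> charts_at N (\<phi> x)" "compatible_chart N (p c)" "\<phi> x \<in> cdom (p c)"
  using assms atlas_compatible[OF smooth_atlas, of "p c"] by (auto simp: charts_at_def atlas_push)

lemma smooth_at_phi: "x \<in> C \<Longrightarrow> smooth_at M N \<phi> x"
  and smooth_at_psi: "x \<in> C \<Longrightarrow> smooth_at N M \<psi> (\<phi> x)"
proof -
  assume x: "x \<in> C"
  obtain c where c: "c \<in> charts_at M x" using charts_at_ex[OF M] x C_points by blast
  note A = charts_atD[OF M c] and B = pushed_chart_at[OF c x]
  note ev = eventually_image[OF A(4,2) x]
  have xC: "eventually (\<lambda>y. y \<in> C) (mnear M x)" using C x unfolding openin_iff_nhdsin by blast
  show "smooth_at M N \<phi> x"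
  proof (rule smooth_atI[where f = \<phi>, OF M smooth_atlas A(1,2) B(2,3)])
    show "\<forall>\<^sub>F y in mnear M x. \<phi> y \<in> cdom (p c)"
      using xC eventually_mnear_cdom[OF M A(1,2)] by eventually_elim simp
    show "smooth_near (cmodel c) (cmap c x) (\<lambda>z. cmap (p c) (\<phi> (cinv c z)))"
      by (rule smooth_near_cong[OF A(6) smooth_near_id(1)[OF A(6,8)]])
        (use ev in \<open>eventually_elim, auto simp: cinv_cmap[OF A(3)]\<close>)
  qed
  show "smooth_at N M \<psi> (\<phi> x)"
  proof (rule smooth_atI[where f = \<psi>, OF smooth_atlas M B(2,3) A(1)])
    show "\<psi> (\<phi> x) \<in> cdom c" using x A(2) by simp
    show "\<forall>\<^sub>F y in mnear N (\<phi> x). \<psi> y \<in> cdom c"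
      using eventually_mnear_cdom[OF smooth_atlas B(2,3)] by eventually_elim auto
    have "smooth_near (cmodel c) (cmap c x) (\<lambda>z. cmap c (\<psi> (cinv (p c) z)))"
      by (rule smooth_near_cong[OF A(6) smooth_near_id(1)[OF A(6,8)]])
        (use ev in \<open>eventually_elim, auto simp: cinv_eq[OF A(4)] cinv_cmap[OF A(3)]\<close>)
    then show "smooth_near (cmodel (p c)) (cmap (p c) (\<phi> x)) (\<lambda>z. cmap c (\<psi> (cinv (p c) z)))"
      using x by simp
  qed
qed

lemma eventually_phi_psi: "x \<in> C \<Longrightarrow> eventually (\<lambda>y. \<phi> (\<psi> y) = y) (mnear N (\<phi> x))"
  using eventually_mnear_points[OF smooth_atlas, of "\<phi> x"]
  by (auto elim!: eventually_mono simp: f_inv_into_f)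

text \<open>The inverse \<open>\<psi>\<close> is a continuous injection into a Hausdorff
  space.\<close>

lemma is_manifold:
  assumes "Hausdorff_space (mtop M)"
  shows "is_manifold N"
proof -
  have "smooth_map N M \<psi>"
    unfolding smooth_map_iff_smooth_at[OF smooth_atlas M] using smooth_at_psi by auto
  then have "continuous_map (mtop N) (mtop M) \<psi>" by (simp add: smooth_map_def)
  moreover have "inj_on \<psi> (topspace (mtop N))"
    by (auto simp: topspace_mtop[OF smooth_atlas] inj_on_def)
  ultimately have "Hausdorff_space (mtop N)"
    by (rule Hausdorff_space_injective_preimage[OF assms])
  then show ?thesis using smooth_atlas by (simp add: is_manifold_def smooth_atlas_def)
qed

lemma tmap_psi_phi:
  assumes x: "x \<in> C" and v: "v \<in> tangent M x"
  shows "tmap N M \<psi> (\<phi> x) (tmap M N \<phi> x v) = v"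
proof -
  have xC: "eventually (\<lambda>y. y \<in> C) (mnear M x)" using C x unfolding openin_iff_nhdsin by blast
  have xM: "x \<in> points M" using x C_points by auto
  have "tmap N M \<psi> (\<phi> x) (tmap M N \<phi> x v) = tmap M M (\<lambda>y. \<psi> (\<phi> y)) x v"
    by (rule tmap_compose[OF M smooth_atlas M smooth_at_phi[OF x] smooth_at_psi[OF x] v])
  also have "\<dots> = tmap M M (\<lambda>y. y) x v"
    by (rule tmap_cong[OF M xM v]) (use xC in \<open>eventually_elim, simp\<close>)
  finally show ?thesis by (simp add: tmap_id[OF M v])
qed

lemma tmap_phi_psi:
  assumes x: "x \<in> C" and v: "v \<in> tangent N (\<phi> x)"
  shows "tmap M N \<phi> x (tmap N M \<psi> (\<phi> x) v) = v"
proof -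
  have "tmap M N \<phi> (\<psi> (\<phi> x)) (tmap N M \<psi> (\<phi> x) v) = tmap N N (\<lambda>y. \<phi> (\<psi> y)) (\<phi> x) v"
    by (rule tmap_compose[OF smooth_atlas M smooth_atlas smooth_at_psi[OF x] _ v]) (use smooth_at_phi[OF x] x in simp)
  also have "\<dots> = tmap N N (\<lambda>y. y) (\<phi> x) v"
    by (rule tmap_cong[OF smooth_atlas _ v eventually_phi_psi[OF x]]) (use x in simp)
  finally show ?thesis using x by (simp add: tmap_id[OF smooth_atlas v])
qed

text \<open>In the charts \<open>c\<close> and \<open>p c\<close> the map \<open>\<psi>\<close> is
  the identity, so it matches the coordinate vectors and both forms have the same
  coefficients.\<close>

lemma local_form_push:
  assumes c: "c \<in> atlas M" and z: "z \<in> cmap c ` (cdom c \<inter> C)" and a: "a \<in> cmodel c" and b: "b \<in> cmodel c"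
  shows "local_form N (pullback_form N M w \<psi>) (p c) z a b = local_form M w c z a b"
proof -
  define x where "x = cinv c z"
  have x: "x \<in> C" "x \<in> cdom c" "cinv (p c) z = \<phi> x" using cinv_eq[OF c z] by (auto simp: x_def)
  have cx: "c \<in> charts_at M x" using c x by (simp add: charts_at_def)
  note A = charts_atD[OF M cx] and B = pushed_chart_at[OF cx x(1)]
  note ev = eventually_image[OF A(4,2) x(1)]
  have *: "tmap N M \<psi> (\<phi> x) (coord_tvec N (\<phi> x) (p c) u) = coord_tvec M x c u" if u: "u \<in> cmodel c" for u
  proof -
    note T = coord_tvec(1,2)[OF smooth_atlas B(1), of u]
    have uT: "coord_tvec N (\<phi> x) (p c) u \<in> tangent N (\<phi> x)" using T u by simp
    have t: "tmap N M \<psi> (\<phi> x) (coord_tvec N (\<phi> x) (p c) u) \<in> tangent M x"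
      using tmap_in_tangent[OF smooth_atlas M smooth_at_psi[OF x(1)] uT] x by simp
    have "tmap N M \<psi> (\<phi> x) (coord_tvec N (\<phi> x) (p c) u) c =
        dir_deriv (\<lambda>y. cmap c (\<psi> (cinv (p c) y))) (cmap (p c) (\<phi> x)) (coord_tvec N (\<phi> x) (p c) u (p c))"
      by (rule tmap_apply(2)[OF smooth_atlas M smooth_at_psi[OF x(1)] uT _ B(1)]) (use cx x in simp)
    also have "\<dots> = dir_deriv (\<lambda>y. cmap c (\<psi> (cinv (p c) y))) (cmap c x) u"
      using T u x by simp
    also have "\<dots> = dir_deriv (\<lambda>y. y) (cmap c x) u"
      by (rule dir_deriv_cong_near(1)[OF A(6,8) u])
        (use ev in \<open>eventually_elim, auto simp: cinv_eq[OF A(4)] cinv_cmap[OF A(3)]\<close>)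
    also have "\<dots> = u" by (rule smooth_near_id(2)[OF A(6,8) u])
    also have "u = coord_tvec M x c u c" by (rule coord_tvec(2)[OF M cx u, symmetric])
    finally show ?thesis by (rule tangent_eqI[OF M t coord_tvec(1)[OF M cx u] cx])
  qed
  show ?thesis
    unfolding local_form_def x(3) pullback_form_def x_def[symmetric] using *[OF a] *[OF b] x by simp
qed

text \<open>Smoothness and closedness concern the coefficients in charts, which agree with those of
  \<open>w\<close>. Nondegeneracy holds as the tangent maps of \<open>\<phi>\<close> and
  \<open>\<psi>\<close> are mutually inverse.\<close>

lemma symplectic_form_push:
  assumes w: "symplectic_form M w"
  shows "symplectic_form N (pullback_form N M w \<psi>)"
proof -
  let ?w = "pullback_form N M w \<psi>"
  have "is_two_form N ?w"
    unfolding is_two_form_def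
  proof (intro conjI ballI allI)
    fix y u v assume y: "y \<in> points N" and u: "u \<in> tangent N y" and v: "v \<in> tangent N y"
    then obtain x where x: "x \<in> C" "y = \<phi> x" by auto
    note s = smooth_at_psi[OF x(1), folded x(2)]
    note T = tmap_in_tangent[OF smooth_atlas M s]
    have yM: "\<psi> y \<in> points M" by (rule smooth_atD(2)[OF s])
    have W: "w (\<psi> y) a b = - w (\<psi> y) b a" "w (\<psi> y) (tscale r a) b = r * w (\<psi> y) a b"
        "a' \<in> tangent M (\<psi> y) \<Longrightarrow> w (\<psi> y) (tadd a a') b = w (\<psi> y) a b + w (\<psi> y) a' b"
      if "a \<in> tangent M (\<psi> y)" "b \<in> tangent M (\<psi> y)" for a b a' r
      using w yM that unfolding symplectic_form_def is_two_form_def by blast+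
    show "?w y u v = - ?w y v u" unfolding pullback_form_def by (rule W[OF T[OF u] T[OF v]])
    show "?w y (tscale a u) v = a * ?w y u v" for a
      unfolding pullback_form_def tmap_linear(2)[OF smooth_atlas M s u v] by (rule W[OF T[OF u] T[OF v]])
    show "?w y (tadd u u') v = ?w y u v + ?w y u' v" if u': "u' \<in> tangent N y" for u'
      unfolding pullback_form_def tmap_linear(1)[OF smooth_atlas M s u u'] by (rule W(3)[OF T[OF u] T[OF v] T[OF u']])
  next
    fix c' assume "c' \<in> atlas N"
    then obtain c where c: "c \<in> atlas M" "c' = p c" by (auto simp: atlas_push)
    note cc = compatible_chartD(1)[OF atlas_compatible[OF M c(1)]]
    let ?E = "cmodel c" and ?I = "cmap c ` (cdom c \<inter> C)"
    have mE: "subspace (?E \<times> ?E \<times> ?E)"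
      using model_space_Times[OF is_chartD(5)[OF cc] model_space_Times[OF is_chartD(5)[OF cc] is_chartD(5)[OF cc]]]
      by (simp add: model_space_def)
    have o: "openin (top_of_set (?E \<times> ?E \<times> ?E)) (?I \<times> ?E \<times> ?E)"
      by (intro openin_Times openin_image[OF c(1)] openin_subtopology_self)
    have "smooth_on (?E \<times> ?E \<times> ?E) (cmap c ` cdom c \<times> ?E \<times> ?E) (\<lambda>(y, a, b). local_form M w c y a b)"
      using w c(1) unfolding symplectic_form_def is_two_form_def by blast
    then have "smooth_on (?E \<times> ?E \<times> ?E) (?I \<times> ?E \<times> ?E) (\<lambda>(y, a, b). local_form M w c y a b)"
      by (rule smooth_on_subset) auto
    then have "smooth_on (?E \<times> ?E \<times> ?E) (?I \<times> ?E \<times> ?E) (\<lambda>(y, a, b). local_form N ?w (p c) y a b)"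
      by (rule smooth_on_cong[OF mE o, rotated]) (auto simp: local_form_push[OF c(1)])
    then show "smooth_on (cmodel c' \<times> cmodel c' \<times> cmodel c') (cmap c' ` cdom c' \<times> cmodel c' \<times> cmodel c')
        (\<lambda>(y, a, b). local_form N ?w c' y a b)"
      unfolding c(2) image_eq by simp
  qed
  moreover have "closed_form N ?w"
    unfolding closed_form_def
  proof (intro ballI)
    fix c' y a b d assume "c' \<in> atlas N" and y: "y \<in> cmap c' ` cdom c'" and abd: "a \<in> cmodel c'" "b \<in> cmodel c'" "d \<in> cmodel c'"
    then obtain c where c: "c \<in> atlas M" "c' = p c" by (auto simp: atlas_push)
    note cc = compatible_chartD(1)[OF atlas_compatible[OF M c(1)]]
    have y': "y \<in> cmap c ` (cdom c \<inter> C)" using y unfolding c(2) image_eq .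
    have abd': "a \<in> cmodel c" "b \<in> cmodel c" "d \<in> cmodel c" using abd by (auto simp: c(2))
    have *: "dir_deriv (\<lambda>z. local_form N ?w c' z e f) y g = dir_deriv (\<lambda>z. local_form M w c z e f) y g"
      if "e \<in> cmodel c" "f \<in> cmodel c" "g \<in> cmodel c" for e f g
      unfolding c(2)
      by (rule dir_deriv_cong_on[OF is_chartD(3)[OF cc] that(3) openin_image[OF c(1)] y' local_form_push[OF c(1) _ that(1,2)]])
    have "y \<in> cmap c ` cdom c" using y' by auto
    then have "dir_deriv (\<lambda>z. local_form M w c z b d) y a + dir_deriv (\<lambda>z. local_form M w c z d a) y b +
        dir_deriv (\<lambda>z. local_form M w c z a b) y d = 0"
      using w c(1) abd' unfolding symplectic_form_def closed_form_def by blast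
    then show "dir_deriv (\<lambda>z. local_form N ?w c' z b d) y a + dir_deriv (\<lambda>z. local_form N ?w c' z d a) y b +
        dir_deriv (\<lambda>z. local_form N ?w c' z a b) y d = 0"
      using abd' by (simp add: *)
  qed
  moreover have "u = (\<lambda>_. 0)" if y: "y \<in> points N" and u: "u \<in> tangent N y" and 0: "\<forall>v\<in>tangent N y. ?w y u v = 0" for y u
  proof -
    obtain x where x: "x \<in> C" "y = \<phi> x" using y by auto
    have xM: "x \<in> points M" using x C_points by auto
    have t: "tmap N M \<psi> y u \<in> tangent M x"
      using tmap_in_tangent[OF smooth_atlas M smooth_at_psi[OF x(1)]] u x by simp
    have "w x (tmap N M \<psi> y u) v = 0" if v: "v \<in> tangent M x" for v
    proof -
      have "tmap M N \<phi> x v \<in> tangent N y"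
        using tmap_in_tangent[OF M smooth_atlas smooth_at_phi[OF x(1)] v] x by simp
      with 0 have "?w y u (tmap M N \<phi> x v) = 0" by blast
      then show ?thesis using x tmap_psi_phi[OF x(1) v] by (simp add: pullback_form_def)
    qed
    then have "tmap N M \<psi> y u = (\<lambda>_. 0)" using w t xM unfolding symplectic_form_def by blast
    then have "u = tmap M N \<phi> x (\<lambda>_. 0)" using tmap_phi_psi[OF x(1)] u x by metis
    then show ?thesis by (simp add: tmap_zero)
  qed
  ultimately show ?thesis unfolding symplectic_form_def by blast
qed

text \<open>The open set \<open>C\<close> carries its own atlas of slice charts, so both directions
  are compared with maps from or into \<open>M\<close>.\<close>

lemma diffeomorphism_push: "diffeomorphism (submanifold M C) N \<phi>"
proof -
  have sub: "is_submanifold M C" by (rule is_submanifold_open[OF M C])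
  note K = smooth_atlas_submanifold[OF M sub]
  have "smooth_map (submanifold M C) N \<phi>"
    unfolding smooth_map_iff_smooth_at[OF K smooth_atlas] points_submanifold
    using smooth_at_compose[OF K M smooth_atlas smooth_at_inclusion[OF M sub]] smooth_at_phi by blast
  moreover have "smooth_map N (submanifold M C) \<psi>"
    unfolding smooth_map_iff_smooth_at[OF smooth_atlas K] points_push
  proof
    fix y assume "y \<in> \<phi> ` C"
    then obtain x where x: "x \<in> C" "y = \<phi> x" by auto
    show "smooth_at N (submanifold M C) \<psi> y"
      unfolding x(2)
      by (rule smooth_at_into_submanifold[OF smooth_atlas M sub smooth_at_psi[OF x(1)]])
        (rule eventually_mono[OF eventually_mnear_points[OF smooth_atlas]], simp add: inv_into_into)
  qed
  ultimately show ?thesis by (simp add: diffeomorphism_def inj bij_betw_def)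
qed

lemma symplectomorphism_push:
  "symplectomorphism (submanifold M C) (restrict_form M w C) N (pullback_form N M w \<psi>) \<phi>"
proof -
  have sub: "is_submanifold M C" by (rule is_submanifold_open[OF M C])
  note K = smooth_atlas_submanifold[OF M sub]
  have "pullback_eq (submanifold M C) (restrict_form M w C) N (pullback_form N M w \<psi>) \<phi>"
    unfolding pullback_eq_def points_submanifold
  proof (intro ballI)
    fix x u v assume x: "x \<in> C" and uv: "u \<in> tangent (submanifold M C) x" "v \<in> tangent (submanifold M C) x"
    have i: "smooth_at (submanifold M C) M (\<lambda>y. y) x" by (rule smooth_at_inclusion[OF M sub x])
    have *: "tmap N M \<psi> (\<phi> x) (tmap (submanifold M C) N \<phi> x a) = tmap (submanifold M C) M (\<lambda>y. y) x a"
      if a: "a \<in> tangent (submanifold M C) x" for a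
      using tmap_compose[OF K M smooth_atlas i smooth_at_phi[OF x] a]
        tmap_psi_phi[OF x tmap_in_tangent[OF K M i a]] by simp
    show "pullback_form N M w \<psi> (\<phi> x) (tmap (submanifold M C) N \<phi> x u) (tmap (submanifold M C) N \<phi> x v)
        = restrict_form M w C x u v"
      using x by (simp add: pullback_form_def restrict_form_def *[OF uv(1)] *[OF uv(2)])
  qed
  with diffeomorphism_push show ?thesis by (simp add: symplectomorphism_def)
qed

end

subsection \<open>Local sections of submersions\<close>

text \<open>In the adapted charts a section is the affine map \<open>w \<mapsto> R w + b\<close>:
  \<open>R\<close> is a right inverse of the projection \<open>P\<close>, and \<open>b\<close> is
  chosen so that the map hits \<open>x\<close>. Since \<open>b\<close> lies in the kernel of
  \<open>P\<close>, the affine map is still a right inverse.\<close>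

lemma submersion_section:
  assumes M: "smooth_atlas M" and N: "smooth_atlas N" and f: "submersion M N f" and x: "x \<in> points M"
  obtains s where "s (f x) = x" "smooth_at N M s (f x)"
    "eventually (\<lambda>z. s z \<in> points M \<and> f (s z) = z) (mnear N (f x))"
proof -
  have "\<exists>c d P R. compatible_chart M c \<and> compatible_chart N d \<and>
        x \<in> cdom c \<and> f ` cdom c \<subseteq> cdom d \<and>
        continuous_linear_on (cmodel c) P \<and> P ` cmodel c \<subseteq> cmodel d \<and>
        continuous_linear_on (cmodel d) R \<and> R ` cmodel d \<subseteq> cmodel c \<and>
        (\<forall>w\<in>cmodel d. P (R w) = w) \<and>
        (\<forall>y\<in>cdom c. cmap d (f y) = P (cmap c y))"
    using conjunct2[OF f[unfolded submersion_def]] x by (rule bspec)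
  then obtain c d P R where c: "compatible_chart M c" "x \<in> cdom c" and d: "compatible_chart N d" "f ` cdom c \<subseteq> cdom d"
    and P: "continuous_linear_on (cmodel c) P" "P ` cmodel c \<subseteq> cmodel d"
    and R: "continuous_linear_on (cmodel d) R" "R ` cmodel d \<subseteq> cmodel c"
    and PR: "\<forall>w\<in>cmodel d. P (R w) = w"
    and loc: "\<forall>y\<in>cdom c. cmap d (f y) = P (cmap c y)"
    by (elim exE conjE) (rule that)
  note C = compatible_chartD(1)[OF c(1)] and D = compatible_chartD(1)[OF d(1)]
  have fd: "f x \<in> cdom d" using c d by auto
  define b where "b = cmap c x - R (cmap d (f x))"
  define k where "k w = R w + b" for w
  define s where "s z = cinv c (k (cmap d z))" for z
  have dF: "cmap d (f x) \<in> cmodel d" by (rule cmap_in_model[OF D fd])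
  have bF: "b \<in> cmodel c"
    unfolding b_def using cmap_in_model[OF C c(2)] R(2) dF is_chartD(3)[OF C] by (auto intro: subspace_diff)
  have kF: "k w \<in> cmodel c" if "w \<in> cmodel d" for w
    unfolding k_def using that R(2) bF is_chartD(3)[OF C] by (auto intro: subspace_add)
  have k0: "k (cmap d (f x)) = cmap c x" by (simp add: k_def b_def)
  have ks: "smooth_near (cmodel d) (cmap d (f x)) k"
    unfolding k_def by (rule smooth_near_affine(1)[OF is_chartD(3)[OF D] R(1) dF])
  have "filterlim k (nbhds (cmodel c) (cmap c x)) (nbhds (cmodel d) (cmap d (f x)))"
    unfolding filterlim_nbhds using smooth_near_tendsto[OF ks] eventually_nbhds_model[of "cmodel d" "cmap d (f x)"]
    by (auto simp: k0 kF elim!: eventually_mono)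
  from eventually_compose_filterlim[OF eventually_chart_image[OF C c(2)] this]
  have ev: "\<forall>\<^sub>F w in nbhds (cmodel d) (cmap d (f x)). w \<in> cmap d ` cdom d \<and> k w \<in> cmap c ` cdom c"
    using eventually_chart_image[OF D fd] by eventually_elim simp
  have ev': "\<forall>\<^sub>F z in mnear N (f x). z \<in> cdom d \<and> k (cmap d z) \<in> cmap c ` cdom c"
    unfolding eventually_mnear[OF N d(1) fd] using ev by eventually_elim (simp add: cmap_cinv cinv_in)
  have Pk: "P (k w) = w" if w: "w \<in> cmodel d" for w
  proof -
    have "R w \<in> cmodel c" "R (cmap d (f x)) \<in> cmodel c" using R(2) w dF by auto
    then have "P (k w) = P (R w) + (P (cmap c x) - P (R (cmap d (f x))))"
      unfolding k_def b_def using P(1) bF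
      by (simp add: continuous_linear_on_def b_def continuous_linear_on_diff[OF is_chartD(3)[OF C] P(1) cmap_in_model[OF C c(2)]])
    then show ?thesis using PR w dF bspec[OF loc c(2)] by simp
  qed
  show thesis
  proof (rule that[of s])
    show sx: "s (f x) = x" by (simp add: s_def k0 cinv_cmap[OF C c(2)])
    show "smooth_at N M s (f x)"
    proof (rule smooth_atI[OF N M d(1) fd c(1)])
      show "s (f x) \<in> cdom c" using sx c by simp
      show "\<forall>\<^sub>F z in mnear N (f x). s z \<in> cdom c"
        using ev' by eventually_elim (simp add: s_def cinv_in)
      show "smooth_near (cmodel d) (cmap d (f x)) (\<lambda>y. cmap c (s (cinv d y)))"
        by (rule smooth_near_cong[OF is_chartD(3)[OF D] ks])
          (use ev in \<open>eventually_elim, simp add: s_def cmap_cinv\<close>)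
    qed
    show "\<forall>\<^sub>F z in mnear N (f x). s z \<in> points M \<and> f (s z) = z"
      using ev'
    proof eventually_elim
      case (elim z)
      have sc: "s z \<in> cdom c" using elim by (simp add: s_def cinv_in)
      have "cmap d (f (s z)) = cmap d z"
        unfolding bspec[OF loc sc] using elim Pk[OF cmap_in_model[OF D]] by (simp add: s_def cmap_cinv)
      then have "f (s z) = z" using is_chartD(2)[OF D] d(2) sc elim by (auto simp: inj_on_def)
      then show ?case using sc is_chartD(1)[OF C] by auto
    qed
  qed
qed

subsection \<open>Manifolds are locally connected\<close>

lemma convex_imp_connected:
  fixes A :: "'e::lctvs set"
  assumes "convex A"
  shows "connected A"
  unfolding connected_iff_connected_component
proof (intro ballI)
  fix x y assume xy: "x \<in> A" "y \<in> A"
  let ?g = "\<lambda>t::real. (1 - t) *\<^sub>R x + t *\<^sub>R y"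
  have "continuous_on {0..1} ?g"
    unfolding continuous_on_def by (intro ballI tendsto_intros tendsto_scaleR_lctvs)
  then have "connected (?g ` {0..1})" by (rule connected_continuous_image) simp
  then show "connected_component A x y"
  proof (rule connected_componentI)
    show "?g ` {0..1} \<subseteq> A" using convexD_alt[OF assms xy] by auto
    show "x \<in> ?g ` {0..1}" by (rule image_eqI[of _ _ 0]) auto
    show "y \<in> ?g ` {0..1}" by (rule image_eqI[of _ _ 1]) auto
  qed
qed

text \<open>A point of \<open>K\<close> has a chart neighbourhood that is convex in coordinates; it
  is connected, so the maximal connected set \<open>K\<close> contains it.\<close>

lemma openin_connected_component:
  assumes M: "smooth_atlas M" and K: "K \<in> connected_components_of (mtop M)"
  shows "openin (mtop M) K"
  unfolding openin_iff_nhdsin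
proof (intro conjI ballI)
  show KM: "K \<subseteq> topspace (mtop M)" by (rule connected_components_of_subset[OF K])
  fix x assume x: "x \<in> K"
  then have xM: "x \<in> points M" using KM M by auto
  obtain c where c: "c \<in> atlas M" "x \<in> cdom c" using atlas_cover[OF M xM] by auto
  note c' = atlas_compatible[OF M c(1)]
  note C = compatible_chartD(1)[OF c']
  obtain T where T: "open T" "cmap c x \<in> T" "\<And>y. y \<in> T \<inter> cmodel c \<Longrightarrow> y \<in> cmap c ` cdom c"
    using eventually_chart_image[OF C c(2)] unfolding eventually_nbhds by auto
  obtain D where D: "convex D" "open D" "cmap c x \<in> D" "D \<subseteq> T" by (rule ex_convex_open[OF T(1,2)])
  let ?A = "D \<inter> cmodel c"
  have Ac: "y \<in> cmap c ` cdom c" if "y \<in> ?A" for y using that T D by auto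
  have "continuous_map (top_of_set ?A) (mtop M) (cinv c)"
    unfolding continuous_map_iff_nhdsin
  proof (intro ballI conjI)
    fix y assume "y \<in> topspace (top_of_set ?A)"
    then have y: "y \<in> ?A" by simp
    note yc = cinv_in[OF Ac[OF y]]
    show "cinv c y \<in> topspace (mtop M)" using yc is_chartD(1)[OF C] by (auto simp: M)
    have "nhdsin (top_of_set ?A) y \<le> nbhds (cmodel c) y"
      unfolding le_filter_def
    proof (intro allI impI)
      fix P assume "eventually P (nbhds (cmodel c) y)"
      then obtain V where "open V" "y \<in> V" "\<forall>z\<in>V \<inter> cmodel c. P z" unfolding eventually_nbhds by auto
      then show "eventually P (nhdsin (top_of_set ?A) y)"
        unfolding eventually_nhdsin using y by (intro disjI2 exI[of _ "?A \<inter> V"]) auto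
    qed
    then show "filterlim (cinv c) (mnear M (cinv c y)) (nhdsin (top_of_set ?A) y)"
      using filterlim_cinv[OF M c' yc] unfolding cmap_cinv[OF Ac[OF y]] by (rule filterlim_mono[rotated 2]) simp
  qed
  moreover have "connected ?A"
    by (rule convex_imp_connected) (use D is_chartD(3)[OF C] in \<open>auto intro: convex_Int subspace_imp_convex\<close>)
  then have "connectedin (top_of_set ?A) ?A" by (simp add: connectedin_subtopology)
  ultimately have "connectedin (mtop M) (cinv c ` ?A)" by (rule connectedin_continuous_map_image)
  moreover have xA: "cmap c x \<in> ?A" using D cmap_in_model[OF C c(2)] by simp
  then have "x \<in> cinv c ` ?A" using cinv_cmap[OF C c(2)] by (metis imageI)
  ultimately have sub: "cinv c ` ?A \<subseteq> K"
    using x by (intro connected_components_of_maximal[OF K]) (auto simp: disjnt_iff)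
  have "\<forall>\<^sub>F y in nbhds (cmodel c) (cmap c x). y \<in> ?A"
    unfolding eventually_nbhds by (rule exI[of _ D]) (use D in auto)
  then show "eventually (\<lambda>y. y \<in> K) (mnear M x)"
    unfolding eventually_mnear[OF M c' c(2)] by eventually_elim (use sub in auto)
qed

subsection \<open>Partial derivatives\<close>

lemma dir_deriv_const [simp]: "dir_deriv (\<lambda>_. k) x v = 0"
  by (rule dir_deriv_eqI) simp

text \<open>The direction splits as \<open>(w, 0) + (0, z)\<close>, and the chain rule along the two
  coordinate slices identifies the summands.\<close>

lemma dir_deriv_partial:
  assumes F: "model_space F" and G: "model_space G" and m: "smooth_near (F \<times> G) (x, y) m"
    and w: "w \<in> F" and z: "z \<in> G"
  shows "dir_deriv m (x, y) (w, z) = dir_deriv (\<lambda>u. m (u, y)) x w + dir_deriv (\<lambda>v. m (x, v)) y z"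
proof -
  have xy: "x \<in> F" "y \<in> G" using smooth_near_in_model[OF m] by auto
  have FG: "model_space (F \<times> G)" by (rule model_space_Times[OF F G])
  have s: "subspace F" "subspace G" "subspace (F \<times> G)" "0 \<in> F" "0 \<in> G"
    using F G FG by (auto simp: model_space_def subspace_0)
  have "dir_deriv (\<lambda>u. m (u, y)) x w = dir_deriv m (x, y) (dir_deriv (\<lambda>u. (u, y)) x w)"
    by (rule smooth_near_compose(2)[OF s(1) FG smooth_near_Pair(1)[OF s(1) smooth_near_id(1) smooth_near_const] _ _ w])
      (use m s xy eventually_nbhds_model[of F x] in \<open>auto elim!: eventually_mono\<close>)
  also have "dir_deriv (\<lambda>u. (u, y)) x w = (w, 0)"
    using smooth_near_Pair(2)[OF s(1) smooth_near_id(1)[OF s(1) xy(1)] smooth_near_const[OF s(1) xy(1)] w]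
      smooth_near_id(2)[OF s(1) xy(1) w] by simp
  finally have 1: "dir_deriv (\<lambda>u. m (u, y)) x w = dir_deriv m (x, y) (w, 0)" .
  have "dir_deriv (\<lambda>v. m (x, v)) y z = dir_deriv m (x, y) (dir_deriv (\<lambda>v. (x, v)) y z)"
    by (rule smooth_near_compose(2)[OF s(2) FG smooth_near_Pair(1)[OF s(2) smooth_near_const smooth_near_id(1)] _ _ z])
      (use m s xy eventually_nbhds_model[of G y] in \<open>auto elim!: eventually_mono\<close>)
  also have "dir_deriv (\<lambda>v. (x, v)) y z = (0, z)"
    using smooth_near_Pair(2)[OF s(2) smooth_near_const[OF s(2) xy(2)] smooth_near_id(1)[OF s(2) xy(2)] z]
      smooth_near_id(2)[OF s(2) xy(2) z] by simp
  finally have 2: "dir_deriv (\<lambda>v. m (x, v)) y z = dir_deriv m (x, y) (0, z)" .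
  have "dir_deriv m (x, y) ((w, 0) + (0, z)) = dir_deriv m (x, y) (w, 0) + dir_deriv m (x, y) (0, z)"
    using smooth_near_continuous_linear[OF s(3) m] w z s(4,5) unfolding continuous_linear_on_def by blast
  then show ?thesis unfolding 1 2 by simp
qed

text \<open>\<open>P\<close> is linear only on a closed subspace \<open>T\<close> containing the
  values of \<open>f\<close>. This form serves both for elements of the dual and for derivatives of
  transition maps, which are linear on model spaces only.\<close>

lemma tderiv_continuous_linear:
  assumes M: "smooth_atlas M" and f: "smooth_at M vector_manifold f x" and v: "v \<in> tangent M x"
    and T: "model_space T" and P: "continuous_linear_on T P" and fT: "eventually (\<lambda>y. f y \<in> T) (mnear M x)"
  shows "tderiv M x f v \<in> T" "tderiv M x (\<lambda>y. P (f y)) v = P (tderiv M x f v)"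
    "smooth_at M vector_manifold (\<lambda>y. P (f y)) x"
proof -
  obtain c where c: "c \<in> charts_at M x" using charts_at_ex[OF M smooth_atD(1)[OF f]] by auto
  note A = charts_atD[OF M c]
  have vc: "v c \<in> cmodel c" by (rule tangentD(2)[OF v c])
  have s: "smooth_near (cmodel c) (cmap c x) (\<lambda>y. f (cinv c y))"
    using f smooth_at_vector_iff[OF M A(1,2)] by blast
  have e: "\<forall>\<^sub>F y in nbhds (cmodel c) (cmap c x). f (cinv c y) \<in> T"
    using fT unfolding eventually_mnear[OF M A(1,2)] .
  have fx: "f x \<in> T" by (rule eventually_mnear_self[OF A(5) M fT])
  have sT: "subspace T" using T by (simp add: model_space_def)
  have P': "smooth_near T (f (cinv c (cmap c x))) P" unfolding A(9) by (rule smooth_near_affine(2)[OF sT P fx])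
  show in_T: "tderiv M x f v \<in> T"
    unfolding tderiv_chart[OF M f v c] by (rule dir_deriv_in_model[OF A(6) T s e vc])
  show sm: "smooth_at M vector_manifold (\<lambda>y. P (f y)) x"
    unfolding smooth_at_vector_iff[OF M A(1,2)] by (rule smooth_near_compose(1)[OF A(6) T s P' e])
  show "tderiv M x (\<lambda>y. P (f y)) v = P (tderiv M x f v)"
    unfolding tderiv_chart[OF M sm v c] tderiv_chart[OF M f v c] smooth_near_compose(2)[OF A(6) T s P' e vc]
    using smooth_near_affine(3)[OF sT P] fx in_T A(9) tderiv_chart[OF M f v c] by simp
qed

lemma tderiv_const:
  assumes "smooth_atlas M" "x \<in> points M" "v \<in> tangent M x" "eventually (\<lambda>y. f y = k) (mnear M x)"
  shows "tderiv M x f v = 0"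
proof -
  have "tderiv M x f v = tderiv M x (\<lambda>_. k) v" by (rule tderiv_cong[OF assms])
  also have "\<dots> = 0" by (simp add: tderiv_def Let_def comp_def dir_deriv_eqI)
  finally show ?thesis .
qed

subsection \<open>The coadjoint action\<close>

locale lie =
  fixes H :: "'h monoid" (structure) and M :: "('h, 'f::lctvs) manifold"
  assumes lie_group: "lie_group H M"
begin

lemma group: "group H" and smooth_atlas: "smooth_atlas M" and points [simp]: "points M = carrier H"
  using lie_group by (auto simp: lie_group_def is_manifold_smooth_atlas)

sublocale group H by (rule group)

lemma smooth_at_mult:
  assumes K: "smooth_atlas K" and f: "smooth_at K M f x" and g: "smooth_at K M g x"
  shows "smooth_at K M (\<lambda>y. f y \<otimes> g y) x"
proof -
  note P = smooth_atlas_prod[OF smooth_atlas smooth_atlas]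
  have "smooth_at (prod_manifold M M) M (\<lambda>(a, b). a \<otimes> b) (f x, g x)"
    using lie_group smooth_atD(2)[OF f] smooth_atD(2)[OF g] smooth_map_iff_smooth_at[OF P smooth_atlas]
    by (auto simp: lie_group_def)
  from smooth_at_compose[OF K P smooth_atlas smooth_at_Pair[OF K smooth_atlas smooth_atlas f g] this]
  show ?thesis by simp
qed

lemma smooth_at_inv:
  assumes K: "smooth_atlas K" and f: "smooth_at K M f x"
  shows "smooth_at K M (\<lambda>y. inv (f y)) x"
proof -
  have "smooth_at M M (\<lambda>a. inv a) (f x)"
    using lie_group smooth_atD(2)[OF f] smooth_map_iff_smooth_at[OF smooth_atlas smooth_atlas]
    by (auto simp: lie_group_def)
  from smooth_at_compose[OF K smooth_atlas smooth_atlas f this] show ?thesis .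
qed

lemma smooth_at_conj: "h \<in> carrier H \<Longrightarrow> a \<in> carrier H \<Longrightarrow> smooth_at M M (\<lambda>a. h \<otimes> a \<otimes> inv h) a"
  by (intro smooth_at_mult smooth_at_const smooth_at_id smooth_atlas) auto

lemma Ad_in_lie_algebra:
  assumes "h \<in> carrier H" "\<eta> \<in> lie_algebra H M"
  shows "Ad H M h \<eta> \<in> lie_algebra H M"
  using tmap_in_tangent[OF smooth_atlas smooth_atlas smooth_at_conj[OF assms(1) one_closed], of \<eta>] assms
  unfolding Ad_def lie_algebra_def by simp

text \<open>\<open>Ad\<close> applied to \<eta> is the partial derivative, in the second argument at
  the unit, of conjugation \<open>(h, a) \<mapsto> h a h\<^sup>-\<^sup>1\<close>. In coordinates
  this is a directional derivative of the smooth map \<open>K\<close> in the fixed direction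
  \<open>(0, \<eta> c)\<close>, hence smooth in the base point.\<close>

lemma smooth_at_Ad:
  assumes \<eta>: "\<eta> \<in> lie_algebra H M" and c: "c \<in> charts_at M \<one>"
  shows "smooth_at M vector_manifold (\<lambda>h. Ad H M h \<eta> c) \<one>"
proof -
  note A = charts_atD[OF smooth_atlas c]
  note P = smooth_atlas_prod[OF smooth_atlas smooth_atlas]
  let ?E = "cmodel c" and ?e = "cmap c \<one>"
  let ?pc = "prod_chart c c"
  have pc: "compatible_chart (prod_manifold M M) ?pc"
    by (rule atlas_compatible[OF P]) (use A in \<open>auto simp: atlas_prod\<close>)
  have pc1: "(\<one>, \<one>) \<in> cdom ?pc" using A by simp
  have \<eta>T: "\<eta> \<in> tangent M \<one>" using \<eta> by (simp add: lie_algebra_def)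
  have w: "\<eta> c \<in> ?E" by (rule tangentD(2)[OF \<eta>T c])
  define conj where "conj = (\<lambda>p. fst p \<otimes> snd p \<otimes> inv (fst p))"
  have conj: "smooth_at (prod_manifold M M) M conj (\<one>, \<one>)"
    unfolding conj_def
    by (intro smooth_at_mult smooth_at_inv P smooth_at_fst_snd smooth_atlas) auto
  define K where "K = (\<lambda>q. cmap c (conj (cinv ?pc q)))"
  have "conj (\<one>, \<one>) \<in> cdom c" using A by (simp add: conj_def)
  from smooth_at_chart(1)[OF P smooth_atlas conj pc pc1 A(1) this]
  have K: "smooth_near (?E \<times> ?E) (?e, ?e) K" by (simp add: K_def)
  have w2: "(0, \<eta> c) \<in> ?E \<times> ?E" using w A(6) by (simp add: subspace_0)
  have "smooth_near ?E ?e (\<lambda>y. dir_deriv K (y, ?e) (0, \<eta> c))"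
    by (rule smooth_near_compose(1)[OF A(6) model_space_Times[OF A(7) A(7)]
        smooth_near_Pair(1)[OF A(6) smooth_near_id(1)[OF A(6,8)] smooth_near_const[OF A(6,8), of ?e]],
        where g = "\<lambda>q. dir_deriv K q (0, \<eta> c)"])
      (use smooth_near_dir_deriv[OF K w2] eventually_nbhds_model[of ?E ?e] A(8) in \<open>auto elim!: eventually_mono\<close>)
  then have "smooth_near ?E ?e (\<lambda>y. Ad H M (cinv c y) \<eta> c)"
  proof (rule smooth_near_cong[OF A(6)])
    show "\<forall>\<^sub>F y in nbhds ?E ?e. dir_deriv K (y, ?e) (0, \<eta> c) = Ad H M (cinv c y) \<eta> c"
      using eventually_chart_image[OF A(3,2)]
    proof eventually_elim
      case (elim y)
      define h where "h = cinv c y"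
      have h: "h \<in> carrier H" using cinv_in[OF elim] is_chartD(1)[OF A(3)] by (auto simp: h_def)
      have "Ad H M h \<eta> c = dir_deriv (\<lambda>z. cmap c (h \<otimes> cinv c z \<otimes> inv h)) ?e (\<eta> c)"
        unfolding Ad_def
        by (rule tmap_apply(2)[OF smooth_atlas smooth_atlas smooth_at_conj[OF h one_closed] \<eta>T _ c]) (use h c in simp)
      also have "\<dots> = dir_deriv (\<lambda>z. K (y, z)) ?e (\<eta> c)"
        by (rule dir_deriv_cong_near(1)[OF A(6,8) w])
          (use eventually_chart_image[OF A(3,2)] in \<open>eventually_elim,
            simp add: K_def conj_def cinv_prod_chart[OF A(3,3) elim] h_def\<close>)
      \<comment> \<open>The two difference quotients are literally equal, because adding a multiple
        of \<open>(0, \<eta> c)\<close> leaves the first coordinate alone.\<close>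
      also have "\<dots> = dir_deriv K (y, ?e) (0, \<eta> c)"
        by (simp add: dir_deriv_def)
      finally show ?case by (simp add: h_def)
    qed
  qed
  then show ?thesis by (simp add: smooth_at_vector_iff[OF smooth_atlas A(1,2)])
qed

lemma eventually_carrier: "eventually (\<lambda>h. h \<in> carrier H) (mnear M x)"
  using eventually_mnear_points[OF smooth_atlas] by simp

text \<open>The bracket is defined chart by chart. Its components fit together because those of
  \<open>Ad H M h \<eta>\<close> are related by the same linear map for every \<open>h\<close>, and
  this map commutes with differentiation in \<open>h\<close>.\<close>

lemma lie_bracket_coord:
  assumes \<xi>: "\<xi> \<in> lie_algebra H M" and \<eta>: "\<eta> \<in> lie_algebra H M" and c: "c \<in> charts_at M \<one>"
  shows "lie_bracket H M \<xi> \<eta> c \<in> cmodel c"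
    "coord_tvec M \<one> c (lie_bracket H M \<xi> \<eta> c) = lie_bracket H M \<xi> \<eta>"
proof -
  note A = charts_atD[OF smooth_atlas c]
  have \<xi>T: "\<xi> \<in> tangent M \<one>" using \<xi> by (simp add: lie_algebra_def)
  have AdT: "Ad H M h \<eta> \<in> tangent M \<one>" if "h \<in> carrier H" for h
    using Ad_in_lie_algebra[OF that \<eta>] by (simp add: lie_algebra_def)
  have in_c: "eventually (\<lambda>h. Ad H M h \<eta> c \<in> cmodel c) (mnear M \<one>)"
    using eventually_carrier by eventually_elim (rule tangentD(2)[OF AdT c])
  note s = smooth_at_Ad[OF \<eta> c]
  show "lie_bracket H M \<xi> \<eta> c \<in> cmodel c"
    unfolding lie_bracket_def
    by (rule tderiv_continuous_linear(1)[OF smooth_atlas s \<xi>T A(7) continuous_linear_on_id in_c])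
  show "coord_tvec M \<one> c (lie_bracket H M \<xi> \<eta> c) = lie_bracket H M \<xi> \<eta>"
  proof
    fix d
    show "coord_tvec M \<one> c (lie_bracket H M \<xi> \<eta> c) d = lie_bracket H M \<xi> \<eta> d"
    proof (cases "d \<in> charts_at M \<one>")
      case d: True
      let ?\<tau> = "\<lambda>y. cmap d (cinv c y)"
      have l: "continuous_linear_on (cmodel c) (dir_deriv ?\<tau> (cmap c \<one>))"
        by (rule smooth_near_continuous_linear[OF A(6) charts_at_transition_near(1)[OF smooth_atlas c d]])
      have "lie_bracket H M \<xi> \<eta> d = tderiv M \<one> (\<lambda>h. dir_deriv ?\<tau> (cmap c \<one>) (Ad H M h \<eta> c)) \<xi>"
        unfolding lie_bracket_def
        by (rule tderiv_cong[OF smooth_atlas A(5) \<xi>T])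
          (rule eventually_mono[OF eventually_carrier], rule tangentD(3)[OF AdT c d])
      also have "\<dots> = dir_deriv ?\<tau> (cmap c \<one>) (lie_bracket H M \<xi> \<eta> c)"
        unfolding lie_bracket_def by (rule tderiv_continuous_linear(2)[OF smooth_atlas s \<xi>T A(7) l in_c])
      finally show ?thesis using d by (simp add: coord_tvec_def comp_def)
    next
      case False
      have "lie_bracket H M \<xi> \<eta> d = 0"
        unfolding lie_bracket_def
        by (rule tderiv_const[OF smooth_atlas A(5) \<xi>T])
          (rule eventually_mono[OF eventually_carrier], rule tangentD(1)[OF AdT False])
      then show ?thesis using False by (simp add: coord_tvec_def)
    qed
  qed
qed

text \<open>Differentiate \<open>h \<otimes> inv h = \<one>\<close> at the unit, where both partial
  derivatives of the multiplication are the identity.\<close>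

lemma tmap_inv:
  assumes \<xi>: "\<xi> \<in> tangent M \<one>"
  shows "tmap M M (\<lambda>h. inv h) \<one> \<xi> = tscale (-1) \<xi>"
proof -
  obtain c where c: "c \<in> charts_at M \<one>" using charts_at_ex[OF smooth_atlas, of \<one>] by auto
  note A = charts_atD[OF smooth_atlas c]
  note P = smooth_atlas_prod[OF smooth_atlas smooth_atlas]
  have inv: "smooth_at M M (\<lambda>h. inv h) \<one>"
    by (rule smooth_at_inv[OF smooth_atlas smooth_at_id[OF smooth_atlas A(5)]])
  have invT: "tmap M M (\<lambda>h. inv h) \<one> \<xi> \<in> tangent M \<one>"
    using tmap_in_tangent[OF smooth_atlas smooth_atlas inv \<xi>] by simp
  \<comment> \<open>The claim in a single chart; \<open>m\<close> and \<open>i\<close> below are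
    multiplication and inversion in coordinates.\<close>
  have T: "u + tmap M M (\<lambda>h. inv h) \<one> \<xi> d = 0" if "d \<in> charts_at M \<one>" "u = \<xi> d" for u d
  proof -
    note D = charts_atD[OF smooth_atlas that(1)]
    let ?F = "cmodel d" and ?f = "cmap d \<one>"
    let ?pd = "prod_chart d d"
    have pd: "compatible_chart (prod_manifold M M) ?pd"
      by (rule atlas_compatible[OF P]) (use D in \<open>auto simp: atlas_prod\<close>)
    have pd1: "(\<one>, \<one>) \<in> cdom ?pd" using D by simp
    have u: "u \<in> ?F" unfolding that(2) by (rule tangentD(2)[OF \<xi> that(1)])
    have mult: "smooth_at (prod_manifold M M) M (\<lambda>p. fst p \<otimes> snd p) (\<one>, \<one>)"
      by (intro smooth_at_mult P smooth_at_fst_snd smooth_atlas) auto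
    define m where "m = (\<lambda>q. cmap d (fst (cinv ?pd q) \<otimes> snd (cinv ?pd q)))"
    define i where "i = (\<lambda>y. cmap d (inv (cinv d y)))"
    have "fst (\<one>, \<one>) \<otimes> snd (\<one>, \<one>) \<in> cdom d" using D by simp
    from smooth_at_chart(1)[OF P smooth_atlas mult pd pd1 D(1) this]
    have m: "smooth_near (?F \<times> ?F) (?f, ?f) m" by (simp add: m_def)
    have i1: "inv \<one> \<in> cdom d" using D by simp
    note I = smooth_at_chart[OF smooth_atlas smooth_atlas inv D(1,2) D(1) i1]
    have i: "smooth_near ?F ?f i" using I(1) by (simp add: i_def)
    have if1: "i ?f = ?f" by (simp add: i_def D(9))
    define z where "z = dir_deriv i ?f u"
    have zF: "z \<in> ?F" unfolding z_def
      by (rule dir_deriv_in_model[OF D(6) D(7) i _ u]) (use I(3) in \<open>simp add: i_def\<close>)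
    have tz: "tmap M M (\<lambda>h. inv h) \<one> \<xi> d = z"
      unfolding z_def i_def that(2)
      by (rule tmap_apply(2)[OF smooth_atlas smooth_atlas inv \<xi> _ that(1)]) (use that in simp)
    have m1: "m (y, ?f) = y" "m (?f, y) = y" if "y \<in> cmap d ` cdom d" for y
    proof -
      have f: "?f \<in> cmap d ` cdom d" using D by auto
      have "cinv d y \<in> carrier H" using cinv_in[OF that] is_chartD(1)[OF D(3)] by auto
      then show "m (y, ?f) = y" "m (?f, y) = y"
        unfolding m_def cinv_prod_chart[OF D(3,3) that f] cinv_prod_chart[OF D(3,3) f that]
        by (simp_all add: D(9) cmap_cinv[OF that])
    qed
    note ev = eventually_chart_image[OF D(3,2)]
    have "dir_deriv (\<lambda>y. m (y, ?f)) ?f u = dir_deriv (\<lambda>y. y) ?f u"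
      by (rule dir_deriv_cong_near(1)[OF D(6,8) u]) (rule eventually_mono[OF ev], rule m1)
    also have "\<dots> = u" by (rule smooth_near_id(2)[OF D(6,8) u])
    finally have 1: "dir_deriv (\<lambda>y. m (y, ?f)) ?f u = u" .
    have "dir_deriv (\<lambda>y. m (?f, y)) ?f z = dir_deriv (\<lambda>y. y) ?f z"
      by (rule dir_deriv_cong_near(1)[OF D(6,8) zF]) (rule eventually_mono[OF ev], rule m1)
    also have "\<dots> = z" by (rule smooth_near_id(2)[OF D(6,8) zF])
    finally have 2: "dir_deriv (\<lambda>y. m (?f, y)) ?f z = z" .
    have "0 = dir_deriv (\<lambda>y. ?f) ?f u" by simp
    also have "\<dots> = dir_deriv (\<lambda>y. m (y, i y)) ?f u"
    proof (rule dir_deriv_cong_near(1)[OF D(6,8) u])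
      show "\<forall>\<^sub>F y in nbhds ?F ?f. ?f = m (y, i y)"
        using ev I(2)
      proof eventually_elim
        case (elim y)
        have "i y \<in> cmap d ` cdom d" using elim by (simp add: i_def)
        moreover have "cinv d y \<in> carrier H" using cinv_in[OF elim(1)] is_chartD(1)[OF D(3)] by auto
        moreover have "cinv d (i y) = inv (cinv d y)" using elim by (simp add: i_def cinv_cmap[OF D(3)])
        ultimately show ?case using elim(1) by (simp add: m_def cinv_prod_chart[OF D(3,3)])
      qed
    qed
    also have "\<dots> = dir_deriv m (?f, i ?f) (dir_deriv (\<lambda>y. (y, i y)) ?f u)"
      by (rule smooth_near_compose(2)[OF D(6) model_space_Times[OF D(7) D(7)]
          smooth_near_Pair(1)[OF D(6) smooth_near_id(1)[OF D(6,8)] i] _ _ u])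
        (use m if1 I(3) eventually_nbhds_model[of ?F ?f] in \<open>auto simp: i_def elim: eventually_elim2\<close>)
    also have "dir_deriv (\<lambda>y. (y, i y)) ?f u = (u, z)"
      using smooth_near_Pair(2)[OF D(6) smooth_near_id(1)[OF D(6,8)] i u] smooth_near_id(2)[OF D(6,8) u]
      by (simp add: z_def)
    also have "dir_deriv m (?f, i ?f) (u, z) = u + z"
      using dir_deriv_partial[OF D(7,7) m u zF] by (simp add: if1 1 2)
    finally show ?thesis by (simp add: tz)
  qed
  show ?thesis
  proof
    fix d show "tmap M M (\<lambda>h. inv h) \<one> \<xi> d = tscale (- 1) \<xi> d"
    proof (cases "d \<in> charts_at M \<one>")
      case True
      from T[OF this refl] show ?thesis by (simp add: tscale_def eq_neg_iff_add_eq_0 add.commute)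
    next
      case False
      then show ?thesis using tangentD(1)[OF invT False] tangentD(1)[OF \<xi> False] by (simp add: tscale_def)
    qed
  qed
qed

text \<open>The coadjoint action evaluates \<mu> on \<open>Ad\<close> of the inverse; the minus sign
  is the derivative of the inversion. Read in a chart, \<mu> is continuous linear on a model space,
  so it passes through the derivative that defines the bracket.\<close>

lemma coadjoint_derivative:
  assumes \<mu>: "\<mu> \<in> lie_dual H M" and \<xi>: "\<xi> \<in> lie_algebra H M" and \<eta>: "\<eta> \<in> lie_algebra H M"
  shows "tderiv M \<one> (\<lambda>h. coadjoint_action H M h \<mu> \<eta>) \<xi> = - \<mu> (lie_bracket H M \<xi> \<eta>)"
proof -
  obtain c where c: "c \<in> charts_at M \<one>" using charts_at_ex[OF smooth_atlas, of \<one>] by auto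
  note A = charts_atD[OF smooth_atlas c]
  have \<xi>T: "\<xi> \<in> tangent M \<one>" using \<xi> by (simp add: lie_algebra_def)
  have AdT: "Ad H M h \<eta> \<in> tangent M \<one>" if "h \<in> carrier H" for h
    using Ad_in_lie_algebra[OF that \<eta>] by (simp add: lie_algebra_def)
  have in_c: "eventually (\<lambda>h. Ad H M h \<eta> c \<in> cmodel c) (mnear M \<one>)"
    using eventually_carrier by eventually_elim (rule tangentD(2)[OF AdT c])
  let ?l = "\<lambda>w. \<mu> (coord_tvec M \<one> c w)"
  have l: "continuous_linear_on (cmodel c) ?l" using \<mu> c by (simp add: lie_dual_def)
  note s = smooth_at_Ad[OF \<eta> c]
  note L = tderiv_continuous_linear[OF smooth_atlas s \<xi>T A(7) l in_c]
  have inv: "smooth_at M M (\<lambda>h. inv h) \<one>"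
    by (rule smooth_at_inv[OF smooth_atlas smooth_at_id[OF smooth_atlas A(5)]])
  have "tderiv M \<one> (\<lambda>h. coadjoint_action H M h \<mu> \<eta>) \<xi> = tderiv M \<one> (\<lambda>h. ?l (Ad H M (inv h) \<eta> c)) \<xi>"
    by (rule tderiv_cong[OF smooth_atlas A(5) \<xi>T])
      (rule eventually_mono[OF eventually_carrier], simp add: coadjoint_action_def Ad_dual_def coord_tvec(3)[OF smooth_atlas c AdT] \<eta>)
  also have "\<dots> = tderiv M (inv \<one>) (\<lambda>h. ?l (Ad H M h \<eta> c)) (tmap M M (\<lambda>h. inv h) \<one> \<xi>)"
    by (rule tderiv_compose[OF smooth_atlas smooth_atlas inv \<xi>T, symmetric]) (use L(3) in simp)
  also have "\<dots> = - tderiv M \<one> (\<lambda>h. ?l (Ad H M h \<eta> c)) \<xi>"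
    using tderiv_linear(2)[OF smooth_atlas L(3) \<xi>T \<xi>T, of "-1"] by (simp add: tmap_inv[OF \<xi>T])
  also have "tderiv M \<one> (\<lambda>h. ?l (Ad H M h \<eta> c)) \<xi> = ?l (lie_bracket H M \<xi> \<eta> c)"
    unfolding L(2) by (simp add: lie_bracket_def)
  finally show ?thesis using lie_bracket_coord(2)[OF \<xi> \<eta> c] by simp
qed

lemma smooth_at_left_action:
  assumes S: "smooth_atlas S" and L: "smooth_left_action H M S L"
    and K: "smooth_atlas K" and f: "smooth_at K M f x" and g: "smooth_at K S g x"
  shows "smooth_at K S (\<lambda>y. L (f y) (g y)) x"
proof -
  note P = smooth_atlas_prod[OF smooth_atlas S]
  have "smooth_at (prod_manifold M S) S (\<lambda>(h, x). L h x) (f x, g x)"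
    using L smooth_atD(2)[OF f] smooth_atD(2)[OF g] smooth_map_iff_smooth_at[OF P S]
    by (auto simp: smooth_left_action_def)
  from smooth_at_compose[OF K P S smooth_at_Pair[OF K smooth_atlas S f g] this]
  show ?thesis by simp
qed

end

subsection \<open>Reduction of a dual pair\<close>

text \<open>\<open>Q\<close> is the reduced space. \<open>N\<close> and \<open>\<pi>\<close> are
  parameters bound by equations, so the proofs meet them as opaque names and open the definitions
  only where they matter.\<close>

locale reduced_dual_pair = lie H MH
  for H :: "'h monoid" (structure) and MH :: "('h, 'f2::lctvs) manifold" +
  fixes S :: "('s, 'e::lctvs) manifold" and \<omega> :: "('s, 'e) two_form"
    and G :: "'g monoid" and MG :: "('g, 'f1::lctvs) manifold"
    and R :: "'s \<Rightarrow> 'g \<Rightarrow> 's" and L :: "'h \<Rightarrow> 's \<Rightarrow> 's"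
    and J\<^sub>R :: "'s \<Rightarrow> ('g, 'f1) tvec \<Rightarrow> real" and J\<^sub>L :: "'s \<Rightarrow> ('h, 'f2) tvec \<Rightarrow> real"
    and \<sigma> :: "('g, 'f1) tvec \<Rightarrow> real"
    and Q :: "('s set, 'q::lctvs) manifold" and \<omega>\<^sub>Q :: "('s set, 'q) two_form"
    and N :: "'s set" and \<pi> :: "'s \<Rightarrow> 's set"
  assumes S: "smooth_atlas S" and symplectic: "symplectic_form S \<omega>"
    and action: "smooth_left_action H MH S L"
    and orthogonal_R: "x \<in> points S \<Longrightarrow> (\<lambda>\<xi>. right_generator G MG S R \<xi> x) ` lie_algebra G MG =
         symplectic_orthogonal S \<omega> x ((\<lambda>\<xi>. left_generator H MH S L \<xi> x) ` lie_algebra H MH)"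
    and orthogonal_L: "x \<in> points S \<Longrightarrow> (\<lambda>\<xi>. left_generator H MH S L \<xi> x) ` lie_algebra H MH =
         symplectic_orthogonal S \<omega> x ((\<lambda>\<xi>. right_generator G MG S R \<xi> x) ` lie_algebra G MG)"
    and momentum_R: "momentum_map G MG S \<omega> (right_generator G MG S R) J\<^sub>R"
    and momentum_L: "momentum_map H MH S \<omega> (left_generator H MH S L) J\<^sub>L"
    and equivariant_R: "x \<in> points S \<Longrightarrow> g \<in> carrier G \<Longrightarrow> J\<^sub>R (R x g) = Ad_dual G MG g (J\<^sub>R x)"
    and equivariant_L: "x \<in> points S \<Longrightarrow> h \<in> carrier H \<Longrightarrow> J\<^sub>L (L h x) = coadjoint_action H MH h (J\<^sub>L x)"
    and G_transitive: "transitive_on (\<lambda>x. R x ` carrier G) (level_set S J\<^sub>L \<tau>)"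
    and H_transitive: "K \<in> connected_components_of (subtopology (mtop S) N) \<Longrightarrow>
      transitive_on (\<lambda>x. (\<lambda>h. L h x) ` carrier H) K"
    and N_def: "N = level_set S J\<^sub>R \<sigma>"
    and \<pi>_def: "\<pi> = (\<lambda>x. R x ` coadjoint_isotropy G MG \<sigma>)"
    and N: "is_submanifold S N"
    and Q: "smooth_atlas Q" "Hausdorff_space (mtop Q)" and points_Q: "points Q = \<pi> ` N"
    and submersion: "submersion (submanifold S N) Q \<pi>"
    and symplectic_Q: "symplectic_form Q \<omega>\<^sub>Q"
    and reduced: "pullback_eq (submanifold S N) (restrict_form S \<omega> N) Q \<omega>\<^sub>Q \<pi>"
begin

section \<open>The level set, its classes and the components of the reduced space\<close>

abbreviation "N' \<equiv> submanifold S N"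

lemma N': "smooth_atlas N'"
  by (rule smooth_atlas_submanifold[OF S N])

lemma N_points: "x \<in> N \<Longrightarrow> x \<in> points S" and J_R_N: "x \<in> N \<Longrightarrow> J\<^sub>R x = \<sigma>"
  by (auto simp: N_def level_set_def)

lemma inclusion: "x \<in> N \<Longrightarrow> smooth_at N' S (\<lambda>y. y) x"
  by (rule smooth_at_inclusion[OF S N])

lemma smooth_at_\<pi>: "x \<in> N \<Longrightarrow> smooth_at N' Q \<pi> x"
  using submersion smooth_map_iff_smooth_at[OF N' Q(1)] by (simp add: submersion_def)

text \<open>A level set of \<open>J\<^sub>L\<close> is a single orbit of \<open>G\<close>, and an
  element of \<open>G\<close> carrying \<open>x\<close> to another point of \<open>N\<close> must
  fix \<sigma>, by equivariance of \<open>J\<^sub>R\<close>.\<close>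

lemma \<pi>_eq:
  assumes x: "x \<in> N"
  shows "\<pi> x = {y \<in> N. J\<^sub>L y = J\<^sub>L x}"
proof (intro equalityI subsetI)
  have orbit: "R x ` carrier G = level_set S J\<^sub>L (J\<^sub>L x)"
    using G_transitive[of "J\<^sub>L x"] N_points[OF x] by (auto simp: transitive_on_def level_set_def)
  {
    fix y assume "y \<in> \<pi> x"
    then obtain g where g: "g \<in> carrier G" "Ad_dual G MG g \<sigma> = \<sigma>" "y = R x g"
      by (auto simp: \<pi>_def coadjoint_isotropy_def)
    then have "y \<in> level_set S J\<^sub>L (J\<^sub>L x)" using orbit by auto
    moreover have "J\<^sub>R y = \<sigma>" using equivariant_R[OF N_points[OF x] g(1)] g J_R_N[OF x] by simp
    ultimately show "y \<in> {y \<in> N. J\<^sub>L y = J\<^sub>L x}" by (auto simp: level_set_def N_def)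
  }
  fix y assume y: "y \<in> {y \<in> N. J\<^sub>L y = J\<^sub>L x}"
  then have "y \<in> R x ` carrier G" using orbit N_points by (auto simp: level_set_def)
  then obtain g where g: "g \<in> carrier G" "y = R x g" by auto
  have "Ad_dual G MG g \<sigma> = \<sigma>"
    using equivariant_R[OF N_points[OF x] g(1)] g y J_R_N[OF x] J_R_N[of y] by simp
  then show "y \<in> \<pi> x" using g by (auto simp: \<pi>_def coadjoint_isotropy_def)
qed

lemma \<pi>_eq_iff: "x \<in> N \<Longrightarrow> y \<in> N \<Longrightarrow> \<pi> x = \<pi> y \<longleftrightarrow> J\<^sub>L x = J\<^sub>L y"
  using \<pi>_eq by auto

text \<open>A class is a set of points on which \<open>J\<^sub>L\<close> is constant, by
  \<open>\<pi>_eq\<close>, so any representative may be picked.\<close>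

definition \<Phi> :: "'s set \<Rightarrow> ('h, 'f2) tvec \<Rightarrow> real" where
  "\<Phi> q = J\<^sub>L (SOME x. x \<in> q)"

lemma \<Phi>_\<pi>: "x \<in> N \<Longrightarrow> \<Phi> (\<pi> x) = J\<^sub>L x"
  unfolding \<Phi>_def \<pi>_eq by (rule someI2[of _ x]) auto

definition component :: "'s \<Rightarrow> 's set" where
  "component x = connected_component_of_set (subtopology (mtop S) N) x"

lemma component:
  assumes x: "x \<in> N"
  shows "x \<in> component x" "component x \<subseteq> N" "connectedin (mtop N') (component x)" "openin (mtop N') (component x)"
    "component x = (\<lambda>h. L h x) ` carrier H"
proof -
  have top: "topspace (subtopology (mtop S) N) = N" using N_points by (auto simp: topspace_mtop[OF S])
  have K: "component x \<in> connected_components_of (subtopology (mtop S) N)"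
    unfolding component_def connected_component_in_connected_components_of top by (rule x)
  show xK: "x \<in> component x"
    unfolding component_def mem_Collect_eq connected_component_of_refl top by (rule x)
  show "component x \<subseteq> N" using connected_components_of_subset[OF K] top by simp
  show "connectedin (mtop N') (component x)"
    unfolding mtop_submanifold[OF S N] by (rule connectedin_connected_components_of[OF K])
  show "openin (mtop N') (component x)"
    by (rule openin_connected_component[OF N']) (use K in \<open>simp add: mtop_submanifold[OF S N]\<close>)
  show "component x = (\<lambda>h. L h x) ` carrier H"
    using H_transitive[OF K] xK by (simp add: transitive_on_def)
qed

lemma L_N: "x \<in> N \<Longrightarrow> h \<in> carrier H \<Longrightarrow> L h x \<in> N"
  using component(2,5)[of x] by auto

lemma J_L_L: "x \<in> N \<Longrightarrow> h \<in> carrier H \<Longrightarrow> J\<^sub>L (L h x) = coadjoint_action H MH h (J\<^sub>L x)"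
  by (rule equivariant_L[OF N_points])

lemma L_one: "x \<in> N \<Longrightarrow> L \<one> x = x"
  and L_mult: "x \<in> N \<Longrightarrow> h \<in> carrier H \<Longrightarrow> k \<in> carrier H \<Longrightarrow> L (h \<otimes> k) x = L h (L k x)"
  using action N_points by (auto simp: smooth_left_action_def)

lemma local_section:
  assumes x: "x \<in> N"
  obtains s where "s (\<pi> x) = x" "smooth_at Q N' s (\<pi> x)" "eventually (\<lambda>z. s z \<in> N \<and> \<pi> (s z) = z) (mnear Q (\<pi> x))"
  using submersion_section[OF N' Q(1) submersion, of x] x by auto

lemma openin_\<pi>_component:
  assumes x: "x \<in> N"
  shows "openin (mtop Q) (\<pi> ` component x)"
  unfolding openin_iff_nhdsin
proof (intro conjI ballI)
  show "\<pi> ` component x \<subseteq> topspace (mtop Q)" using component(2)[OF x] by (auto simp: Q points_Q)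
  fix q assume "q \<in> \<pi> ` component x"
  then obtain y where y: "y \<in> component x" "q = \<pi> y" by auto
  then have yN: "y \<in> N" using component(2)[OF x] by auto
  obtain s where s: "s (\<pi> y) = y" "smooth_at Q N' s (\<pi> y)" "eventually (\<lambda>z. s z \<in> N \<and> \<pi> (s z) = z) (mnear Q (\<pi> y))"
    by (rule local_section[OF yN])
  have "eventually (\<lambda>z. z \<in> component x) (mnear N' (s (\<pi> y)))"
    using component(4)[OF x] y(1) unfolding s(1) openin_iff_nhdsin by blast
  from eventually_compose_filterlim[OF this smooth_atD(3)[OF s(2)]]
  show "eventually (\<lambda>z. z \<in> \<pi> ` component x) (mnear Q q)"
    unfolding y(2) using s(3) by eventually_elim (metis imageI)
qed

text \<open>Distinct components of \<open>N\<close> may have intersecting images. A common class of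
  \<open>L h x\<close> and \<open>L k y\<close> is moved back by \<open>inv h\<close>, using
  equivariance of \<open>J\<^sub>L\<close>, which puts the class of \<open>x\<close> into the image
  of the component of \<open>y\<close>.\<close>

lemma \<pi>_component_disjoint:
  assumes x: "x \<in> N" and y: "y \<in> N" and "\<pi> ` component x \<inter> \<pi> ` component y \<noteq> {}"
  shows "\<pi> x \<in> \<pi> ` component y"
proof -
  obtain h k where hk: "h \<in> carrier H" "k \<in> carrier H" "\<pi> (L h x) = \<pi> (L k y)"
    using assms(3) unfolding component(5)[OF x] component(5)[OF y] by auto
  have h': "inv h \<in> carrier H" using hk by simp
  have "J\<^sub>L (L h x) = J\<^sub>L (L k y)" using hk(3) \<pi>_eq_iff[OF L_N[OF x hk(1)] L_N[OF y hk(2)]] by simp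
  then have "J\<^sub>L (L (inv h) (L h x)) = J\<^sub>L (L (inv h) (L k y))"
    using J_L_L[OF L_N[OF x hk(1)] h'] J_L_L[OF L_N[OF y hk(2)] h'] by simp
  then have "J\<^sub>L x = J\<^sub>L (L (inv h \<otimes> k) y)"
    using L_mult[OF x h' hk(1)] L_mult[OF y h' hk(2)] L_one[OF x] hk(1) by simp
  then have "\<pi> x = \<pi> (L (inv h \<otimes> k) y)"
    using \<pi>_eq_iff[OF x L_N[OF y m_closed[OF h' hk(2)]]] by simp
  then show ?thesis unfolding component(5)[OF y] using h' hk(2) by auto
qed

lemma component_of_Q:
  assumes C: "C \<in> connected_components_of (mtop Q)"
  obtains x where "x \<in> N" "C = \<pi> ` component x"
proof -
  have top: "topspace (mtop Q) = \<pi> ` N" by (simp add: Q points_Q)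
  have "C \<noteq> {}" by (rule nonempty_connected_components_of[OF C])
  then obtain q where "q \<in> C" by auto
  moreover have "C \<subseteq> \<pi> ` N" using connected_components_of_subset[OF C] unfolding top .
  ultimately obtain x where x: "x \<in> N" "\<pi> x \<in> C" by auto
  let ?D = "\<pi> ` component x"
  have D: "openin (mtop Q) ?D" by (rule openin_\<pi>_component[OF x(1)])
  have "smooth_map N' Q \<pi>" using submersion by (simp add: submersion_def)
  then have "connectedin (mtop Q) ?D"
    using component(3)[OF x(1)] by (auto simp: smooth_map_def intro: connectedin_continuous_map_image)
  moreover have xD: "\<pi> x \<in> ?D" using component(1)[OF x(1)] by auto
  ultimately have "?D \<subseteq> C"
    using x(2) by (intro connected_components_of_maximal[OF C]) (auto simp: disjnt_iff)
  moreover have "C \<subseteq> ?D"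
  proof -
    \<comment> \<open>The complement of \<open>?D\<close> is a union of open images, none of which
      meets \<open>?D\<close>, so \<open>?D\<close> is closed as well as open.\<close>
    have "\<pi> ` N - ?D = \<Union> {\<pi> ` component y | y. y \<in> N \<and> \<pi> y \<notin> ?D}"
    proof (intro equalityI subsetI)
      fix q assume "q \<in> \<pi> ` N - ?D"
      then show "q \<in> \<Union> {\<pi> ` component y | y. y \<in> N \<and> \<pi> y \<notin> ?D}" using component(1) by blast
    next
      fix q assume "q \<in> \<Union> {\<pi> ` component y | y. y \<in> N \<and> \<pi> y \<notin> ?D}"
      then obtain y where y: "y \<in> N" "\<pi> y \<notin> ?D" "q \<in> \<pi> ` component y" by blast
      then show "q \<in> \<pi> ` N - ?D" using component(2)[OF y(1)] \<pi>_component_disjoint[OF y(1) x(1)] by blast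
    qed
    moreover have "openin (mtop Q) (\<Union> {\<pi> ` component y | y. y \<in> N \<and> \<pi> y \<notin> ?D})"
      using openin_\<pi>_component by (intro openin_Union) blast
    ultimately have "closedin (mtop Q) ?D"
      using openin_subset[OF D] unfolding closedin_def top by simp
    from connectedin_clopen_cases[OF connectedin_connected_components_of[OF C] this D]
    show ?thesis using x(2) xD by (auto simp: disjnt_iff)
  qed
  ultimately show thesis using that[OF x(1)] by blast
qed

section \<open>Generators of \<open>H\<close> on the level set and on the reduced space\<close>

definition genN :: "('h, 'f2) tvec \<Rightarrow> 's \<Rightarrow> ('s, 'e) tvec" where
  "genN \<xi> x = tmap MH N' (\<lambda>h. L h x) \<one> \<xi>"

text \<open>Attached to a representative \<open>x\<close>, so that the action induced on the
  quotient need not be constructed.\<close>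

definition genQ :: "('h, 'f2) tvec \<Rightarrow> 's \<Rightarrow> ('s set, 'q) tvec" where
  "genQ \<xi> x = tmap N' Q \<pi> x (genN \<xi> x)"

lemma orbit_map:
  assumes x: "x \<in> N"
  shows "smooth_at MH S (\<lambda>h. L h x) \<one>" "smooth_at MH N' (\<lambda>h. L h x) \<one>"
proof -
  show s: "smooth_at MH S (\<lambda>h. L h x) \<one>"
    using N_points[OF x]
    by (intro smooth_at_left_action[OF S action smooth_atlas] smooth_at_id smooth_at_const smooth_atlas S) auto
  show "smooth_at MH N' (\<lambda>h. L h x) \<one>"
    by (rule smooth_at_into_submanifold[OF smooth_atlas S N s])
      (rule eventually_mono[OF eventually_carrier], rule L_N[OF x])
qed

text \<open>The orbit map of \<open>x\<close> stays in \<open>N\<close>, so the generator exists as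
  a tangent vector of \<open>N\<close>. Tangent vectors of \<open>N\<close> and of \<open>S\<close>
  are indexed by different atlases and are compared through the tangent map of the
  inclusion.\<close>

lemma generators:
  assumes x: "x \<in> N" and \<xi>: "\<xi> \<in> lie_algebra H MH"
  shows "genN \<xi> x \<in> tangent N' x" "genQ \<xi> x \<in> tangent Q (\<pi> x)"
    "tmap N' S (\<lambda>y. y) x (genN \<xi> x) = left_generator H MH S L \<xi> x"
    "genQ \<xi> x = tmap MH Q (\<lambda>h. \<pi> (L h x)) \<one> \<xi>"
proof -
  have \<xi>T: "\<xi> \<in> tangent MH \<one>" using \<xi> by (simp add: lie_algebra_def)
  note o = orbit_map[OF x]
  show g: "genN \<xi> x \<in> tangent N' x"
    using tmap_in_tangent[OF smooth_atlas N' o(2) \<xi>T] by (simp add: genN_def L_one[OF x])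
  show "genQ \<xi> x \<in> tangent Q (\<pi> x)"
    unfolding genQ_def by (rule tmap_in_tangent[OF N' Q(1) smooth_at_\<pi>[OF x] g])
  show "tmap N' S (\<lambda>y. y) x (genN \<xi> x) = left_generator H MH S L \<xi> x"
    using tmap_compose[OF smooth_atlas N' S o(2) _ \<xi>T, of "\<lambda>y. y"] inclusion[OF x]
    by (simp add: genN_def left_generator_def L_one[OF x])
  show "genQ \<xi> x = tmap MH Q (\<lambda>h. \<pi> (L h x)) \<one> \<xi>"
    using tmap_compose[OF smooth_atlas N' Q(1) o(2) _ \<xi>T, of \<pi>] smooth_at_\<pi>[OF x]
    by (simp add: genN_def genQ_def L_one[OF x])
qed

lemma J_L_dual: "x \<in> N \<Longrightarrow> J\<^sub>L x \<in> lie_dual H MH"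
  using momentum_L N_points by (simp add: momentum_map_def)

lemma smooth_at_J_L: "x \<in> N \<Longrightarrow> \<eta> \<in> lie_algebra H MH \<Longrightarrow> smooth_at S vector_manifold (\<lambda>y. J\<^sub>L y \<eta>) x"
  using momentum_L N_points smooth_fun_iff_smooth_at[OF S] by (auto simp: momentum_map_def)

text \<open>Equivariance gives \<open>d\<langle>J\<^sub>L, \<eta>\<rangle>(\<xi>\<^sub>S) = - \<langle>J\<^sub>L, [\<xi>, \<eta>]\<rangle>\<close>, and the left-hand side
  is \<open>\<omega>(\<eta>\<^sub>S, \<xi>\<^sub>S)\<close>.\<close>

lemma \<omega>_generators:
  assumes x: "x \<in> N" and \<xi>: "\<xi> \<in> lie_algebra H MH" and \<eta>: "\<eta> \<in> lie_algebra H MH"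
  shows "\<omega> x (left_generator H MH S L \<xi> x) (left_generator H MH S L \<eta> x) = J\<^sub>L x (lie_bracket H MH \<xi> \<eta>)"
proof -
  let ?g = "\<lambda>\<xi>. left_generator H MH S L \<xi> x"
  note xS = N_points[OF x]
  have \<xi>T: "\<xi> \<in> tangent MH \<one>" using \<xi> by (simp add: lie_algebra_def)
  have gT: "?g \<zeta> \<in> tangent S x" if "\<zeta> \<in> lie_algebra H MH" for \<zeta>
    using orthogonal_L[OF xS] that by (auto simp: symplectic_orthogonal_def)
  have "\<omega> x (?g \<eta>) (?g \<xi>) = tderiv S x (\<lambda>y. J\<^sub>L y \<eta>) (?g \<xi>)"
    using momentum_L xS \<eta> gT[OF \<xi>] by (simp add: momentum_map_def)
  also have "\<dots> = tderiv MH \<one> (\<lambda>h. J\<^sub>L (L h x) \<eta>) \<xi>"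
    using tderiv_compose[OF smooth_atlas S orbit_map(1)[OF x] \<xi>T, of "\<lambda>y. J\<^sub>L y \<eta>"] smooth_at_J_L[OF x \<eta>]
    by (simp add: left_generator_def L_one[OF x])
  also have "\<dots> = tderiv MH \<one> (\<lambda>h. coadjoint_action H MH h (J\<^sub>L x) \<eta>) \<xi>"
    by (rule tderiv_cong[OF smooth_atlas _ \<xi>T])
      (simp, rule eventually_mono[OF eventually_carrier], simp add: J_L_L[OF x])
  also have "\<dots> = - J\<^sub>L x (lie_bracket H MH \<xi> \<eta>)"
    by (rule coadjoint_derivative[OF J_L_dual[OF x] \<xi> \<eta>])
  finally show ?thesis
    using symplectic xS gT[OF \<xi>] gT[OF \<eta>] unfolding symplectic_form_def is_two_form_def by (metis minus_equation_iff)
qed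

lemma \<omega>\<^sub>Q_generators:
  assumes x: "x \<in> N" and \<xi>: "\<xi> \<in> lie_algebra H MH" and \<eta>: "\<eta> \<in> lie_algebra H MH"
  shows "\<omega>\<^sub>Q (\<pi> x) (genQ \<xi> x) (genQ \<eta> x) = J\<^sub>L x (lie_bracket H MH \<xi> \<eta>)"
proof -
  have "\<omega>\<^sub>Q (\<pi> x) (genQ \<xi> x) (genQ \<eta> x) = restrict_form S \<omega> N x (genN \<xi> x) (genN \<eta> x)"
    unfolding genQ_def using reduced generators(1)[OF x \<xi>] generators(1)[OF x \<eta>] x
    by (simp add: pullback_eq_def)
  also have "\<dots> = \<omega> x (left_generator H MH S L \<xi> x) (left_generator H MH S L \<eta> x)"
    by (simp add: restrict_form_def pullback_form_def generators(3)[OF x] \<xi> \<eta>)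
  finally show ?thesis by (simp add: \<omega>_generators[OF assms])
qed

text \<open>Tangent vectors of \<open>N\<close> lie in \<open>ker dJ\<^sub>R = \<gg>\<^sub>S\<^sup>\<omega> = \<hh>\<^sub>S\<close>.\<close>

lemma tangent_Q:
  assumes x: "x \<in> N"
  shows "tangent Q (\<pi> x) = (\<lambda>\<xi>. genQ \<xi> x) ` lie_algebra H MH"
proof (intro equalityI subsetI)
  fix v assume v: "v \<in> tangent Q (\<pi> x)"
  note xS = N_points[OF x]
  obtain s where s: "s (\<pi> x) = x" "smooth_at Q N' s (\<pi> x)" "eventually (\<lambda>z. s z \<in> N \<and> \<pi> (s z) = z) (mnear Q (\<pi> x))"
    by (rule local_section[OF x])
  \<comment> \<open>A lift of \<open>v\<close>: the section satisfies \<open>\<pi> (s z) = z\<close>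
    near \<open>\<pi> x\<close>, so the tangent map of \<open>\<pi>\<close> sends \<open>u\<close>
    back to \<open>v\<close>.\<close>
  define u where "u = tmap Q N' s (\<pi> x) v"
  have u: "u \<in> tangent N' x" using tmap_in_tangent[OF Q(1) N' s(2) v] by (simp add: u_def s(1))
  have "tmap N' Q \<pi> (s (\<pi> x)) (tmap Q N' s (\<pi> x) v) = tmap Q Q (\<lambda>z. \<pi> (s z)) (\<pi> x) v"
    by (rule tmap_compose[OF Q(1) N' Q(1) s(2) _ v]) (use smooth_at_\<pi>[OF x] in \<open>simp add: s(1)\<close>)
  also have "\<dots> = tmap Q Q (\<lambda>z. z) (\<pi> x) v"
    by (rule tmap_cong[OF Q(1) smooth_atD(1)[OF s(2)] v]) (use s(3) in \<open>auto elim: eventually_mono\<close>)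
  finally have \<pi>u: "tmap N' Q \<pi> x u = v" by (simp add: s(1) u_def tmap_id[OF Q(1) v])
  let ?i = "tmap N' S (\<lambda>y. y) x u"
  have iT: "?i \<in> tangent S x" by (rule tmap_in_tangent[OF N' S inclusion[OF x] u])
  have "\<omega> x ?i (right_generator G MG S R \<xi> x) = 0" if \<xi>: "\<xi> \<in> lie_algebra G MG" for \<xi>
  proof -
    have gT: "right_generator G MG S R \<xi> x \<in> tangent S x"
      using orthogonal_R[OF xS] \<xi> by (auto simp: symplectic_orthogonal_def)
    have sm: "smooth_at S vector_manifold (\<lambda>y. J\<^sub>R y \<xi>) x"
      using momentum_R xS \<xi> smooth_fun_iff_smooth_at[OF S] by (auto simp: momentum_map_def)
    have "\<omega> x (right_generator G MG S R \<xi> x) ?i = tderiv S x (\<lambda>y. J\<^sub>R y \<xi>) ?i"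
      using momentum_R xS \<xi> iT by (simp add: momentum_map_def)
    also have "\<dots> = tderiv N' x (\<lambda>y. J\<^sub>R y \<xi>) u"
      using tderiv_compose[OF N' S inclusion[OF x] u sm] .
    also have "\<dots> = 0"
      by (rule tderiv_const[OF N' _ u, of _ "\<sigma> \<xi>"])
        (use x eventually_mnear_points[OF N', of x] J_R_N in \<open>auto elim!: eventually_mono\<close>)
    finally show ?thesis
      using symplectic xS gT iT unfolding symplectic_form_def is_two_form_def by (metis neg_equal_0_iff_equal)
  qed
  then have "?i \<in> (\<lambda>\<xi>. left_generator H MH S L \<xi> x) ` lie_algebra H MH"
    using orthogonal_L[OF xS] iT by (auto simp: symplectic_orthogonal_def)
  then obtain \<xi> where \<xi>: "\<xi> \<in> lie_algebra H MH" "?i = tmap N' S (\<lambda>y. y) x (genN \<xi> x)"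
    using generators(3)[OF x] by auto
  \<comment> \<open>The equality found in the tangent space of \<open>S\<close> descends to
    \<open>N\<close> because the inclusion has an injective tangent map.\<close>
  have "u = genN \<xi> x" by (rule tmap_inclusion_inj[OF S N x u generators(1)[OF x \<xi>(1)] \<xi>(2)])
  then have "v = genQ \<xi> x" using \<pi>u by (simp add: genQ_def)
  then show "v \<in> (\<lambda>\<xi>. genQ \<xi> x) ` lie_algebra H MH" using \<xi>(1) by blast
qed (use generators(2)[OF x] in auto)

lemma inj_on_\<Phi>: "inj_on \<Phi> (\<pi> ` N)"
  using \<pi>_eq_iff by (auto simp: inj_on_def \<Phi>_\<pi>)

end

section \<open>One component of the reduced space, transported to a coadjoint orbit\<close>

locale reduced_dual_pair_component = reduced_dual_pair +
  fixes x\<^sub>0 assumes x\<^sub>0: "x\<^sub>0 \<in> N"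
begin

abbreviation "C \<equiv> \<pi> ` component x\<^sub>0"

sublocale P: pushed_manifold Q C \<Phi>
proof
  show "inj_on \<Phi> C" using inj_on_\<Phi> component(2)[OF x\<^sub>0] by (auto intro: inj_on_subset)
qed (auto intro: Q openin_\<pi>_component x\<^sub>0)

abbreviation "Orb \<equiv> push_manifold Q C \<Phi>"

lemma component_N: "x \<in> component x\<^sub>0 \<Longrightarrow> x \<in> N"
  using component(2)[OF x\<^sub>0] by auto

lemma L_component:
  assumes "x \<in> component x\<^sub>0" "h \<in> carrier H"
  shows "L h x \<in> component x\<^sub>0"
proof -
  obtain k where k: "k \<in> carrier H" "x = L k x\<^sub>0" using assms(1) component(5)[OF x\<^sub>0] by auto
  have "L h x = L (h \<otimes> k) x\<^sub>0" using L_mult[OF x\<^sub>0 assms(2) k(1)] k(2) by simp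
  then show ?thesis using component(5)[OF x\<^sub>0] k(1) assms(2) by auto
qed

text \<open>The component is a single orbit of \<open>H\<close>, and \<open>\<Phi>\<close> after
  \<open>\<pi>\<close> is the equivariant map \<open>J\<^sub>L\<close>.\<close>

lemma points_Orb: "points Orb = coadjoint_orbit H MH (J\<^sub>L x\<^sub>0)"
proof -
  have "points Orb = (\<lambda>h. \<Phi> (\<pi> (L h x\<^sub>0))) ` carrier H"
    unfolding points_push component(5)[OF x\<^sub>0] by (simp add: image_image)
  also have "\<dots> = coadjoint_orbit H MH (J\<^sub>L x\<^sub>0)"
    unfolding coadjoint_orbit_def
    by (rule image_cong[OF refl]) (simp add: \<Phi>_\<pi> L_N[OF x\<^sub>0] J_L_L[OF x\<^sub>0])
  finally show ?thesis .
qed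

lemma Orb_pointE:
  assumes "\<nu> \<in> points Orb"
  obtains x where "x \<in> component x\<^sub>0" "x \<in> N" "\<nu> = \<Phi> (\<pi> x)" "\<nu> = J\<^sub>L x" "\<pi> x \<in> C"
  using assms component_N \<Phi>_\<pi> by auto

text \<open>\<open>t\<close> is a local section of \<open>\<pi>\<close> preceded by the inverse of
  \<open>\<Phi>\<close>, hence a local section of \<open>J\<^sub>L\<close>. It is kept inside the
  component of \<open>x\<^sub>0\<close>, so that moving it by \<open>H\<close> and projecting ends
  in \<open>C\<close> again.\<close>

lemma section_Orb:
  assumes x: "x \<in> component x\<^sub>0"
  obtains t where "smooth_at Orb N' t (\<Phi> (\<pi> x))" "t (\<Phi> (\<pi> x)) = x"
    "eventually (\<lambda>\<nu>. \<nu> \<in> points Orb \<and> t \<nu> \<in> component x\<^sub>0 \<and> \<nu> = J\<^sub>L (t \<nu>)) (mnear Orb (\<Phi> (\<pi> x)))"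
proof -
  note xN = component_N[OF x]
  have \<pi>x: "\<pi> x \<in> C" using x by auto
  obtain s where s: "s (\<pi> x) = x" "smooth_at Q N' s (\<pi> x)" "eventually (\<lambda>z. s z \<in> N \<and> \<pi> (s z) = z) (mnear Q (\<pi> x))"
    by (rule local_section[OF xN])
  have s': "smooth_at Q N' s (P.\<psi> (\<Phi> (\<pi> x)))" using s(2) P.psi_phi[OF \<pi>x] by simp
  note t = smooth_at_compose[where f = P.\<psi>, OF P.smooth_atlas Q(1) N' P.smooth_at_psi[OF \<pi>x] s']
  have t0: "s (P.\<psi> (\<Phi> (\<pi> x))) = x" using s(1) P.psi_phi[OF \<pi>x] by simp
  have "eventually (\<lambda>z. z \<in> component x\<^sub>0) (mnear N' (s (P.\<psi> (\<Phi> (\<pi> x)))))"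
    using component(4)[OF x\<^sub>0] x unfolding t0 openin_iff_nhdsin by blast
  then have 1: "eventually (\<lambda>\<nu>. s (P.\<psi> \<nu>) \<in> component x\<^sub>0) (mnear Orb (\<Phi> (\<pi> x)))"
    by (rule eventually_compose_filterlim[OF _ smooth_atD(3)[OF t]])
  have "eventually (\<lambda>z. \<pi> (s z) = z) (mnear Q (P.\<psi> (\<Phi> (\<pi> x))))"
    unfolding P.psi_phi[OF \<pi>x] using s(3) by (auto elim: eventually_mono)
  then have 2: "eventually (\<lambda>\<nu>. \<pi> (s (P.\<psi> \<nu>)) = P.\<psi> \<nu>) (mnear Orb (\<Phi> (\<pi> x)))"
    by (rule eventually_compose_filterlim[OF _ smooth_atD(3)[OF P.smooth_at_psi[OF \<pi>x]]])
  have "eventually (\<lambda>\<nu>. \<nu> \<in> points Orb \<and> s (P.\<psi> \<nu>) \<in> component x\<^sub>0 \<and> \<nu> = J\<^sub>L (s (P.\<psi> \<nu>))) (mnear Orb (\<Phi> (\<pi> x)))"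
    using 1 2 P.eventually_phi_psi[OF \<pi>x] eventually_mnear_points[OF P.smooth_atlas]
  proof eventually_elim
    case (elim \<nu>)
    then show ?case using \<Phi>_\<pi>[OF component_N[OF elim(1)]] by simp
  qed
  from that[OF t t0 this] show thesis .
qed

text \<open>Near a given point the coadjoint action is \<open>\<Phi> (\<pi> (L h (t \<nu>)))\<close>
  with a local section \<open>t\<close> of \<open>J\<^sub>L\<close>, a composition of smooth
  maps.\<close>

lemma smooth_action: "smooth_left_action H MH Orb (coadjoint_action H MH)"
  unfolding smooth_left_action_def
proof (intro conjI ballI)
  let ?P = "prod_manifold MH Orb"
  note P = smooth_atlas_prod[OF smooth_atlas P.smooth_atlas]
  show "smooth_map ?P Orb (\<lambda>(h, \<nu>). coadjoint_action H MH h \<nu>)"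
    unfolding smooth_map_iff_smooth_at[OF P P.smooth_atlas]
  proof
    fix p assume "p \<in> points ?P"
    then obtain h \<nu> where p: "p = (h, \<nu>)" "h \<in> carrier H" "\<nu> \<in> points Orb" by auto
    obtain x where x: "x \<in> component x\<^sub>0" "x \<in> N" "\<nu> = \<Phi> (\<pi> x)" by (rule Orb_pointE[OF p(3)])
    obtain t where t: "smooth_at Orb N' t (\<Phi> (\<pi> x))" "t (\<Phi> (\<pi> x)) = x"
      "eventually (\<lambda>\<nu>. \<nu> \<in> points Orb \<and> t \<nu> \<in> component x\<^sub>0 \<and> \<nu> = J\<^sub>L (t \<nu>)) (mnear Orb (\<Phi> (\<pi> x)))"
      by (rule section_Orb[OF x(1)])
    have fst: "smooth_at ?P MH fst p" and snd: "smooth_at ?P Orb snd p"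
      unfolding p(1) by (rule smooth_at_fst_snd[OF smooth_atlas P.smooth_atlas]; use p in simp)+
    have sp: "snd p = \<Phi> (\<pi> x)" by (simp add: p x)
    have 1: "smooth_at ?P N' (\<lambda>q. t (snd q)) p"
      by (rule smooth_at_compose[OF P P.smooth_atlas N' snd]) (use t(1) in \<open>simp add: sp\<close>)
    have 2: "smooth_at ?P S (\<lambda>q. t (snd q)) p"
      using smooth_at_compose[OF P N' S 1, of "\<lambda>y. y"] inclusion[OF x(2)] by (simp add: sp t(2))
    have 3: "smooth_at ?P S (\<lambda>q. L (fst q) (t (snd q))) p"
      by (rule smooth_at_left_action[OF S action P fst 2])
    have ev: "eventually (\<lambda>q. fst q \<in> carrier H \<and> t (snd q) \<in> component x\<^sub>0 \<and> snd q = J\<^sub>L (t (snd q))) (mnear ?P p)"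
      using eventually_compose_filterlim[OF t(3) smooth_atD(3)[OF snd, unfolded sp]]
        eventually_mnear_points[OF P, of p] by eventually_elim auto
    \<comment> \<open>The action is known to be smooth into \<open>S\<close>; it has to be
      corestricted to the submanifold \<open>N\<close> before \<open>\<pi>\<close> can be
      applied.\<close>
    have 4: "smooth_at ?P N' (\<lambda>q. L (fst q) (t (snd q))) p"
      by (rule smooth_at_into_submanifold[OF P S N 3]) (use ev L_N component_N in \<open>auto elim!: eventually_mono\<close>)
    have Lx: "L (fst p) (t (snd p)) = L h x" by (simp add: sp t(2), simp add: p(1))
    have LC: "L h x \<in> component x\<^sub>0" by (rule L_component[OF x(1) p(2)])
    have 5: "smooth_at ?P Q (\<lambda>q. \<pi> (L (fst q) (t (snd q)))) p"
      by (rule smooth_at_compose[OF P N' Q(1) 4]) (use smooth_at_\<pi>[OF component_N[OF LC]] in \<open>simp add: Lx\<close>)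
    have 6: "smooth_at ?P Orb (\<lambda>q. \<Phi> (\<pi> (L (fst q) (t (snd q))))) p"
      by (rule smooth_at_compose[OF P Q(1) P.smooth_atlas 5]) (use P.smooth_at_phi LC in \<open>simp add: Lx\<close>)
    show "smooth_at ?P Orb (\<lambda>(h, \<nu>). coadjoint_action H MH h \<nu>) p"
    proof (rule smooth_at_cong[OF P P.smooth_atlas 6])
      show "\<forall>\<^sub>F q in mnear ?P p. \<Phi> (\<pi> (L (fst q) (t (snd q)))) = (case q of (h, \<nu>) \<Rightarrow> coadjoint_action H MH h \<nu>)"
        using ev
      proof eventually_elim
        case (elim q)
        then have "t (snd q) \<in> N" "fst q \<in> carrier H" using component_N by auto
        then show ?case using elim by (simp add: \<Phi>_\<pi> L_N J_L_L case_prod_unfold)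
      qed
    qed
  qed
next
  \<comment> \<open>Every point of the orbit is a value of \<open>J\<^sub>L\<close>, so the action
    laws are transferred from \<open>L\<close> by equivariance.\<close>
  fix \<nu> assume "\<nu> \<in> points Orb"
  then obtain x where x: "x \<in> N" "\<nu> = J\<^sub>L x" by (rule Orb_pointE)
  show "coadjoint_action H MH \<one> \<nu> = \<nu>" using J_L_L[OF x(1), of \<one>] x by (simp add: L_one)
  fix h k assume hk: "h \<in> carrier H" "k \<in> carrier H"
  show "coadjoint_action H MH (h \<otimes> k) \<nu> = coadjoint_action H MH h (coadjoint_action H MH k \<nu>)"
    using J_L_L[OF x(1), of "h \<otimes> k"] J_L_L[OF L_N[OF x(1) hk(2)] hk(1)] J_L_L[OF x(1) hk(2)] hk
    by (simp add: x(2) L_mult[OF x(1)])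
qed

section \<open>Tangent spaces, evaluations and the symplectic form of the orbit\<close>

lemma generator_Orb:
  assumes x: "x \<in> component x\<^sub>0" and \<xi>: "\<xi> \<in> lie_algebra H MH"
  shows "left_generator H MH Orb (coadjoint_action H MH) \<xi> (\<Phi> (\<pi> x)) = tmap Q Orb \<Phi> (\<pi> x) (genQ \<xi> x)"
proof -
  note xN = component_N[OF x]
  have \<xi>T: "\<xi> \<in> tangent MH \<one>" using \<xi> by (simp add: lie_algebra_def)
  have "smooth_at MH Q (\<lambda>h. \<pi> (L h x)) \<one>"
    by (rule smooth_at_compose[OF smooth_atlas N' Q(1) orbit_map(2)[OF xN]])
      (use smooth_at_\<pi>[OF xN] in \<open>simp add: L_one[OF xN]\<close>)
  from tmap_compose[OF smooth_atlas Q(1) P.smooth_atlas this _ \<xi>T, of \<Phi>]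
  have "tmap Q Orb \<Phi> (\<pi> x) (genQ \<xi> x) = tmap MH Orb (\<lambda>h. \<Phi> (\<pi> (L h x))) \<one> \<xi>"
    using P.smooth_at_phi x generators(4)[OF xN \<xi>] by (simp add: L_one[OF xN])
  also have "\<dots> = tmap MH Orb (\<lambda>h. coadjoint_action H MH h (\<Phi> (\<pi> x))) \<one> \<xi>"
    by (rule tmap_cong[OF smooth_atlas _ \<xi>T])
      (simp, rule eventually_mono[OF eventually_carrier], simp add: \<Phi>_\<pi> L_N xN J_L_L)
  finally show ?thesis by (simp add: left_generator_def)
qed

lemma tangent_Orb:
  assumes x: "x \<in> component x\<^sub>0"
  shows "tangent Orb (\<Phi> (\<pi> x)) =
    (\<lambda>\<xi>. left_generator H MH Orb (coadjoint_action H MH) \<xi> (\<Phi> (\<pi> x))) ` lie_algebra H MH"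
proof (intro equalityI subsetI)
  note xN = component_N[OF x]
  have \<pi>x: "\<pi> x \<in> C" using x by auto
  {
    fix v assume v: "v \<in> tangent Orb (\<Phi> (\<pi> x))"
    have "tmap Orb Q P.\<psi> (\<Phi> (\<pi> x)) v \<in> tangent Q (\<pi> x)"
      using tmap_in_tangent[OF P.smooth_atlas Q(1) P.smooth_at_psi[OF \<pi>x] v] P.psi_phi[OF \<pi>x] by simp
    then obtain \<xi> where \<xi>: "\<xi> \<in> lie_algebra H MH" "tmap Orb Q P.\<psi> (\<Phi> (\<pi> x)) v = genQ \<xi> x"
      unfolding tangent_Q[OF xN] by auto
    have "v = left_generator H MH Orb (coadjoint_action H MH) \<xi> (\<Phi> (\<pi> x))"
      using P.tmap_phi_psi[OF \<pi>x v] \<xi> generator_Orb[OF x \<xi>(1)] by simp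
    with \<xi>(1) show "v \<in> (\<lambda>\<xi>. left_generator H MH Orb (coadjoint_action H MH) \<xi> (\<Phi> (\<pi> x))) ` lie_algebra H MH" by blast
  }
  fix v assume "v \<in> (\<lambda>\<xi>. left_generator H MH Orb (coadjoint_action H MH) \<xi> (\<Phi> (\<pi> x))) ` lie_algebra H MH"
  then obtain \<xi> where \<xi>: "\<xi> \<in> lie_algebra H MH" "v = tmap Q Orb \<Phi> (\<pi> x) (genQ \<xi> x)"
    using generator_Orb[OF x] by auto
  show "v \<in> tangent Orb (\<Phi> (\<pi> x))"
    unfolding \<xi>(2) by (rule tmap_in_tangent[OF Q(1) P.smooth_atlas P.smooth_at_phi[OF \<pi>x] generators(2)[OF xN \<xi>(1)]])
qed

text \<open>Near the point, evaluation at \<eta> is \<open>J\<^sub>L (t \<nu>) \<eta>\<close> with a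
  local section \<open>t\<close>, and the components of a momentum map are smooth.\<close>

lemma smooth_at_evaluation:
  assumes x: "x \<in> component x\<^sub>0" and \<eta>: "\<eta> \<in> lie_algebra H MH"
  shows "smooth_at Orb vector_manifold (\<lambda>\<nu>. \<nu> \<eta>) (\<Phi> (\<pi> x))"
proof -
  note xN = component_N[OF x]
  obtain t where t: "smooth_at Orb N' t (\<Phi> (\<pi> x))" "t (\<Phi> (\<pi> x)) = x"
    "eventually (\<lambda>\<nu>. \<nu> \<in> points Orb \<and> t \<nu> \<in> component x\<^sub>0 \<and> \<nu> = J\<^sub>L (t \<nu>)) (mnear Orb (\<Phi> (\<pi> x)))"
    by (rule section_Orb[OF x])
  have "smooth_at Orb S t (\<Phi> (\<pi> x))"
    using smooth_at_compose[OF P.smooth_atlas N' S t(1), of "\<lambda>y. y"] inclusion[OF xN] by (simp add: t(2))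
  from smooth_at_compose[OF P.smooth_atlas S smooth_atlas_vector this, of "\<lambda>y. J\<^sub>L y \<eta>"]
  have "smooth_at Orb vector_manifold (\<lambda>\<nu>. J\<^sub>L (t \<nu>) \<eta>) (\<Phi> (\<pi> x))"
    using smooth_at_J_L[OF xN \<eta>] by (simp add: t(2))
  then show ?thesis
    by (rule smooth_at_cong[OF P.smooth_atlas smooth_atlas_vector])
      (use t(3) in eventually_elim, metis)
qed

lemma tderiv_evaluation:
  assumes x: "x \<in> component x\<^sub>0" and \<xi>: "\<xi> \<in> lie_algebra H MH" and \<eta>: "\<eta> \<in> lie_algebra H MH"
  shows "tderiv Orb (\<Phi> (\<pi> x)) (\<lambda>\<kappa>. \<kappa> \<eta>) (left_generator H MH Orb (coadjoint_action H MH) \<xi> (\<Phi> (\<pi> x)))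
    = - J\<^sub>L x (lie_bracket H MH \<xi> \<eta>)"
proof -
  note xN = component_N[OF x]
  have \<xi>T: "\<xi> \<in> tangent MH \<one>" using \<xi> by (simp add: lie_algebra_def)
  have \<nu>: "\<Phi> (\<pi> x) \<in> points Orb" using x by auto
  have s: "smooth_at MH Orb (\<lambda>h. coadjoint_action H MH h (\<Phi> (\<pi> x))) \<one>"
    by (intro smooth_at_left_action[OF P.smooth_atlas smooth_action smooth_atlas] smooth_at_id smooth_at_const smooth_atlas P.smooth_atlas \<nu>)
      auto
  have 1: "coadjoint_action H MH \<one> (\<Phi> (\<pi> x)) = \<Phi> (\<pi> x)"
    using smooth_action \<nu> unfolding smooth_left_action_def by blast
  have "tderiv Orb (\<Phi> (\<pi> x)) (\<lambda>\<kappa>. \<kappa> \<eta>) (left_generator H MH Orb (coadjoint_action H MH) \<xi> (\<Phi> (\<pi> x)))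
      = tderiv MH \<one> (\<lambda>h. coadjoint_action H MH h (\<Phi> (\<pi> x)) \<eta>) \<xi>"
    using tderiv_compose[OF smooth_atlas P.smooth_atlas s \<xi>T, of "\<lambda>\<kappa>. \<kappa> \<eta>"] smooth_at_evaluation[OF x \<eta>]
    by (simp add: 1 left_generator_def)
  then show ?thesis
    using coadjoint_derivative[OF J_L_dual[OF xN] \<xi> \<eta>] by (simp add: \<Phi>_\<pi>[OF xN])
qed

lemma orbit_manifold_Orb: "orbit_manifold H MH (J\<^sub>L x\<^sub>0) Orb"
  unfolding orbit_manifold_def
proof (intro conjI ballI impI)
  show "is_manifold Orb" by (rule P.is_manifold[OF Q(2)])
  show "points Orb = coadjoint_orbit H MH (J\<^sub>L x\<^sub>0)" by (rule points_Orb)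
  show "smooth_left_action H MH Orb (coadjoint_action H MH)" by (rule smooth_action)
next
  fix \<nu> assume "\<nu> \<in> points Orb"
  then obtain x where x: "x \<in> component x\<^sub>0" "\<nu> = \<Phi> (\<pi> x)" by (rule Orb_pointE)
  show "tangent Orb \<nu> = (\<lambda>\<xi>. left_generator H MH Orb (coadjoint_action H MH) \<xi> \<nu>) ` lie_algebra H MH"
    unfolding x(2) by (rule tangent_Orb[OF x(1)])
next
  fix \<eta> assume \<eta>: "\<eta> \<in> lie_algebra H MH"
  show "smooth_fun Orb (\<lambda>\<nu>. \<nu> \<eta>)"
    unfolding smooth_fun_iff_smooth_at[OF P.smooth_atlas] using smooth_at_evaluation[OF _ \<eta>] by auto
next
  fix \<nu> v assume "\<nu> \<in> points Orb" and v: "v \<in> tangent Orb \<nu>"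
    and 0: "\<forall>\<eta>\<in>lie_algebra H MH. tderiv Orb \<nu> (\<lambda>\<kappa>. \<kappa> \<eta>) v = 0"
  then obtain x where x: "x \<in> component x\<^sub>0" "x \<in> N" "\<nu> = \<Phi> (\<pi> x)" by (metis Orb_pointE)
  \<comment> \<open>The derivatives of the evaluations along this generator are, up to sign, the
    values of \<open>\<omega>\<^sub>Q\<close> on \<open>genQ \<xi> x\<close> and the other
    generators. These span the tangent space, so their vanishing makes \<open>genQ \<xi> x\<close>
    zero by nondegeneracy.\<close>
  obtain \<xi> where \<xi>: "\<xi> \<in> lie_algebra H MH" "v = left_generator H MH Orb (coadjoint_action H MH) \<xi> \<nu>"
    using v unfolding x(3) tangent_Orb[OF x(1)] by auto
  have "\<omega>\<^sub>Q (\<pi> x) (genQ \<xi> x) (genQ \<eta> x) = 0" if \<eta>: "\<eta> \<in> lie_algebra H MH" for \<eta>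
    using 0 \<eta> tderiv_evaluation[OF x(1) \<xi>(1) \<eta>] \<omega>\<^sub>Q_generators[OF x(2) \<xi>(1) \<eta>] unfolding \<xi>(2) x(3) by simp
  then have "\<forall>u\<in>tangent Q (\<pi> x). \<omega>\<^sub>Q (\<pi> x) (genQ \<xi> x) u = 0" unfolding tangent_Q[OF x(2)] by auto
  moreover have "\<pi> x \<in> points Q" using x(2) by (simp add: points_Q)
  ultimately have "genQ \<xi> x = (\<lambda>_. 0)"
    using symplectic_Q generators(2)[OF x(2) \<xi>(1)] unfolding symplectic_form_def by blast
  then show "v = (\<lambda>_. 0)" unfolding \<xi>(2) x(3) generator_Orb[OF x(1) \<xi>(1)] by (simp add: tmap_zero)
qed

abbreviation "\<omega>\<^sub>O \<equiv> pullback_form Orb Q \<omega>\<^sub>Q P.\<psi>"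

text \<open>The tangent map of \<open>P.\<psi>\<close> takes the generators on the orbit back to
  those on the reduced space, where the formula is already known.\<close>

lemma orbit_symplectic_form_Orb: "orbit_symplectic_form H MH Orb \<omega>\<^sub>O"
  unfolding orbit_symplectic_form_def
proof (intro conjI ballI)
  show "symplectic_form Orb \<omega>\<^sub>O" by (rule P.symplectic_form_push[OF symplectic_Q])
  fix \<nu> \<xi> \<eta> assume "\<nu> \<in> points Orb" and \<xi>: "\<xi> \<in> lie_algebra H MH" and \<eta>: "\<eta> \<in> lie_algebra H MH"
  then obtain x where x: "x \<in> component x\<^sub>0" "x \<in> N" "\<nu> = \<Phi> (\<pi> x)" "\<nu> = J\<^sub>L x" "\<pi> x \<in> C" by (metis Orb_pointE)
  have "tmap Orb Q P.\<psi> \<nu> (left_generator H MH Orb (coadjoint_action H MH) \<zeta> \<nu>) = genQ \<zeta> x"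
    if \<zeta>: "\<zeta> \<in> lie_algebra H MH" for \<zeta>
    unfolding x(3) generator_Orb[OF x(1) \<zeta>]
    by (rule P.tmap_psi_phi[OF x(5) generators(2)[OF x(2) \<zeta>]])
  moreover have "P.\<psi> \<nu> = \<pi> x" unfolding x(3) by (rule P.psi_phi[OF x(5)])
  ultimately show "\<omega>\<^sub>O \<nu> (left_generator H MH Orb (coadjoint_action H MH) \<xi> \<nu>)
      (left_generator H MH Orb (coadjoint_action H MH) \<eta> \<nu>) = \<nu> (lie_bracket H MH \<xi> \<eta>)"
    using \<omega>\<^sub>Q_generators[OF x(2) \<xi> \<eta>] by (simp add: pullback_form_def \<xi> \<eta> x(4))
qed

end

theorem proposition2p4:
  fixes S :: "('s, 'e::lctvs) manifold" and \<omega> :: "('s, 'e) two_form"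
    and G :: "'g monoid" and MG :: "('g, 'f1::lctvs) manifold"
    and H :: "'h monoid" and MH :: "('h, 'f2::lctvs) manifold"
    and R :: "'s \<Rightarrow> 'g \<Rightarrow> 's" and L :: "'h \<Rightarrow> 's \<Rightarrow> 's"
    and J\<^sub>R :: "'s \<Rightarrow> ('g, 'f1) tvec \<Rightarrow> real" and J\<^sub>L :: "'s \<Rightarrow> ('h, 'f2) tvec \<Rightarrow> real"
    and \<sigma> :: "('g, 'f1) tvec \<Rightarrow> real"
    and S\<^sub>\<sigma> :: "('s set, 'q::lctvs) manifold" and \<omega>\<^sub>\<sigma> :: "('s set, 'q) two_form"
  defines "genR \<equiv> right_generator G MG S R"
    and "genL \<equiv> left_generator H MH S L"
    and "N \<equiv> level_set S J\<^sub>R \<sigma>"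
    and "\<pi> \<equiv> (\<lambda>x. R x ` coadjoint_isotropy G MG \<sigma>)"
  assumes symplectic_manifold: "is_manifold S" "symplectic_form S \<omega>"
    and lie_groups: "lie_group G MG" "lie_group H MH"
    and actions: "smooth_right_action G MG S R" "smooth_left_action H MH S L"
    and commuting: "\<forall>x\<in>points S. \<forall>g\<in>carrier G. \<forall>h\<in>carrier H. L h (R x g) = R (L h x) g"
    and symplectic_actions: "\<forall>g\<in>carrier G. pullback_eq S \<omega> S \<omega> (\<lambda>x. R x g)"
      "\<forall>h\<in>carrier H. pullback_eq S \<omega> S \<omega> (L h)"
    and completely_orthogonal:
      "\<forall>x\<in>points S. (\<lambda>\<xi>. genR \<xi> x) ` lie_algebra G MG =
         symplectic_orthogonal S \<omega> x ((\<lambda>\<xi>. genL \<xi> x) ` lie_algebra H MH)"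
      "\<forall>x\<in>points S. (\<lambda>\<xi>. genL \<xi> x) ` lie_algebra H MH =
         symplectic_orthogonal S \<omega> x ((\<lambda>\<xi>. genR \<xi> x) ` lie_algebra G MG)"
    and momentum_maps: "momentum_map G MG S \<omega> genR J\<^sub>R" "momentum_map H MH S \<omega> genL J\<^sub>L"
    and equivariance:
      "\<forall>x\<in>points S. \<forall>g\<in>carrier G. J\<^sub>R (R x g) = Ad_dual G MG g (J\<^sub>R x)"
      "\<forall>x\<in>points S. \<forall>h\<in>carrier H. J\<^sub>L (L h x) = coadjoint_action H MH h (J\<^sub>L x)"
    and G_transitive: "\<forall>\<tau>. transitive_on (\<lambda>x. R x ` carrier G) (level_set S J\<^sub>L \<tau>)"
    and H_connected: "connected_space (mtop MH)"
    and H_transitive: "\<forall>\<tau>. \<forall>C \<in> connected_components_of (subtopology (mtop S) (level_set S J\<^sub>R \<tau>)).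
      transitive_on (\<lambda>x. (\<lambda>h. L h x) ` carrier H) C"
    and \<sigma>: "\<sigma> \<in> lie_dual G MG"
    and level_submanifold: "is_submanifold S N"
    and quotient_manifold: "is_manifold S\<^sub>\<sigma>" "points S\<^sub>\<sigma> = \<pi> ` N"
      "submersion (submanifold S N) S\<^sub>\<sigma> \<pi>"
    and reduced_form: "symplectic_form S\<^sub>\<sigma> \<omega>\<^sub>\<sigma>"
      "pullback_eq (submanifold S N) (restrict_form S \<omega> N) S\<^sub>\<sigma> \<omega>\<^sub>\<sigma> \<pi>"
  shows "\<forall>C \<in> connected_components_of (mtop S\<^sub>\<sigma>).
    \<exists>\<mu> \<in> lie_dual H MH.
    \<exists>(Orb :: (('h, 'f2) tvec \<Rightarrow> real, 'q) manifold) \<omega>\<^sub>O \<Phi>.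
      orbit_manifold H MH \<mu> Orb \<and> orbit_symplectic_form H MH Orb \<omega>\<^sub>O \<and>
      symplectomorphism (submanifold S\<^sub>\<sigma> C) (restrict_form S\<^sub>\<sigma> \<omega>\<^sub>\<sigma> C) Orb \<omega>\<^sub>O \<Phi>"
proof
  fix C assume C: "C \<in> connected_components_of (mtop S\<^sub>\<sigma>)"
  interpret reduced_dual_pair H MH S \<omega> G MG R L J\<^sub>R J\<^sub>L \<sigma> S\<^sub>\<sigma> \<omega>\<^sub>\<sigma> N \<pi>
  proof
    show "lie_group H MH" by (rule lie_groups)
    show "smooth_atlas S" "smooth_atlas S\<^sub>\<sigma>" "Hausdorff_space (mtop S\<^sub>\<sigma>)"
      using symplectic_manifold quotient_manifold by (auto simp: is_manifold_smooth_atlas is_manifold_def)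
    show "J\<^sub>R (R x g) = Ad_dual G MG g (J\<^sub>R x)" if "x \<in> points S" "g \<in> carrier G" for x g
      using equivariance(1) that by blast
    show "J\<^sub>L (L h x) = coadjoint_action H MH h (J\<^sub>L x)" if "x \<in> points S" "h \<in> carrier H" for x h
      using equivariance(2) that by blast
    show "transitive_on (\<lambda>x. (\<lambda>h. L h x) ` carrier H) K"
      if "K \<in> connected_components_of (subtopology (mtop S) N)" for K
      using H_transitive that unfolding N_def by blast
  qed (use symplectic_manifold actions completely_orthogonal momentum_maps G_transitive level_submanifold
      quotient_manifold reduced_form in \<open>simp_all add: genR_def genL_def N_def \<pi>_def\<close>)
  obtain x where x: "x \<in> N" "C = \<pi> ` component x" by (rule component_of_Q[OF C])
  interpret reduced_dual_pair_component H MH S \<omega> G MG R L J\<^sub>R J\<^sub>L \<sigma> S\<^sub>\<sigma> \<omega>\<^sub>\<sigma> N \<pi> x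
    by unfold_locales (rule x(1))
  \<comment> \<open>The witnesses are \<open>\<mu> = J\<^sub>L x\<close>, the transported structure
    and form, and the map \<open>\<Phi>\<close> of the locale.\<close>
  show "\<exists>\<mu> \<in> lie_dual H MH.
    \<exists>(Orb :: (('h, 'f2) tvec \<Rightarrow> real, 'q) manifold) \<omega>\<^sub>O \<Phi>.
      orbit_manifold H MH \<mu> Orb \<and> orbit_symplectic_form H MH Orb \<omega>\<^sub>O \<and>
      symplectomorphism (submanifold S\<^sub>\<sigma> C) (restrict_form S\<^sub>\<sigma> \<omega>\<^sub>\<sigma> C) Orb \<omega>\<^sub>O \<Phi>"
    unfolding x(2)
    using J_L_dual[OF x(1)] orbit_manifold_Orb orbit_symplectic_form_Orb P.symplectomorphism_push by blast
qed

end
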